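(* Let $\mathcal D\subset \mathcal B(\ell^2(\mathbb N))$ be the algebra of diagonal operators and let $s:\mathcal D\to\mathbb C$ be a pure state. Then there exists a unique state $\tilde s:\mathcal B(\ell^2(\mathbb N))\to\mathbb C$ that extends $s$.
   Context: $\ell^2(\mathbb N)$ is the complex Hilbert space of square-summable sequences and $\mathcal B(\ell^2(\mathbb N))$ is the algebra of bounded linear operators on it. $\mathcal D$ is the subalgebra of operators whose matrix with respect to the standard orthonormal basis is diagonal. For $\mathcal A=\mathcal D$ or $\mathcal A=\mathcal B(\ell^2(\mathbb N))$, a state on $\mathcal A$ is a bounded linear functional $s:\mathcal A\to\mathbb C$ that is positive (i.e. $A\ge 0$ implies $s(A)\ge 0$) and satisfies $s(\mathbf I)=1$, where $\mathbf I$ is the identity operator. A state is pure if it is not a (nontrivial) convex combination of other states. *)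

theory Defs
  imports "HOL-Analysis.Analysis" "HOL-Library.Complex_Order"
begin

section \<open>The complex Hilbert space of square-summable sequences\<close>

typedef ell2 = "{x :: nat \<Rightarrow> complex. summable (\<lambda>n. (cmod (x n))\<^sup>2)}"
  morphisms coord Abs_ell2
  by (rule exI[of _ "\<lambda>_. 0"]) simp

setup_lifting type_definition_ell2

lemma square_summable_mult:
  fixes x y :: "nat \<Rightarrow> complex"
  assumes "summable (\<lambda>n. (cmod (x n))\<^sup>2)" "summable (\<lambda>n. (cmod (y n))\<^sup>2)"
  shows "summable (\<lambda>n. cmod (x n) * cmod (y n))"
proof (rule summable_comparison_test'[where N = 0])
  show "summable (\<lambda>n. (cmod (x n))\<^sup>2 + (cmod (y n))\<^sup>2)"
    using assms by (rule summable_add)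
  fix n
  have "2 * cmod (x n) * cmod (y n) \<le> (cmod (x n))\<^sup>2 + (cmod (y n))\<^sup>2"
    by (rule sum_squares_bound)
  moreover have "0 \<le> cmod (x n) * cmod (y n)" by simp
  ultimately show "norm (cmod (x n) * cmod (y n)) \<le> (cmod (x n))\<^sup>2 + (cmod (y n))\<^sup>2"
    unfolding real_norm_def by linarith
qed

lemma square_summable_add:
  fixes x y :: "nat \<Rightarrow> complex"
  assumes "summable (\<lambda>n. (cmod (x n))\<^sup>2)" "summable (\<lambda>n. (cmod (y n))\<^sup>2)"
  shows "summable (\<lambda>n. (cmod (x n + y n))\<^sup>2)"
proof (rule summable_comparison_test'[where N = 0])
  show "summable (\<lambda>n. ((cmod (x n))\<^sup>2 + (cmod (y n))\<^sup>2) + 2 * (cmod (x n) * cmod (y n)))"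
    by (intro summable_add summable_mult square_summable_mult assms)
  fix n
  have "(cmod (x n + y n))\<^sup>2 \<le> (cmod (x n) + cmod (y n))\<^sup>2"
    by (intro power_mono norm_triangle_ineq) simp
  then show "norm ((cmod (x n + y n))\<^sup>2) \<le> ((cmod (x n))\<^sup>2 + (cmod (y n))\<^sup>2) + 2 * (cmod (x n) * cmod (y n))"
    by (simp add: power2_sum)
qed

lemma square_summable_mult_const:
  fixes x :: "nat \<Rightarrow> complex"
  assumes "summable (\<lambda>n. (cmod (x n))\<^sup>2)"
  shows "summable (\<lambda>n. (cmod (c * x n))\<^sup>2)"
  using summable_mult[OF assms, of "(cmod c)\<^sup>2"] by (simp add: norm_mult power_mult_distrib)

lift_definition scaleC_ell2 :: "complex \<Rightarrow> ell2 \<Rightarrow> ell2"  (infixr \<open>*\<^sub>C\<close> 75)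
  is "\<lambda>c x n. c * x n"
  by (rule square_summable_mult_const)

lift_definition cinner :: "ell2 \<Rightarrow> ell2 \<Rightarrow> complex"
  is "\<lambda>x y. \<Sum>n. cnj (x n) * y n" .

lift_definition ket :: "nat \<Rightarrow> ell2"
  is "\<lambda>j n. if n = j then 1 else 0"
proof -
  fix j :: nat
  have "summable (\<lambda>n. (if n = j then 1 else 0 :: real))" by simp
  moreover have "(cmod (if n = j then 1 else 0))\<^sup>2 = (if n = j then 1 else 0)" for n
    by simp
  ultimately show "summable (\<lambda>n. (cmod (if n = j then 1 else 0))\<^sup>2)" by presburger
qed

lemma summable_inner:
  fixes x y :: "nat \<Rightarrow> complex"
  assumes "summable (\<lambda>n. (cmod (x n))\<^sup>2)" "summable (\<lambda>n. (cmod (y n))\<^sup>2)"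
  shows "summable (\<lambda>n. x n \<bullet> y n)"
  using square_summable_mult[OF assms]
  by (rule summable_comparison_test'[where N = 0]) (simp add: Cauchy_Schwarz_ineq2)

text \<open>The underlying real inner product is the real part of \<^const>\<open>cinner\<close>; the induced
  norm is the usual one.\<close>

instantiation ell2 :: real_inner
begin

lift_definition zero_ell2 :: ell2 is "\<lambda>_. 0" by simp

lift_definition plus_ell2 :: "ell2 \<Rightarrow> ell2 \<Rightarrow> ell2" is "\<lambda>x y n. x n + y n"
  by (rule square_summable_add)

lift_definition uminus_ell2 :: "ell2 \<Rightarrow> ell2" is "\<lambda>x n. - x n" by simp

lift_definition minus_ell2 :: "ell2 \<Rightarrow> ell2 \<Rightarrow> ell2" is "\<lambda>x y n. x n - y n"
  using square_summable_add[where y = "\<lambda>n. - y n" for y] by simp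

lift_definition scaleR_ell2 :: "real \<Rightarrow> ell2 \<Rightarrow> ell2" is "\<lambda>r x n. r *\<^sub>R x n"
  by (simp add: scaleR_conv_of_real square_summable_mult_const del: norm_mult)

lift_definition inner_ell2 :: "ell2 \<Rightarrow> ell2 \<Rightarrow> real" is "\<lambda>x y. \<Sum>n. x n \<bullet> y n" .

definition norm_ell2 :: "ell2 \<Rightarrow> real" where "norm_ell2 x = sqrt (x \<bullet> x)"

definition dist_ell2 :: "ell2 \<Rightarrow> ell2 \<Rightarrow> real" where "dist_ell2 x y = norm (x - y)"

definition sgn_ell2 :: "ell2 \<Rightarrow> ell2" where "sgn_ell2 x = inverse (norm x) *\<^sub>R x"

definition [code del]:
  "(uniformity :: (ell2 \<times> ell2) filter) = (INF e\<in>{0 <..}. principal {(x, y). dist x y < e})"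

definition open_ell2 :: "ell2 set \<Rightarrow> bool"
  where [code del]: "open_ell2 S = (\<forall>x\<in>S. \<forall>\<^sub>F (x', y) in uniformity. x' = x \<longrightarrow> y \<in> S)"

instance
proof
  fix x y z :: ell2 and a b :: real
  show "x + y + z = x + (y + z)" by transfer (simp add: add.assoc)
  show "x + y = y + x" by transfer (simp add: add.commute)
  show "0 + x = x" by transfer simp
  show "- x + x = 0" by transfer simp
  show "x - y = x + - y" by transfer simp
  show "a *\<^sub>R (x + y) = a *\<^sub>R x + a *\<^sub>R y" by transfer (simp add: algebra_simps)
  show "(a + b) *\<^sub>R x = a *\<^sub>R x + b *\<^sub>R x" by transfer (simp add: algebra_simps)
  show "a *\<^sub>R b *\<^sub>R x = (a * b) *\<^sub>R x" by transfer simp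
  show "1 *\<^sub>R x = x" by transfer simp
  show "dist x y = norm (x - y)" by (rule dist_ell2_def)
  show "sgn x = inverse (norm x) *\<^sub>R x" by (rule sgn_ell2_def)
  show "(uniformity :: (ell2 \<times> ell2) filter) = (INF e\<in>{0 <..}. principal {(x, y). dist x y < e})"
    by (rule uniformity_ell2_def)
  show "open U = (\<forall>x\<in>U. \<forall>\<^sub>F (x', y) in uniformity. x' = x \<longrightarrow> y \<in> U)" for U :: "ell2 set"
    by (rule open_ell2_def)
  show "x \<bullet> y = y \<bullet> x" by transfer (simp add: inner_commute)
  show "(x + y) \<bullet> z = x \<bullet> z + y \<bullet> z"
    by transfer (simp add: inner_add_left suminf_add summable_inner)
  show "(a *\<^sub>R x) \<bullet> y = a * (x \<bullet> y)"
    by transfer (simp add: suminf_mult summable_inner)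
  show "0 \<le> x \<bullet> x" by transfer (simp add: suminf_nonneg summable_inner)
  show "x \<bullet> x = 0 \<longleftrightarrow> x = 0"
    by transfer (subst suminf_eq_zero_iff, auto simp: summable_inner)
  show "norm x = sqrt (x \<bullet> x)" by (rule norm_ell2_def)
qed

end

lemma norm_ell2_eq: "norm x = sqrt (\<Sum>n. (cmod (coord x n))\<^sup>2)"
  unfolding norm_ell2_def by transfer (simp add: dot_square_norm)

lemma cinner_self: "cinner x x = complex_of_real ((norm x)\<^sup>2)"
proof -
  have s: "summable (\<lambda>n. (cmod (coord x n))\<^sup>2)" using coord[of x] by simp
  have "cinner x x = (\<Sum>n. complex_of_real ((cmod (coord x n))\<^sup>2))"
    unfolding cinner.rep_eq by (simp only: complex_norm_square mult.commute)
  also have "\<dots> = complex_of_real (\<Sum>n. (cmod (coord x n))\<^sup>2)"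
    using s by (simp only: suminf_of_real)
  also have "(\<Sum>n. (cmod (coord x n))\<^sup>2) = (norm x)\<^sup>2"
    using suminf_nonneg[OF s] by (simp add: norm_ell2_eq)
  finally show ?thesis .
qed

lemma norm_scaleC: "norm (c *\<^sub>C x) = cmod c * norm x"
proof -
  have "summable (\<lambda>n. (cmod (coord x n))\<^sup>2)" using coord[of x] by simp
  then show ?thesis
    by (simp add: norm_ell2_eq scaleC_ell2.rep_eq norm_mult power_mult_distrib suminf_mult
        real_sqrt_mult)
qed

lemma scaleC_add: "c *\<^sub>C (x + y) = c *\<^sub>C x + c *\<^sub>C y"
  by transfer (simp add: distrib_left)

lemma scaleC_scaleC: "c *\<^sub>C d *\<^sub>C x = (c * d) *\<^sub>C x"
  by transfer (simp add: mult.assoc)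

lemma scaleR_eq_scaleC: "r *\<^sub>R x = complex_of_real r *\<^sub>C x"
  by transfer (simp add: scaleR_conv_of_real)

lemma norm_ket: "norm (ket j) = 1"
proof -
  have "(cmod (coord (ket j) n))\<^sup>2 = (if n = j then 1 else 0)" for n
    by (simp add: ket.rep_eq)
  then have "(\<lambda>n. (cmod (coord (ket j) n))\<^sup>2) sums 1"
    using sums_single[of j "\<lambda>_. 1 :: real"] by simp
  then show ?thesis
    by (simp add: norm_ell2_eq sums_iff)
qed


section \<open>The algebra of bounded operators\<close>

text \<open>Elements of \<^typ>\<open>ell2 \<Rightarrow>\<^sub>L ell2\<close> are bounded and real-linear; the complex-linear
  ones are singled out.\<close>

typedef bop = "{A :: ell2 \<Rightarrow>\<^sub>L ell2. \<forall>c x. A (c *\<^sub>C x) = c *\<^sub>C A x}"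
  morphisms blinfun_of_bop Abs_bop
  by (rule exI[of _ id_blinfun]) simp

setup_lifting type_definition_bop

definition bop_apply :: "bop \<Rightarrow> ell2 \<Rightarrow> ell2"  (infixl \<open>\<cdot>\<close> 90)
  where "A \<cdot> x = blinfun_apply (blinfun_of_bop A) x"

lemma bounded_linear_scaleC: "bounded_linear ((*\<^sub>C) c)"
proof (rule bounded_linear_intro)
  fix x y :: ell2 and r :: real
  show "c *\<^sub>C (x + y) = c *\<^sub>C x + c *\<^sub>C y" by (rule scaleC_add)
  show "c *\<^sub>C r *\<^sub>R x = r *\<^sub>R c *\<^sub>C x"
    by (simp add: scaleR_eq_scaleC scaleC_scaleC mult.commute)
  show "norm (c *\<^sub>C x) \<le> norm x * cmod c" by (simp add: norm_scaleC)
qed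

lift_definition scaleC_bop :: "complex \<Rightarrow> bop \<Rightarrow> bop"
  is "\<lambda>c A. Blinfun ((*\<^sub>C) c) o\<^sub>L A"
  by (simp add: bounded_linear_Blinfun_apply[OF bounded_linear_scaleC] scaleC_scaleC mult.commute)

instantiation bop :: real_normed_algebra_1
begin

lift_definition zero_bop :: bop is 0
  by (simp, transfer, simp)

lift_definition one_bop :: bop is id_blinfun by simp

lift_definition plus_bop :: "bop \<Rightarrow> bop \<Rightarrow> bop" is "(+)"
  by (simp add: blinfun.add_left scaleC_add)

lift_definition uminus_bop :: "bop \<Rightarrow> bop" is uminus
  by (simp add: blinfun.minus_left, transfer, simp)

lift_definition minus_bop :: "bop \<Rightarrow> bop \<Rightarrow> bop" is "(-)"
  by (simp add: blinfun.diff_left, transfer, simp add: right_diff_distrib)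

lift_definition times_bop :: "bop \<Rightarrow> bop \<Rightarrow> bop" is "(o\<^sub>L)" by simp

lift_definition scaleR_bop :: "real \<Rightarrow> bop \<Rightarrow> bop" is scaleR
  by (simp add: blinfun.scaleR_left scaleR_eq_scaleC scaleC_scaleC mult.commute)

lift_definition norm_bop :: "bop \<Rightarrow> real" is norm .

definition dist_bop :: "bop \<Rightarrow> bop \<Rightarrow> real" where "dist_bop A B = norm (A - B)"

definition sgn_bop :: "bop \<Rightarrow> bop" where "sgn_bop A = inverse (norm A) *\<^sub>R A"

definition [code del]:
  "(uniformity :: (bop \<times> bop) filter) = (INF e\<in>{0 <..}. principal {(A, B). dist A B < e})"

definition open_bop :: "bop set \<Rightarrow> bool"
  where [code del]: "open_bop S = (\<forall>A\<in>S. \<forall>\<^sub>F (A', B) in uniformity. A' = A \<longrightarrow> B \<in> S)"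

instance
proof
  fix A B C :: bop and a b :: real
  show "A + B + C = A + (B + C)" by transfer (simp add: add.assoc)
  show "A + B = B + A" by transfer (simp add: add.commute)
  show "0 + A = A" by transfer simp
  show "- A + A = 0" by transfer simp
  show "A - B = A + - B" by transfer simp
  show "a *\<^sub>R (A + B) = a *\<^sub>R A + a *\<^sub>R B" by transfer (simp add: algebra_simps)
  show "(a + b) *\<^sub>R A = a *\<^sub>R A + b *\<^sub>R A" by transfer (simp add: algebra_simps)
  show "a *\<^sub>R b *\<^sub>R A = (a * b) *\<^sub>R A" by transfer simp
  show "1 *\<^sub>R A = A" by transfer simp
  show "A * B * C = A * (B * C)" by transfer (simp add: blinfun_eqI)
  show "1 * A = A" by transfer (simp add: blinfun_eqI)
  show "A * 1 = A" by transfer (simp add: blinfun_eqI)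
  show "(A + B) * C = A * C + B * C" by transfer (simp add: bounded_bilinear.add_left[OF bounded_bilinear_blinfun_compose])
  show "A * (B + C) = A * B + A * C" by transfer (simp add: bounded_bilinear.add_right[OF bounded_bilinear_blinfun_compose])
  show "a *\<^sub>R A * B = a *\<^sub>R (A * B)" by transfer (simp add: bounded_bilinear.scaleR_left[OF bounded_bilinear_blinfun_compose])
  show "A * a *\<^sub>R B = a *\<^sub>R (A * B)" by transfer (simp add: bounded_bilinear.scaleR_right[OF bounded_bilinear_blinfun_compose])
  show "dist A B = norm (A - B)" by (rule dist_bop_def)
  show "sgn A = inverse (norm A) *\<^sub>R A" by (rule sgn_bop_def)
  show "(uniformity :: (bop \<times> bop) filter) = (INF e\<in>{0 <..}. principal {(A, B). dist A B < e})"
    by (rule uniformity_bop_def)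
  show "open U = (\<forall>A\<in>U. \<forall>\<^sub>F (A', B) in uniformity. A' = A \<longrightarrow> B \<in> U)" for U :: "bop set"
    by (rule open_bop_def)
  show "norm A = 0 \<longleftrightarrow> A = 0" by transfer simp
  show "norm (A + B) \<le> norm A + norm B" by transfer (rule norm_triangle_ineq)
  show "norm (a *\<^sub>R A) = \<bar>a\<bar> * norm A" by transfer simp
  show "norm (A * B) \<le> norm A * norm B" by transfer (rule norm_blinfun_compose)
  have "norm (blinfun_apply id_blinfun (ket 0)) \<le> norm (id_blinfun :: ell2 \<Rightarrow>\<^sub>L ell2) * norm (ket 0)"
    by (rule norm_blinfun)
  then have n1: "norm (id_blinfun :: ell2 \<Rightarrow>\<^sub>L ell2) = 1"
    using norm_blinfun_id_le[where 'a = ell2] by (simp add: norm_ket)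
  then show "norm (1 :: bop) = 1" by transfer
  show "(0 :: bop) \<noteq> 1" using n1 by transfer auto
qed

end

definition positive_op :: "bop \<Rightarrow> bool"
  where "positive_op A \<longleftrightarrow> (\<forall>x. 0 \<le> cinner x (A \<cdot> x))"

definition diagonal_ops :: "bop set"
  where "diagonal_ops = {A. \<forall>i j. i \<noteq> j \<longrightarrow> cinner (ket i) (A \<cdot> ket j) = 0}"


section \<open>States\<close>

text \<open>A functional on a subalgebra \<open>\<A>\<close> is represented by a total function of which only the
  values on \<open>\<A>\<close> matter. The order on \<^typ>\<open>complex\<close> is the one for which \<open>0 \<le> z\<close>
  means that \<open>z\<close> is real and nonnegative.\<close>

definition state :: "bop set \<Rightarrow> (bop \<Rightarrow> complex) \<Rightarrow> bool"
  where "state \<A> s \<longleftrightarrow>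
    (\<forall>A\<in>\<A>. \<forall>B\<in>\<A>. s (A + B) = s A + s B) \<and>
    (\<forall>c. \<forall>A\<in>\<A>. s (scaleC_bop c A) = c * s A) \<and>
    (\<exists>K. \<forall>A\<in>\<A>. cmod (s A) \<le> K * norm A) \<and>
    (\<forall>A\<in>\<A>. positive_op A \<longrightarrow> 0 \<le> s A) \<and>
    s 1 = 1"

definition eq_on :: "bop set \<Rightarrow> (bop \<Rightarrow> complex) \<Rightarrow> (bop \<Rightarrow> complex) \<Rightarrow> bool"
  where "eq_on \<A> s s' \<longleftrightarrow> (\<forall>A\<in>\<A>. s A = s' A)"

definition pure_state :: "bop set \<Rightarrow> (bop \<Rightarrow> complex) \<Rightarrow> bool"
  where "pure_state \<A> s \<longleftrightarrow> state \<A> s \<and>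
    \<not> (\<exists>s\<^sub>1 s\<^sub>2. \<exists>t::real. state \<A> s\<^sub>1 \<and> state \<A> s\<^sub>2 \<and>
        \<not> eq_on \<A> s\<^sub>1 s \<and> \<not> eq_on \<A> s\<^sub>2 s \<and> 0 < t \<and> t < 1 \<and>
        eq_on \<A> s (\<lambda>A. of_real t * s\<^sub>1 A + of_real (1 - t) * s\<^sub>2 A))"

end

theory Submission
  imports Defs "Jordan_Normal_Form.Determinant"
    "HOL-Computational_Algebra.Fundamental_Theorem_Algebra"
begin

text \<open>A pure state on the diagonal operators takes the values 0 and 1 on diagonal projections. If
  \<open>s\<close> is an extension and \<open>P\<close> a diagonal projection with \<open>s P = 1\<close>, then \<open>s A = s (P A P)\<close>; so it
  suffices that every selfadjoint contraction \<open>A\<close> with zero diagonal can be paved: there is a partition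
  of the basis into ten classes such that every diagonal block of \<open>A\<close> is at most \<open>4/5\<close>. Applied to
  \<open>A\<close> and \<open>- A\<close> and iterated, this gives \<open>s A = 0\<close>.

  By compactness paving is a statement about Hermitian matrices, and there it is proved by
  interlacing families, in the variant of Leake and Ravichandran that works with determinants of
  principal submatrices instead of sums of rank one matrices. The sum of
  \<open>\<Prod>\<^sub>c det (x - A[S\<^sub>c])\<close> over all colourings is, up to a constant, the result of applying
  \<open>\<Prod>\<^sub>i \<partial>\<^sub>i\<^sup>r\<^sup>-\<^sup>1\<close> to \<open>det (Z - A)\<^sup>r\<close> at \<open>Z = x\<close>. All conditional sums are real-rooted, so some colouring
  has no larger root than the total sum, and the largest root of the latter is controlled by the
  barrier functions \<open>\<partial>\<^sub>j log\<close>. Applying \<open>\<partial>\<^sub>i\<^sup>r\<^sup>-\<^sup>1\<close> at once leaves a polynomial that is linear in \<open>z\<^sub>i\<close>, whose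
  root is the mean of the old ones; therefore the point may be lowered by \<open>(r - 1)\<^sup>2 / (r \<phi>)\<close> in that
  coordinate, where \<open>\<phi>\<close> bounds the barriers.\<close>

section \<open>Stable univariate polynomials\<close>

text \<open>Existence is explicit: compose \<open>s\<close> with the passage to the diagonal part.
  All the work lies in uniqueness. The constants reflect an extremal two-point measure. A zero
  diagonal gives the spectral measure of A at a basis vector mean 0 on [-1, 1], so the diagonal of
  the inverse of 2 - A is at most the average of 1/(2 - x) over x = 1 and x = -1, which is 2/3. With
  r colours \<phi> = 2r/3, and a coordinate may drop by (3/2)(1 - 1/r)^2. This exceeds 1 from r = 6
  on; r = 10 leaves room for the round value 6/5, hence 2 - 6/5 = 4/5. Multivariate polynomials are
  avoided: each minor is affine in each variable and its derivative is the minor without that index,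
  so differentiating means deleting an index from the set of one colour. Largest roots are expressed
  as positivity on a half line. The main obstacle is that the barrier step keeps most variables
  real, where stability says nothing. It is replaced by lower bounds in terms of leading
  coefficients, and these are values of the same family on smaller index sets. This is why the
  induction must cover all index sets at once.\<close>

definition monic_with_roots :: "complex multiset \<Rightarrow> complex poly" where
  "monic_with_roots M = (\<Prod>x\<in>#M. [:-x, 1:])"

lemma monic_with_roots_empty [simp]: "monic_with_roots {#} = 1"
  and monic_with_roots_add [simp]:
    "monic_with_roots (add_mset x M) = [:-x, 1:] * monic_with_roots M"
  by (simp_all add: monic_with_roots_def)

lemma monic_with_roots_nonzero [simp]: "monic_with_roots M \<noteq> 0"
  by (induction M) (auto simp del: mult_pCons_left)

lemma degree_monic_with_roots [simp]: "degree (monic_with_roots M) = size M"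
  by (induction M) (simp_all add: degree_mult_eq del: mult_pCons_left)

lemma poly_monic_with_roots: "poly (monic_with_roots M) t = (\<Prod>x\<in>#M. t - x)"
  by (induction M) (simp_all add: algebra_simps)

lemma poly_monic_with_roots_eq_0_iff: "poly (monic_with_roots M) t = 0 \<longleftrightarrow> t \<in># M"
  by (induction M) auto

lemma coeff_monic_with_roots_size [simp]: "coeff (monic_with_roots M) (size M) = 1"
proof (induction M)
  case (add x M)
  have "coeff (monic_with_roots M) (Suc (size M)) = 0"
    by (rule coeff_eq_0) simp
  with add show ?case by simp
qed simp

lemma monic_with_roots_remove:
  "x \<in># M \<Longrightarrow> [:-x, 1:] * monic_with_roots (M - {#x#}) = monic_with_roots M"
  using monic_with_roots_add[of x "M - {#x#}"] by simp

lemma complex_poly_factors: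
  "\<exists>M. F = Polynomial.smult (lead_coeff F) (monic_with_roots M) \<and> size M = degree F"
proof (intro exI conjI)
  show eq: "F = Polynomial.smult (lead_coeff F) (monic_with_roots (if F = 0 then {#} else proots F))"
    using complex_poly_decompose_multiset[of F] by (simp add: monic_with_roots_def)
  show "size (if F = 0 then {#} else proots F) = degree F"
    by (cases "F = 0") (simp_all, subst eq, simp)
qed

text \<open>For \<open>F\<close> of degree \<open>r\<close> this is the linear polynomial \<open>F\<^sup>(\<^sup>r\<^sup>-\<^sup>1\<^sup>)/(r - 1)!\<close>.\<close>

definition top_linear :: "nat \<Rightarrow> complex poly \<Rightarrow> complex \<Rightarrow> complex" where
  "top_linear r F t = coeff F (r - 1) + of_nat r * t * coeff F r"

lemma top_linear_add: "top_linear r (F + G) t = top_linear r F t + top_linear r G t"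
  and top_linear_smult: "top_linear r (Polynomial.smult c F) t = c * top_linear r F t"
  by (simp_all add: top_linear_def algebra_simps)

lemma top_linear_sum: "top_linear r (\<Sum>i\<in>I. F i) t = (\<Sum>i\<in>I. top_linear r (F i) t)"
  by (simp add: top_linear_def coeff_sum sum.distrib sum_distrib_left)

text \<open>By Vieta the second coefficient is minus the sum of the roots; the value is thus
  \<open>size M\<close> times the difference between \<open>t\<close> and the mean root.\<close>

lemma top_linear_monic_with_roots:
  assumes "M \<noteq> {#}"
  shows "top_linear (size M) (monic_with_roots M) t = (\<Sum>x\<in>#M. t - x)"
  using assms
proof (induction M)
  case (add x M)
  show ?case
  proof (cases "M = {#}")
    case False
    then obtain k where k: "size M = Suc k" by (cases M) auto
    have "coeff (monic_with_roots M) (Suc (Suc k)) = 0"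
      by (rule coeff_eq_0) (simp add: k)
    moreover have "coeff (monic_with_roots M) (Suc k) = 1"
      using coeff_monic_with_roots_size[of M] by (simp add: k)
    ultimately show ?thesis using add.IH[OF False] False
      by (simp add: top_linear_def k algebra_simps)
  qed (simp add: top_linear_def)
qed simp

lemma top_linear_monic_with_roots_Suc:
  assumes "r = Suc (size M)"
  shows "top_linear r (monic_with_roots M) t = 1"
proof -
  have "coeff (monic_with_roots M) r = 0" by (rule coeff_eq_0) (simp add: assms)
  then show ?thesis using assms by (simp add: top_linear_def)
qed

section \<open>Polynomials without zeros in the open upper half-plane\<close>

lemma stable_roots:
  assumes F: "\<And>t. Im t > 0 \<Longrightarrow> poly F t \<noteq> 0"
  shows "\<exists>M. F = Polynomial.smult (lead_coeff F) (monic_with_roots M) \<and> size M = degree F \<and> (\<forall>x\<in>#M. Im x \<le> 0)"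
proof -
  obtain M where M: "F = Polynomial.smult (lead_coeff F) (monic_with_roots M)" "size M = degree F"
    using complex_poly_factors by blast
  have "Im x \<le> 0" if "x \<in># M" for x
    using F[of x] M(1) that poly_monic_with_roots_eq_0_iff[of M x]
    by (metis mult_zero_right not_le poly_smult)
  with M show ?thesis by blast
qed

text \<open>All roots lie in the closed lower half-plane, so every factor \<open>t - x\<close> has
  modulus at least \<open>Im t\<close>. Unlike mere nonvanishing, the bound passes to
  limits.\<close>

lemma norm_poly_ge_of_stable:
  assumes F: "\<And>t. Im t > 0 \<Longrightarrow> poly F t \<noteq> 0" and deg: "degree F \<le> r" and t: "Im t > 0"
  shows "cmod (poly F t) \<ge> Im t ^ r * cmod (coeff F r)"
proof (cases "degree F = r")
  case True
  obtain M where M: "F = Polynomial.smult (lead_coeff F) (monic_with_roots M)" "size M = degree F"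
    "\<forall>x\<in>#M. Im x \<le> 0"
    using stable_roots[OF F] by blast
  from M(3) have "Im t ^ size M \<le> cmod (\<Prod>x\<in>#M. t - x)"
  proof (induction M)
    case (add x M)
    have "Im t \<le> cmod (t - x)"
      using abs_Im_le_cmod[of "t - x"] add.prems t by simp
    then show ?case using add t by (auto simp: norm_mult intro!: mult_mono)
  qed simp
  then have "Im t ^ r * cmod (coeff F r) \<le> cmod (lead_coeff F * (\<Prod>x\<in>#M. t - x))"
    using M(2) True by (simp add: norm_mult mult.commute[of "Im t ^ r"] mult_left_mono)
  also have "lead_coeff F * (\<Prod>x\<in>#M. t - x) = poly F t"
    by (subst (2) M(1)) (simp add: poly_monic_with_roots)
  finally show ?thesis .
next
  case False
  then have "coeff F r = 0" using deg by (intro coeff_eq_0) simp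
  then show ?thesis by simp
qed

lemma Im_sum_mset: "Im (\<Sum>x\<in>#M. f x) = (\<Sum>x\<in>#M. Im (f x))"
  by (induction M) simp_all

lemma Re_sum_mset: "Re (\<Sum>x\<in>#M. f x) = (\<Sum>x\<in>#M. Re (f x))"
  by (induction M) simp_all

lemma sum_mset_nonneg:
  fixes f :: "'a \<Rightarrow> real"
  assumes "\<And>x. x \<in># M \<Longrightarrow> 0 \<le> f x"
  shows "0 \<le> (\<Sum>x\<in>#M. f x)"
  using assms by (induction M) auto

lemma sum_mset_pos:
  fixes f :: "'a \<Rightarrow> real"
  assumes "M \<noteq> {#}" "\<And>x. x \<in># M \<Longrightarrow> 0 < f x"
  shows "0 < (\<Sum>x\<in>#M. f x)"
  using assms
proof (induction M)
  case (add x M)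
  then show ?case by (cases "M = {#}") (auto intro: add_pos_pos)
qed simp

text \<open>A case of Gauss-Lucas: the only zero of \<open>top_linear\<close> is the mean of the
  roots, which stays in the closed lower half-plane.\<close>

lemma top_linear_nonzero_of_stable:
  assumes F: "\<And>t. Im t > 0 \<Longrightarrow> poly F t \<noteq> 0" and deg: "degree F \<le> r" and r: "r \<ge> 1"
    and lc: "coeff F r \<noteq> 0" and t: "Im t > 0"
  shows "top_linear r F t \<noteq> 0"
proof -
  have dr: "degree F = r" using deg lc le_degree by (metis le_antisym)
  obtain M where M: "F = Polynomial.smult (lead_coeff F) (monic_with_roots M)" "size M = degree F"
    "\<forall>x\<in>#M. Im x \<le> 0"
    using stable_roots[OF F] by blast
  have ne: "M \<noteq> {#}" using M(2) dr r by auto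
  have "0 < (\<Sum>x\<in>#M. Im (t - x))"
    by (rule sum_mset_pos[OF ne]) (use M(3) t in force)
  then have "(\<Sum>x\<in>#M. t - x) \<noteq> 0" using Im_sum_mset[of "\<lambda>x. t - x" M] by (auto simp del: minus_complex.sel)
  moreover have "top_linear r F t = lead_coeff F * (\<Sum>x\<in>#M. t - x)"
    using top_linear_monic_with_roots[OF ne] M(2) dr by (subst M(1)) (simp add: top_linear_smult)
  ultimately show ?thesis using lc dr by (metis mult_eq_0_iff)
qed

lemma log_derivative_monic_with_roots:
  assumes "poly (monic_with_roots M) t \<noteq> 0"
  shows "poly (pderiv (monic_with_roots M)) t / poly (monic_with_roots M) t = (\<Sum>x\<in>#M. 1 / (t - x))"
  using assms
proof (induction M)
  case (add x M)
  then have ne: "t - x \<noteq> 0" "poly (monic_with_roots M) t \<noteq> 0" by auto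
  have "pderiv (monic_with_roots (add_mset x M)) =
      monic_with_roots M + [:-x, 1:] * pderiv (monic_with_roots M)"
    by (simp only: monic_with_roots_add pderiv_mult) (simp add: pderiv_pCons)
  then have "poly (pderiv (monic_with_roots (add_mset x M))) t =
      poly (monic_with_roots M) t + (t - x) * poly (pderiv (monic_with_roots M)) t"
    by (simp only: poly_add poly_mult) (simp add: algebra_simps)
  moreover have "poly (monic_with_roots (add_mset x M)) t = (t - x) * poly (monic_with_roots M) t"
    by (simp add: algebra_simps)
  ultimately have "poly (pderiv (monic_with_roots (add_mset x M))) t / poly (monic_with_roots (add_mset x M)) t
      = 1 / (t - x) + poly (pderiv (monic_with_roots M)) t / poly (monic_with_roots M) t"
    using ne by (simp add: add_divide_distrib)
  then show ?case using add.IH ne by simp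
qed simp

lemma Im_log_derivative_of_stable:
  assumes G: "\<And>t. Im t > 0 \<Longrightarrow> poly G t \<noteq> 0" and s: "poly G s \<noteq> 0" "Im s \<ge> 0"
  shows "Im (poly (pderiv G) s / poly G s) \<le> 0"
proof -
  obtain M where M: "G = Polynomial.smult (lead_coeff G) (monic_with_roots M)"
    "\<forall>x\<in>#M. Im x \<le> 0"
    using stable_roots[OF G] by blast
  have lc: "lead_coeff G \<noteq> 0" using s by auto
  have 1: "poly (monic_with_roots M) s \<noteq> 0" using s(1) M(1) by (metis mult_zero_right poly_smult)
  have "Im (1 / (s - x)) \<le> 0" if "x \<in># M" for x
    using M(2) that s(2) by (auto simp: Im_divide intro!: divide_nonpos_nonneg)
  then have "(\<Sum>x\<in>#M. Im (1 / (s - x))) \<le> 0"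
    by (induction M) (auto intro: add_nonpos_nonpos)
  then have 2: "Im (\<Sum>x\<in>#M. 1 / (s - x)) \<le> 0" using Im_sum_mset[of "\<lambda>x. 1/(s-x)" M] by presburger
  have "poly (pderiv G) s / poly G s = (\<Sum>x\<in>#M. 1 / (s - x))"
    unfolding log_derivative_monic_with_roots[OF 1, symmetric]
    using lc by (subst (1 2) M(1)) (simp add: pderiv_smult)
  with 2 show ?thesis by simp
qed

text \<open>Stability and conjugation symmetry make all roots real, positivity puts them to the left
  of \<open>a\<close>, and there every factor grows in modulus as the point moves right. Positivity
  turns moduli back into values.\<close>

lemma real_rooted_mono:
  assumes stable: "\<And>t. Im t > 0 \<Longrightarrow> poly h t \<noteq> 0" and refl: "\<And>t. poly h (cnj t) = cnj (poly h t)"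
    and pos: "\<And>x. x \<ge> a \<Longrightarrow> 0 < poly h (of_real x)" and xy: "a \<le> x" "x \<le> y"
  shows "poly h (of_real x) \<le> poly h (of_real y)"
proof -
  obtain M where M: "h = Polynomial.smult (lead_coeff h) (monic_with_roots M)" "\<forall>x\<in>#M. Im x \<le> 0"
    using stable_roots[OF stable] by blast
  have root: "z \<in># M \<Longrightarrow> poly h z = 0" for z
    using M(1) poly_monic_with_roots_eq_0_iff[of M z] by (metis mult_zero_right poly_smult)
  have z: "Im z = 0" "Re z < a" if "z \<in># M" for z
  proof -
    show 1: "Im z = 0"
    proof (rule ccontr)
      assume "Im z \<noteq> 0"
      then have "Im (cnj z) > 0" using M(2) that by force
      then show False using root[OF that] stable[of "cnj z"] refl[of z] by simp
    qed
    show "Re z < a" using root[OF that] pos[of "Re z"] 1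
      by (metis complex_is_Real_iff less_irrefl not_le of_real_Re)
  qed
  then have "cmod (\<Prod>z\<in>#M. of_real x - z) \<le> cmod (\<Prod>z\<in>#M. of_real y - z)"
  proof (induction M)
    case (add z M)
    have "cmod (of_real x - z) \<le> cmod (of_real y - z)"
      using add.prems[of z] xy by (simp add: cmod_eq_Re)
    then show ?case using add by (auto simp: norm_mult intro!: mult_mono)
  qed simp
  then have "cmod (poly h (of_real x)) \<le> cmod (poly h (of_real y))"
    by (subst (1 2) M(1)) (simp add: poly_monic_with_roots norm_mult mult_left_mono)
  moreover have "0 < poly h (of_real x)" "0 < poly h (of_real y)" using pos xy by auto
  ultimately show ?thesis
    by (simp add: less_eq_complex_def less_complex_def cmod_eq_Re)
qed

lemma sum_mset_Cauchy_Schwarz: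
  fixes f :: "'a \<Rightarrow> real"
  assumes "\<And>x. x \<in># M \<Longrightarrow> 0 < f x"
  shows "(real (size M))\<^sup>2 \<le> (\<Sum>x\<in>#M. f x) * (\<Sum>x\<in>#M. 1 / f x)"
  using assms
proof (induction M)
  case (add x M)
  define S where "S = (\<Sum>x\<in>#M. f x)"
  define T where "T = (\<Sum>x\<in>#M. 1 / f x)"
  have f: "0 \<le> f y" if "y \<in># M" for y using add.prems[of y] that by simp
  have ST: "S \<ge> 0" "T \<ge> 0"
    unfolding S_def T_def using f by (simp_all add: sum_mset_nonneg)
  have IH: "(real (size M))\<^sup>2 \<le> S * T" using add unfolding S_def T_def by auto
  have y: "f x > 0" using add.prems by simp
  \<comment> \<open>\<open>S / f x\<close> and \<open>f x * T\<close> have product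
    \<open>S * T\<close>: arithmetic against geometric mean.\<close>
  have "4 * (S * T) \<le> (S / f x + f x * T)\<^sup>2"
    using zero_le_power2[of "S / f x - f x * T"] y by (simp add: power2_eq_square field_simps)
  then have "(2 * real (size M))\<^sup>2 \<le> (S / f x + f x * T)\<^sup>2" using IH by (simp add: power_mult_distrib)
  then have "2 * real (size M) \<le> S / f x + f x * T"
    by (rule power2_le_imp_le) (use ST y in simp)
  then have "(real (size M) + 1)\<^sup>2 \<le> (f x + S) * (1 / f x + T)"
  proof -
    have "(f x + S) * (1 / f x + T) = 1 + (S / f x + f x * T) + S * T"
      using y by (simp add: field_simps)
    moreover have "(real (size M) + 1)\<^sup>2 = (real (size M))\<^sup>2 + 2 * real (size M) + 1"
      by (simp add: power2_eq_square algebra_simps)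
    ultimately show ?thesis using IH \<open>2 * real (size M) \<le> _\<close> by linarith
  qed
  then show ?case by (simp add: S_def T_def add.commute)
qed simp

section \<open>Rational functions from the upper to the lower half-plane: residues and partial
  fractions\<close>

text \<open>For \<open>m \<ge> 2\<close> the powers of points of the upper half-plane take every
  argument strictly between 0 and 2 pi. Division by them turns \<open>C\<close> almost all the way
  round, which a nonzero number cannot do inside a half-plane. This rules out multiple
  poles.\<close>

lemma eq_0_if_Im_divide_power_nonpos:
  assumes m: "m \<ge> 2" and C: "\<And>u. Im u > 0 \<Longrightarrow> Im (C / u ^ m) \<le> 0"
  shows "C = 0"
proof -
  have *: "Im (C / cis x) \<le> 0" if "0 < x" "x < 2 * pi" for x
  proof -
    have "2 * pi \<le> real m * pi" using m by (intro mult_right_mono) auto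
    then have "x < real m * pi" using that by linarith
    then have "x / m < pi" using m by (simp add: divide_less_eq mult.commute)
    then have "0 < Im (cis (x / m))" using that m by (simp add: sin_gt_zero)
    moreover have "m \<noteq> 0" using m by simp
    then have "real m * (x / m) = x" by simp
    then have "cis (x / m) ^ m = cis x" by (simp only: Complex.DeMoivre)
    ultimately show ?thesis using C by metis
  qed
  have Im_cis: "Im (C / cis x) = Im C * cos x - Re C * sin x" for x
    by (simp add: Im_divide flip: power2_eq_square)
  have "Re C \<ge> 0" "Im C \<ge> 0" using *[of "pi/2"] *[of pi] by (simp_all add: Im_cis)
  moreover have "Re C \<le> 0"
  proof -
    have "Im (C / cis (3/2 * pi)) \<le> 0" by (rule *) simp_all
    then show ?thesis unfolding Im_cis cos_3over2_pi sin_3over2_pi by simp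
  qed
  moreover have "(Im C - Re C) * (sqrt 2 / 2) \<le> 0"
    using *[of "pi/4"] by (simp only: Im_cis) (simp add: cos_45 sin_45 left_diff_distrib)
  then have "Im C \<le> Re C" by (simp add: mult_le_0_iff)
  ultimately show ?thesis by (simp add: complex_eq_iff)
qed

text \<open>The points \<open>K + i\<close> give \<open>Im C * K \<le> Re C\<close> for all real
  \<open>K\<close>. Applied to a simple pole, this says that the residue is real and
  nonnegative.\<close>

lemma pos_if_Im_divide_nonpos:
  assumes C: "\<And>u. Im u > 0 \<Longrightarrow> Im (C / u) \<le> 0"
  shows "Im C = 0" "Re C \<ge> 0"
proof -
  have *: "Im C * K \<le> Re C" for K
  proof -
    have "K\<^sup>2 + 1 > 0" by (simp add: add_nonneg_pos)
    then show ?thesis using C[of "Complex K 1"] by (auto simp: Im_divide divide_le_0_iff)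
  qed
  show "Re C \<ge> 0" using *[of 0] by simp
  show "Im C = 0"
  proof (rule ccontr)
    assume "Im C \<noteq> 0"
    then show False using *[of "(Re C + 1) / Im C"] by simp
  qed
qed

text \<open>Zooming in on the pole: at \<open>x + e * u\<close> the quotient is the positive number
  \<open>1 / e ^ m\<close> times an expression that tends to the one in the conclusion as
  \<open>e\<close> decreases to 0.\<close>

lemma Im_residue_nonpos:
  assumes x: "x \<in># M" "Im x = 0" and N: "\<And>t. Im t > 0 \<Longrightarrow> Im (poly num t / poly (monic_with_roots M) t) \<le> 0"
    and u: "Im u > 0"
  defines "R \<equiv> monic_with_roots (filter_mset (\<lambda>y. y \<noteq> x) M)"
  shows "Im (poly num x / poly R x / u ^ count M x) \<le> 0"
proof -
  define m where "m = count M x"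
  have M: "monic_with_roots M = [:-x, 1:] ^ m * R"
  proof -
    have "monic_with_roots M = monic_with_roots (filter_mset (\<lambda>y. y = x) M) * R"
      unfolding R_def monic_with_roots_def
      by (subst multiset_partition[of M "\<lambda>y. y = x"]) (simp only: image_mset_union prod_mset_Un)
    then show ?thesis by (simp add: filter_eq_replicate_mset monic_with_roots_def m_def)
  qed
  have Rx: "poly R x \<noteq> 0" by (simp add: R_def poly_monic_with_roots_eq_0_iff)
  let ?g = "\<lambda>e::real. Im (poly num (x + of_real e * u) / poly R (x + of_real e * u) / u ^ m)"
  have "?g e \<le> 0" if "e > 0" for e
  proof -
    have "0 \<ge> Im (poly num (x + of_real e * u) / poly (monic_with_roots M) (x + of_real e * u))"
      using x u that by (intro N) simp
    also have "poly num (x + of_real e * u) / poly (monic_with_roots M) (x + of_real e * u)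
      = of_real (1 / e ^ m) * (poly num (x + of_real e * u) / poly R (x + of_real e * u) / u ^ m)"
      using that by (simp add: M power_mult_distrib field_simps)
    also have "Im \<dots> = (1 / e ^ m) * ?g e"
      by (simp only: times_complex.sel Re_complex_of_real Im_complex_of_real)
    finally show ?thesis using zero_less_power[OF that, of m] by (auto simp: mult_le_0_iff divide_le_0_iff)
  qed
  moreover have "(?g \<longlongrightarrow> Im (poly num x / poly R x / u ^ m)) (at_right 0)"
  proof -
    have "((\<lambda>e::real. x + of_real e * u) \<longlongrightarrow> x + of_real 0 * u) (at_right 0)"
      by (intro tendsto_intros)
    then have 1: "((\<lambda>e::real. x + of_real e * u) \<longlongrightarrow> x) (at_right 0)" by simp
    have "u \<noteq> 0" using u by auto
    then show ?thesis
      by (intro tendsto_intros tendsto_divide isCont_tendsto_compose[OF poly_isCont] 1 Rx) simp_all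
  qed
  ultimately show ?thesis
    unfolding m_def[symmetric]
    by (auto simp: eventually_at_filter intro!: tendsto_upperbound)
qed

text \<open>The rational case of the representation of Nevanlinna functions, a constant plus
  nonnegative multiples of \<open>1 / (t - x)\<close>, multiplied out by the denominator. Common
  roots are cancelled by induction. If there is none, all poles are simple with nonnegative
  residues, and the identity is Lagrange interpolation together with the coefficient of degree
  \<open>size M\<close>.\<close>

lemma partial_fractions_of_Im_nonpos:
  assumes "\<And>x. x \<in># M \<Longrightarrow> Im x = 0" "degree num \<le> size M"
    and "\<And>t. Im t > 0 \<Longrightarrow> Im (poly num t / poly (monic_with_roots M) t) \<le> 0"
  shows "\<exists>a w. (\<forall>x. w x \<ge> (0::real)) \<and>
    num = Polynomial.smult a (monic_with_roots M) +
      (\<Sum>x\<in>set_mset M. Polynomial.smult (of_real (w x)) (monic_with_roots (M - {#x#})))"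
  using assms
proof (induction "size M" arbitrary: M num rule: less_induct)
  case less
  show ?case
  proof (cases "\<exists>x\<in>#M. poly num x = 0")
    case True
    then obtain x where x: "x \<in># M" "poly num x = 0" by blast
    define M' where "M' = M - {#x#}"
    have M: "M = add_mset x M'" using x by (simp add: M'_def)
    obtain num' where num: "num = [:-x, 1:] * num'" using x(2) by (auto simp: poly_eq_0_iff_dvd)
    have "degree num' \<le> size M'"
    proof (cases "num' = 0")
      case False
      then show ?thesis using less.prems(2) by (simp add: num M degree_mult_eq del: mult_pCons_left)
    qed simp
    moreover have "Im (poly num' t / poly (monic_with_roots M') t) \<le> 0" if t: "Im t > 0" for t
    proof -
      have "t - x \<noteq> 0" using less.prems(1)[OF x(1)] t by auto
      then show ?thesis using less.prems(3)[OF t] by (simp add: num M left_diff_distrib[symmetric] del: mult_pCons_left) 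
    qed
    ultimately obtain a w where w: "\<forall>x. w x \<ge> (0::real)"
      and num': "num' = Polynomial.smult a (monic_with_roots M') +
        (\<Sum>x\<in>set_mset M'. Polynomial.smult (of_real (w x)) (monic_with_roots (M' - {#x#})))"
      using less.hyps[of M' num'] less.prems(1) M by auto
    define w' where "w' = (\<lambda>y. if y \<in># M' then w y else 0)"
    have rem: "[:-x, 1:] * monic_with_roots (M' - {#y#}) = monic_with_roots (M - {#y#})" if y: "y \<in># M'" for y
    proof -
      have "M - {#y#} = add_mset x (M' - {#y#})" using y by (simp add: M)
      then show ?thesis by simp
    qed
    have "num = Polynomial.smult a (monic_with_roots M) +
      (\<Sum>y\<in>set_mset M'. Polynomial.smult (of_real (w y)) (monic_with_roots (M - {#y#})))"
      unfolding num num' M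
      by (simp add: distrib_left sum_distrib_left rem[unfolded M] mult_smult_right
            del: mult_pCons_left monic_with_roots_add cong: sum.cong)
         (simp del: mult_pCons_left)
    also have "(\<Sum>y\<in>set_mset M'. Polynomial.smult (of_real (w y)) (monic_with_roots (M - {#y#})))
      = (\<Sum>y\<in>set_mset M. Polynomial.smult (of_real (w' y)) (monic_with_roots (M - {#y#})))"
      by (rule sum.mono_neutral_cong_left) (auto simp: M w'_def)
    finally show ?thesis using w by (intro exI[of _ a] exI[of _ w']) (auto simp: w'_def)
  next
    case False
    have res: "count M x = 1 \<and> Im (poly num x / poly (monic_with_roots (M - {#x#})) x) = 0 \<and>
       Re (poly num x / poly (monic_with_roots (M - {#x#})) x) \<ge> 0" if x: "x \<in># M" for x
    proof -
      define R where "R = monic_with_roots (filter_mset (\<lambda>y. y \<noteq> x) M)"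
      note I = Im_residue_nonpos[OF x less.prems(1)[OF x] less.prems(3), folded R_def]
      have R: "poly R x \<noteq> 0" by (simp add: R_def poly_monic_with_roots_eq_0_iff)
      have c1: "count M x = 1"
      proof (rule ccontr)
        assume "count M x \<noteq> 1"
        then have "count M x \<ge> 2" using x by (metis count_greater_eq_one_iff le_neq_implies_less Suc_1 Suc_leI)
        from eq_0_if_Im_divide_power_nonpos[OF this I] R False x show False by auto
      qed
      have "filter_mset (\<lambda>y. y \<noteq> x) M = M - {#x#}"
        by (rule multiset_eqI) (use c1 in auto)
      then show ?thesis using pos_if_Im_divide_nonpos[of "poly num x / poly R x"] I c1 by (simp add: R_def)
    qed
    define w where "w = (\<lambda>x. if x \<in># M then Re (poly num x / poly (monic_with_roots (M - {#x#})) x) else 0)"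
    define a where "a = coeff num (size M)"
    have w0: "w x \<ge> 0" for x using res by (simp add: w_def)
    have nin: "x \<notin># M - {#x#}" if "x \<in># M" for x
      using res[OF that] by (simp add: not_in_iff)
    have wx: "of_real (w x) * poly (monic_with_roots (M - {#x#})) x = poly num x" if x: "x \<in># M" for x
    proof -
      have "poly (monic_with_roots (M - {#x#})) x \<noteq> 0"
        using nin[OF x] by (simp add: poly_monic_with_roots_eq_0_iff)
      moreover have "of_real (w x) = poly num x / poly (monic_with_roots (M - {#x#})) x"
        using res[OF x] x by (simp add: w_def complex_eq_iff)
      ultimately show ?thesis by simp
    qed
    define G where "G = Polynomial.smult a (monic_with_roots M) +
      (\<Sum>x\<in>set_mset M. Polynomial.smult (of_real (w x)) (monic_with_roots (M - {#x#})))"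
    have "card (set_mset M) = size M"
      using res by (simp add: size_multiset_overloaded_eq)
    moreover have "num = G"
    proof (rule poly_eqI_degree_lead_coeff[where n = "size M" and A = "set_mset M"])
      show "poly num x = poly G x" if x: "x \<in> set_mset M" for x
      proof -
        have "poly (monic_with_roots M) x = 0" using x by (simp add: poly_monic_with_roots_eq_0_iff)
        moreover have "(\<Sum>y\<in>set_mset M. of_real (w y) * poly (monic_with_roots (M - {#y#})) x)
          = (\<Sum>y\<in>set_mset M. if y = x then poly num x else 0)"
        proof (rule sum.cong[OF refl])
          fix y assume "y \<in> set_mset M"
          then show "of_real (w y) * poly (monic_with_roots (M - {#y#})) x = (if y = x then poly num x else 0)"
            using x wx[of x] by (cases "y = x") (auto simp: poly_monic_with_roots_eq_0_iff in_diff_count)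
        qed
        ultimately show ?thesis using x by (simp add: G_def poly_sum)
      qed
      have c0: "coeff (monic_with_roots (M - {#y#})) (size M) = 0" if "y \<in># M" for y
        using that by (intro coeff_eq_0) (simp add: size_Diff1_less)
      show "coeff num (size M) = coeff G (size M)"
        by (simp add: G_def a_def coeff_sum c0)
      show "degree G \<le> size M"
        unfolding G_def
        by (intro degree_add_le degree_sum_le order.trans[OF degree_smult_le])
           (auto simp: size_Diff_singleton)
    qed (use less.prems(2) calculation in auto)
    ultimately show ?thesis using w0 unfolding G_def by blast
  qed
qed

text \<open>At \<open>t\<close> the quotient \<open>num / F\<close> is a constant plus nonnegative
  weights over \<open>c * Y x\<close>, where \<open>Y x\<close> is the distance of the root
  \<open>x\<close> from \<open>t\<close>. After \<open>top_linear\<close> is applied and the point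
  lowered, the constant and the weights are the same, but every denominator has become
  \<open>c * E\<close>. So it suffices that \<open>E\<close> is at least each
  \<open>Y x\<close>.\<close>

lemma barrier_shift:
  fixes t \<phi> \<Delta> :: real
  assumes real: "\<And>x. x \<in># M \<Longrightarrow> Im x = 0" and above: "\<And>x. x \<in># M \<Longrightarrow> Re x < t"
    and r: "size M = r" "r \<ge> 2" and c: "c > (0::real)"
    and F: "F = Polynomial.smult (of_real c) (monic_with_roots M)"
    and \<phi>: "Re (poly (pderiv F) (of_real t) / poly F (of_real t)) \<le> \<phi>" "\<phi> > 0"
    and \<Delta>: "of_nat r * \<Delta> * \<phi> \<le> (of_nat r - 1)\<^sup>2"
    and num: "degree num \<le> r" "\<And>t. Im t > 0 \<Longrightarrow> Im (poly num t / poly F t) \<le> 0"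
  shows "0 < top_linear r F (of_real (t - \<Delta>))"
    and "Re (top_linear r num (of_real (t - \<Delta>)) / top_linear r F (of_real (t - \<Delta>)))
      \<le> Re (poly num (of_real t) / poly F (of_real t))"
proof -
  define Y where "Y = (\<lambda>x. t - Re x)"
  have Y: "Y x > 0" if "x \<in># M" for x using above[OF that] by (simp add: Y_def)
  have tY: "of_real t - x = of_real (Y x)" if "x \<in># M" for x
    using real[OF that] by (simp add: Y_def complex_eq_iff)
  have ne: "M \<noteq> {#}" using r by auto
  have Ft: "poly (monic_with_roots M) (of_real t) \<noteq> 0"
    using above[of "of_real t"] by (auto simp: poly_monic_with_roots_eq_0_iff)
  have inv: "(\<Sum>x\<in>#M. 1 / Y x) \<le> \<phi>"
  proof -
    have "poly (pderiv F) (of_real t) / poly F (of_real t) = (\<Sum>x\<in>#M. 1 / (of_real t - x))"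
      using log_derivative_monic_with_roots[OF Ft] c by (simp add: F pderiv_smult)
    also have "Re \<dots> = (\<Sum>x\<in>#M. Re (1 / (of_real t - x)))" by (rule Re_sum_mset)
    also have "\<dots> = (\<Sum>x\<in>#M. 1 / Y x)"
      by (intro arg_cong[where f = sum_mset] image_mset_cong) (simp add: tY Re_divide power2_eq_square)
    finally show ?thesis using \<phi>(1) by simp
  qed
  \<comment> \<open>This is the sum of the distances of the roots from the new point
    \<open>t - \<Delta>\<close>, that is, the value there of \<open>top_linear\<close> for the monic
    polynomial.\<close>
  define E where "E = (\<Sum>x\<in>#M. Y x) - r * \<Delta>"
  \<comment> \<open>The inverse distances of the other \<open>r - 1\<close> roots still sum to at
    most \<phi>, so by Cauchy-Schwarz their distances sum to at least (r - 1)^2 / \<phi>. That pays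
    for the loss \<open>r * \<Delta>\<close> and leaves \<open>Y x\<close> untouched.\<close>
  have YE: "Y x \<le> E" if x: "x \<in># M" for x
  proof -
    define M' where "M' = M - {#x#}"
    have M: "M = add_mset x M'" using x by (simp add: M'_def)
    have Y': "\<And>y. y \<in># M' \<Longrightarrow> 0 < Y y" using Y M by auto
    have nn: "0 \<le> (\<Sum>x\<in>#M'. Y x)" using less_imp_le[OF Y'] by (rule sum_mset_nonneg)
    have "1 / Y x + (\<Sum>x\<in>#M'. 1 / Y x) \<le> \<phi>" using inv by (simp add: M)
    moreover have "0 < 1 / Y x" using Y[OF x] by simp
    ultimately have "(\<Sum>x\<in>#M'. 1 / Y x) \<le> \<phi>" by linarith
    with sum_mset_Cauchy_Schwarz[of M' Y, OF Y']
    have "(real (size M'))\<^sup>2 \<le> (\<Sum>x\<in>#M'. Y x) * \<phi>"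
      using nn by (meson mult_left_mono order_trans)
    moreover have "real (size M') = real r - 1" using r M by auto
    ultimately have "r * \<Delta> * \<phi> \<le> (\<Sum>x\<in>#M'. Y x) * \<phi>" using \<Delta> by simp
    then have "r * \<Delta> \<le> (\<Sum>x\<in>#M'. Y x)" using \<phi>(2) by simp
    then show ?thesis by (simp add: E_def M)
  qed
  have E: "E > 0" using ne YE Y by (meson less_le_trans multiset_nonemptyE)
  have sumE: "(\<Sum>x\<in>#M. complex_of_real (t - \<Delta>) - x) = of_real E"
  proof -
    have "complex_of_real (t - \<Delta>) - x = of_real (Y x - \<Delta>)" if "x \<in># M" for x
      using tY[OF that] by (simp add: algebra_simps)
    then have "(\<Sum>x\<in>#M. complex_of_real (t - \<Delta>) - x) = (\<Sum>x\<in>#M. of_real (Y x - \<Delta>))"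
      by (intro arg_cong[where f = sum_mset] image_mset_cong)
    also have "\<dots> = of_real ((\<Sum>x\<in>#M. Y x) - size M * \<Delta>)"
      by (induction M) (auto simp: algebra_simps)
    finally show ?thesis by (simp add: E_def r)
  qed
  have TF: "top_linear r F (of_real (t - \<Delta>)) = of_real (c * E)"
    using top_linear_monic_with_roots[OF ne, of "of_real (t - \<Delta>)"] sumE r by (simp add: F top_linear_smult)
  show "0 < top_linear r F (of_real (t - \<Delta>))" using c E unfolding TF by (simp add: less_complex_def)
  have "Im (poly num t / poly (monic_with_roots M) t) \<le> 0" if "Im t > 0" for t
  proof -
    have "poly num t / poly F t = of_real (1 / c) * (poly num t / poly (monic_with_roots M) t)"
      by (simp add: F)
    then have "Im (poly num t / poly F t) = (1 / c) * Im (poly num t / poly (monic_with_roots M) t)"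
      by (simp only: times_complex.sel Re_complex_of_real Im_complex_of_real)
    then show ?thesis using num(2)[OF that] c by (simp add: divide_le_0_iff)
  qed
  then obtain a w where w: "\<forall>x. w x \<ge> (0::real)"
    and numeq: "num = Polynomial.smult a (monic_with_roots M) +
      (\<Sum>x\<in>set_mset M. Polynomial.smult (of_real (w x)) (monic_with_roots (M - {#x#})))"
    using partial_fractions_of_Im_nonpos[of M num] real num(1) r by blast
  have "top_linear r num (of_real (t - \<Delta>)) = a * of_real E + (\<Sum>x\<in>set_mset M. of_real (w x))"
  proof -
    have "top_linear r (monic_with_roots (M - {#x#})) (of_real (t - \<Delta>)) = 1" if "x \<in># M" for x
      using that r by (intro top_linear_monic_with_roots_Suc) (auto simp: size_Diff_singleton)
    then show ?thesis
      using top_linear_monic_with_roots[OF ne, of "of_real (t - \<Delta>)"] sumE r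
      by (simp add: numeq top_linear_add top_linear_sum top_linear_smult)
  qed
  then have 1: "top_linear r num (of_real (t - \<Delta>)) / top_linear r F (of_real (t - \<Delta>))
    = a / of_real c + of_real ((\<Sum>x\<in>set_mset M. w x / (c * E)))"
    unfolding TF using c E by (simp add: add_divide_distrib sum_divide_distrib)
  have 2: "poly num (of_real t) / poly F (of_real t) = a / of_real c + of_real (\<Sum>x\<in>set_mset M. w x / (c * Y x))"
  proof -
    have "poly (monic_with_roots (M - {#x#})) (of_real t) = poly (monic_with_roots M) (of_real t) / of_real (Y x)"
      if "x \<in># M" for x
      using arg_cong[OF monic_with_roots_remove[OF that], of "\<lambda>p. poly p (of_real t)"] tY[OF that] Y[OF that]
      by (simp add: field_simps del: mult_pCons_left) 
    then show ?thesis
      using Ft c by (simp add: numeq F poly_sum add_divide_distrib sum_divide_distrib mult.commute)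
  qed
  have "(\<Sum>x\<in>set_mset M. w x / (c * E)) \<le> (\<Sum>x\<in>set_mset M. w x / (c * Y x))"
    using w YE Y c by (intro sum_mono divide_left_mono mult_left_mono mult_pos_pos) (auto simp: E)
  then show "Re (top_linear r num (of_real (t - \<Delta>)) / top_linear r F (of_real (t - \<Delta>)))
      \<le> Re (poly num (of_real t) / poly F (of_real t))"
    unfolding 1 2 by simp
qed

section \<open>Stable families of multiaffine polynomials\<close>

text \<open>The first argument gives, for each colour, the indices not yet differentiated away; the
  second is the point. Differentiating the factor of one colour changes only the first
  argument.\<close>

type_synonym family = "(nat \<Rightarrow> nat set) \<Rightarrow> (nat \<Rightarrow> complex) \<Rightarrow> complex"

definition strip :: "nat \<Rightarrow> nat set \<Rightarrow> (nat \<Rightarrow> nat set) \<Rightarrow> nat \<Rightarrow> nat set" where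
  "strip j X S = (\<lambda>c. if c \<in> X then S c - {j} else S c)"

text \<open>One scheme for three operations on a product of \<open>r\<close> factors affine in
  \<open>z j\<close>. Deleting \<open>j\<close> from one colour at a time gives the derivative by
  Leibniz (\<open>partial\<close>); deleting it from all colours but one gives the derivative of
  order r - 1 divided by (r - 1)! (\<open>mix\<close>); with weights this becomes a combination of
  the choices of a colour for \<open>j\<close>.\<close>

definition strip_sum :: "nat \<Rightarrow> (nat \<Rightarrow> real) \<Rightarrow> (nat \<Rightarrow> nat set) \<Rightarrow> nat \<Rightarrow> family \<Rightarrow> family" where
  "strip_sum r w X j B = (\<lambda>S z. \<Sum>m<r. of_real (w m) * B (strip j (X m) S) z)"

abbreviation weighted_mix :: "nat \<Rightarrow> (nat \<Rightarrow> real) \<Rightarrow> nat \<Rightarrow> family \<Rightarrow> family" where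
  "weighted_mix r w \<equiv> strip_sum r w (\<lambda>m. - {m})"

abbreviation mix :: "nat \<Rightarrow> nat \<Rightarrow> family \<Rightarrow> family" where
  "mix r \<equiv> weighted_mix r (\<lambda>_. 1)"

abbreviation partial :: "nat \<Rightarrow> nat \<Rightarrow> family \<Rightarrow> family" where
  "partial r \<equiv> strip_sum r (\<lambda>_. 1) (\<lambda>m. {m})"

definition mixes :: "nat \<Rightarrow> nat list \<Rightarrow> family \<Rightarrow> family" where
  "mixes r is B = foldr (mix r) is B"

lemma mixes_simps [simp]: "mixes r [] B = B" "mixes r (i # is) B = mix r i (mixes r is B)"
  by (simp_all add: mixes_def)

lemma strip_commute: "strip i X (strip j Y S) = strip j Y (strip i X S)"
  by (auto simp: strip_def fun_eq_iff)

lemma strip_sum_commute: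
  "strip_sum r w X i (strip_sum r v Y j B) = strip_sum r v Y j (strip_sum r w X i B)"
proof (intro ext)
  fix S z
  show "strip_sum r w X i (strip_sum r v Y j B) S z = strip_sum r v Y j (strip_sum r w X i B) S z"
    unfolding strip_sum_def sum_distrib_left
    by (subst sum.swap) (simp add: strip_commute[of i] mult.left_commute)
qed

lemma mixes_strip_sum: "mixes r is (strip_sum r w X j B) = strip_sum r w X j (mixes r is B)"
  by (induction "is") (simp_all add: strip_sum_commute[of _ _ _ j])

text \<open>The bridge to one variable: as a function of \<open>z i\<close> the family is a
  polynomial whose leading coefficient, \<open>top_linear\<close> and derivative are deletions of
  \<open>i\<close>. Everything is linear in the family, so the property survives operations in other
  indices.\<close>

definition coord_poly :: "nat \<Rightarrow> nat \<Rightarrow> family \<Rightarrow> bool" where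
  "coord_poly r i B \<longleftrightarrow> (\<forall>S z. (\<forall>c. i \<in> S c) \<longrightarrow> (\<exists>F. degree F \<le> r \<and>
    (\<forall>t. poly F t = B S (z(i := t))) \<and> coeff F r = B (strip i UNIV S) z \<and>
    (\<forall>t. top_linear r F t = mix r i B S (z(i := t))) \<and>
    (\<forall>t. poly (pderiv F) t = partial r i B S (z(i := t)))))"

lemma pderiv_sum: "pderiv (\<Sum>i\<in>I. f i) = (\<Sum>i\<in>I. pderiv (f i))"
  by (induction I rule: infinite_finite_induct) (simp_all add: pderiv_add)

lemma coord_poly_strip_sum:
  assumes B: "coord_poly r i B" and ij: "i \<noteq> j"
  shows "coord_poly r i (strip_sum r w X j B)"
  unfolding coord_poly_def
proof (intro allI impI)
  fix S :: "nat \<Rightarrow> nat set" and z :: "nat \<Rightarrow> complex"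
  assume S: "\<forall>c. i \<in> S c"
  have "\<forall>m. \<exists>F. degree F \<le> r \<and>
    (\<forall>t. poly F t = B (strip j (X m) S) (z(i := t))) \<and>
    coeff F r = B (strip i UNIV (strip j (X m) S)) z \<and>
    (\<forall>t. top_linear r F t = mix r i B (strip j (X m) S) (z(i := t))) \<and>
    (\<forall>t. poly (pderiv F) t = partial r i B (strip j (X m) S) (z(i := t)))"
    using B S ij unfolding coord_poly_def by (auto simp: strip_def)
  then obtain F where F: "\<And>m. degree (F m) \<le> r"
    "\<And>m t. poly (F m) t = B (strip j (X m) S) (z(i := t))"
    "\<And>m. coeff (F m) r = B (strip i UNIV (strip j (X m) S)) z"
    "\<And>m t. top_linear r (F m) t = mix r i B (strip j (X m) S) (z(i := t))"
    "\<And>m t. poly (pderiv (F m)) t = partial r i B (strip j (X m) S) (z(i := t))"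
    by metis
  define G where "G = (\<Sum>m<r. Polynomial.smult (of_real (w m)) (F m))"
  have comm: "strip_sum r v Y i (strip_sum r w X j B) S z' =
      (\<Sum>m<r. of_real (w m) * strip_sum r v Y i B (strip j (X m) S) z')" for v Y z'
    by (subst strip_sum_commute) (simp add: strip_sum_def[of r w])
  show "\<exists>F. degree F \<le> r \<and> (\<forall>t. poly F t = strip_sum r w X j B S (z(i := t))) \<and>
    coeff F r = strip_sum r w X j B (strip i UNIV S) z \<and>
    (\<forall>t. top_linear r F t = mix r i (strip_sum r w X j B) S (z(i := t))) \<and>
    (\<forall>t. poly (pderiv F) t = partial r i (strip_sum r w X j B) S (z(i := t)))"
  proof (intro exI[of _ G] conjI allI)
    show "degree G \<le> r" unfolding G_def
      by (intro degree_sum_le) (auto intro: order.trans[OF degree_smult_le] F(1))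
    show "poly G t = strip_sum r w X j B S (z(i := t))" for t
      by (simp add: G_def poly_sum F(2) strip_sum_def)
    show "coeff G r = strip_sum r w X j B (strip i UNIV S) z"
      by (simp add: G_def coeff_sum F(3) strip_sum_def strip_commute[of i])
    show "top_linear r G t = mix r i (strip_sum r w X j B) S (z(i := t))" for t
      by (simp add: G_def top_linear_sum top_linear_smult F(4) comm)
    show "poly (pderiv G) t = partial r i (strip_sum r w X j B) S (z(i := t))" for t
      by (simp add: G_def pderiv_sum pderiv_smult poly_sum F(5) comm)
  qed
qed

lemma coord_poly_mixes:
  assumes "coord_poly r i B" "i \<notin> set is"
  shows "coord_poly r i (mixes r is B)"
  using assms by (induction "is") (auto intro: coord_poly_strip_sum)

text \<open>The only joint regularity in several variables that is kept: it yields limits along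
  lines and univariate polynomials on the diagonal \<open>z k = x\<close>.\<close>

definition line_poly :: "family \<Rightarrow> bool" where
  "line_poly B \<longleftrightarrow> (\<forall>S z w. \<exists>p. \<forall>e. poly p e = B S (\<lambda>k. z k + e * w k))"

lemma line_poly_strip_sum:
  assumes "line_poly B"
  shows "line_poly (strip_sum r v X j B)"
  unfolding line_poly_def
proof (intro allI)
  fix S z w
  have "\<forall>m. \<exists>p. \<forall>e. poly p e = B (strip j (X m) S) (\<lambda>k. z k + e * w k)"
    using assms by (auto simp: line_poly_def)
  then obtain p where "\<And>m e. poly (p m) e = B (strip j (X m) S) (\<lambda>k. z k + e * w k)" by metis
  then show "\<exists>p. \<forall>e. poly p e = strip_sum r v X j B S (\<lambda>k. z k + e * w k)"
    by (intro exI[of _ "\<Sum>m<r. Polynomial.smult (of_real (v m)) (p m)"]) (simp add: poly_sum strip_sum_def)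
qed

lemma line_poly_mixes: "line_poly B \<Longrightarrow> line_poly (mixes r is B)"
  by (induction "is") (auto intro: line_poly_strip_sum)

definition real_family :: "family \<Rightarrow> bool" where
  "real_family B \<longleftrightarrow> (\<forall>S z. B S (\<lambda>k. cnj (z k)) = cnj (B S z))"

lemma real_family_strip_sum: "real_family B \<Longrightarrow> real_family (strip_sum r v X j B)"
  by (simp add: real_family_def strip_sum_def)

lemma real_family_mixes: "real_family B \<Longrightarrow> real_family (mixes r is B)"
  by (induction "is") (auto intro: real_family_strip_sum)

text \<open>\<open>X\<close> holds the indices already mixed. They must be present in every colour,
  since mixing deletes them from all colours but one and only then is the derivative interpretation
  available.\<close>

definition stable_family :: "nat set \<Rightarrow> family \<Rightarrow> bool" where
  "stable_family X B \<longleftrightarrow> (\<forall>S z. (\<forall>c. X \<subseteq> S c) \<longrightarrow> (\<forall>k. Im (z k) > 0) \<longrightarrow> B S z \<noteq> 0)"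

text \<open>The leading coefficient in \<open>z i\<close> is the family with \<open>i\<close>
  deleted everywhere. As \<open>i\<close> is not in \<open>X\<close>, the stability of
  \<open>B\<close> itself makes it nonzero, and the zero of \<open>top_linear\<close> stays out of
  the upper half-plane.\<close>

lemma stable_family_mix:
  assumes B: "stable_family X B" "coord_poly r i B" and i: "i \<notin> X" and r: "r \<ge> 1"
  shows "stable_family (insert i X) (mix r i B)"
  unfolding stable_family_def
proof (intro allI impI)
  fix S :: "nat \<Rightarrow> nat set" and z :: "nat \<Rightarrow> complex"
  assume S: "\<forall>c. insert i X \<subseteq> S c" and z: "\<forall>k. Im (z k) > 0"
  obtain F where F: "degree F \<le> r" "\<And>t. poly F t = B S (z(i := t))"
    "coeff F r = B (strip i UNIV S) z" "\<And>t. top_linear r F t = mix r i B S (z(i := t))"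
    using B(2) S unfolding coord_poly_def by blast
  have "top_linear r F (z i) \<noteq> 0"
  proof (rule top_linear_nonzero_of_stable[OF _ F(1) r])
    show "poly F t \<noteq> 0" if "Im t > 0" for t
      using B(1) S z that unfolding F(2) stable_family_def by simp
    show "coeff F r \<noteq> 0"
    proof -
      have "\<forall>c. X \<subseteq> strip i UNIV S c" using S i by (auto simp: strip_def)
      then show ?thesis using B(1) z unfolding F(3) stable_family_def by blast
    qed
  qed (use z in simp)
  then show "mix r i B S z \<noteq> 0" by (simp add: F(4))
qed

lemma stable_family_mixes:
  assumes "stable_family X B" "\<And>i. i \<in> set is \<Longrightarrow> coord_poly r i B" "distinct is"
    "set is \<inter> X = {}" "r \<ge> 1"
  shows "stable_family (set is \<union> X) (mixes r is B)"
  using assms(2-4)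
proof (induction "is")
  case (Cons i "is")
  have "stable_family (insert i (set is \<union> X)) (mix r i (mixes r is B))"
    using Cons assms(5) by (intro stable_family_mix coord_poly_mixes Cons.IH) auto
  then show ?case by simp
qed (use assms(1) in simp)

text \<open>The bound survives when the remaining variables become real, which nonvanishing alone
  would not.\<close>

lemma stable_family_norm_ge:
  assumes B: "stable_family X B" "coord_poly r i B" "line_poly B" and i: "i \<notin> X"
    and S: "\<And>c. insert i X \<subseteq> S c" and z: "\<And>k. Im (z k) \<ge> 0"
  shows "Im (z i) ^ r * cmod (B (strip i UNIV S) z) \<le> cmod (B S z)"
proof -
  \<comment> \<open>All variables are raised by the same imaginary amount so that stability applies;
    afterwards \<open>e\<close> tends to 0.\<close>
  define Z where "Z = (\<lambda>e k. z k + e * \<i>)"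
  have *: "Im (Z (of_real e) i) ^ r * cmod (B (strip i UNIV S) (Z (of_real e))) \<le> cmod (B S (Z (of_real e)))"
    if e: "e > 0" for e :: real
  proof -
    define y where "y = Z (of_real e)"
    have y: "Im (y k) > 0" for k using z e by (simp add: y_def Z_def add_nonneg_pos)
    obtain F where F: "degree F \<le> r" "\<And>t. poly F t = B S (y(i := t))"
      "coeff F r = B (strip i UNIV S) y"
      using B(2) S unfolding coord_poly_def by (metis insert_subset)
    have "Im (y i) ^ r * cmod (coeff F r) \<le> cmod (poly F (y i))"
    proof (rule norm_poly_ge_of_stable[OF _ F(1) y])
      show "poly F t \<noteq> 0" if "Im t > 0" for t
      proof -
        have "\<forall>k. Im ((y(i := t)) k) > 0" "\<forall>c. X \<subseteq> S c" using y S that by auto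
        then show ?thesis using B(1) unfolding F(2) stable_family_def by blast
      qed
    qed
    then show ?thesis by (simp add: F y_def)
  qed
  have cont: "((\<lambda>e::real. B S' (Z (of_real e))) \<longlongrightarrow> B S' z) (at_right 0)" for S'
  proof -
    have "\<exists>p. \<forall>e. poly p e = B S' (\<lambda>k. z k + e * \<i>)"
      using spec[OF spec[OF spec[OF B(3)[unfolded line_poly_def], of S'], of z], of "\<lambda>_. \<i>"] .
    then obtain p where p: "\<And>e. poly p e = B S' (Z e)" unfolding Z_def by auto
    have "((\<lambda>e::real. poly p (of_real e)) \<longlongrightarrow> poly p (of_real 0)) (at_right 0)"
      by (intro tendsto_intros)
    then show ?thesis by (simp add: p) (simp add: Z_def)
  qed
  have "((\<lambda>e::real. z i + of_real e * \<i>) \<longlongrightarrow> z i + of_real 0 * \<i>) (at_right 0)"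
    by (intro tendsto_intros)
  then have Zi: "((\<lambda>e::real. Z (of_real e) i) \<longlongrightarrow> z i) (at_right 0)" by (simp add: Z_def)
  show ?thesis
  proof (rule tendsto_le[OF trivial_limit_at_right_real])
    show "((\<lambda>e::real. cmod (B S (Z (of_real e)))) \<longlongrightarrow> cmod (B S z)) (at_right 0)"
      by (intro tendsto_intros cont)
    show "((\<lambda>e::real. Im (Z (of_real e) i) ^ r * cmod (B (strip i UNIV S) (Z (of_real e))))
      \<longlongrightarrow> Im (z i) ^ r * cmod (B (strip i UNIV S) z)) (at_right 0)"
      by (intro tendsto_intros cont Zi)
    show "\<forall>\<^sub>F e in at_right 0. Im (Z (of_real e) i) ^ r * cmod (B (strip i UNIV S) (Z (of_real e)))
      \<le> cmod (B S (Z (of_real e)))"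
      using * by (auto simp: eventually_at_filter)
  qed
qed

section \<open>The barrier argument and interlacing\<close>

lemma real_complex_pos_iff: "0 < z \<longleftrightarrow> z \<in> \<real> \<and> 0 < Re z"
  by (auto simp: less_complex_def complex_is_Real_iff)

lemma Re_divide_pos: "0 < f \<Longrightarrow> Re (a / f) = Re a / Re f"
  by (auto simp: real_complex_pos_iff complex_is_Real_iff Re_divide power2_eq_square)

text \<open>Both sides are the coefficient of degree \<open>r\<close> of one and the same polynomial
  in the \<open>i\<close>-th variable, which does not remember its previous value.\<close>

lemma coord_poly_indep:
  assumes "coord_poly r i B" "\<And>c. i \<in> S c"
  shows "B (strip i UNIV S) (z(i := t)) = B (strip i UNIV S) z"
proof -
  obtain F where F: "\<And>u. poly F u = B S (z(i := u))" "coeff F r = B (strip i UNIV S) z"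
    using assms unfolding coord_poly_def by metis
  obtain G where G: "\<And>u. poly G u = B S ((z(i := t))(i := u))" "coeff G r = B (strip i UNIV S) (z(i := t))"
    using assms unfolding coord_poly_def by metis
  have "F = G" by (simp add: F G fun_eq_iff flip: poly_eq_poly_eq_iff)
  with F G show ?thesis by simp
qed

lemma sum_complex_pos:
  fixes f :: "'a \<Rightarrow> complex"
  assumes "finite I" "I \<noteq> {}" "\<And>i. i \<in> I \<Longrightarrow> 0 < f i"
  shows "0 < sum f I"
  using assms by (intro sum_pos) auto

lemma prod_complex_pos:
  fixes f :: "'a \<Rightarrow> complex"
  assumes "\<And>i. i \<in> I \<Longrightarrow> 0 < f i"
  shows "0 < prod f I"
  using assms
  by (induction I rule: infinite_finite_induct)
     (auto simp: real_complex_pos_iff complex_is_Real_iff)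

lemma coeff_prod_linear:
  fixes a b :: "'b \<Rightarrow> complex"
  assumes "finite C"
  shows "degree (\<Prod>c\<in>C. [:b c, a c:]) \<le> card C"
    and "coeff (\<Prod>c\<in>C. [:b c, a c:]) (card C) = (\<Prod>c\<in>C. a c)"
    and "C \<noteq> {} \<Longrightarrow> coeff (\<Prod>c\<in>C. [:b c, a c:]) (card C - 1) = (\<Sum>c\<in>C. b c * (\<Prod>d\<in>C - {c}. a d))"
proof -
  have "degree (\<Prod>c\<in>C. [:b c, a c:]) \<le> card C \<and>
    coeff (\<Prod>c\<in>C. [:b c, a c:]) (card C) = (\<Prod>c\<in>C. a c) \<and>
    (C \<noteq> {} \<longrightarrow> coeff (\<Prod>c\<in>C. [:b c, a c:]) (card C - 1) = (\<Sum>c\<in>C. b c * (\<Prod>d\<in>C - {c}. a d)))"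
    using assms
  proof (induction C)
    case (insert x C)
    define P where "P = (\<Prod>c\<in>C. [:b c, a c:])"
    have P: "degree P \<le> card C" "coeff P (card C) = (\<Prod>c\<in>C. a c)"
      "C \<noteq> {} \<Longrightarrow> coeff P (card C - 1) = (\<Sum>c\<in>C. b c * (\<Prod>d\<in>C - {c}. a d))"
      using insert.IH by (auto simp: P_def)
    have PS: "coeff P (Suc (card C)) = 0" using P(1) by (intro coeff_eq_0) simp
    have eq: "(\<Prod>c\<in>insert x C. [:b c, a c:]) = [:b x, a x:] * P"
      using insert.hyps by (simp add: P_def)
    have "degree (\<Prod>c\<in>insert x C. [:b c, a c:]) \<le> 1 + card C"
      unfolding eq by (rule order.trans[OF degree_mult_le]) (intro add_mono P(1), simp)
    moreover have "coeff (\<Prod>c\<in>insert x C. [:b c, a c:]) (Suc (card C)) = (\<Prod>c\<in>insert x C. a c)"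
      unfolding eq using insert.hyps by (simp add: PS P(2))
    moreover have "coeff (\<Prod>c\<in>insert x C. [:b c, a c:]) (card C) =
        (\<Sum>c\<in>insert x C. b c * (\<Prod>d\<in>insert x C - {c}. a d))"
    proof (cases "C = {}")
      case False
      then obtain k where k: "card C = Suc k" using insert.hyps by (metis card_eq_0_iff not0_implies_Suc)
      have "(\<Sum>c\<in>C. b c * (\<Prod>d\<in>insert x C - {c}. a d)) = (\<Sum>c\<in>C. a x * (b c * (\<Prod>d\<in>C - {c}. a d)))"
      proof (rule sum.cong[OF HOL.refl])
        fix c assume c: "c \<in> C"
        then have "insert x C - {c} = insert x (C - {c})" using insert.hyps by auto
        then show "b c * (\<Prod>d\<in>insert x C - {c}. a d) = a x * (b c * (\<Prod>d\<in>C - {c}. a d))"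
          using insert.hyps by simp
      qed
      moreover have "insert x C - {x} = C" using insert.hyps by auto
      ultimately show ?thesis
        unfolding eq using insert.hyps P(3)[OF False] P(2)
        by (simp add: k sum_distrib_left)
    qed (simp add: eq P_def)
    ultimately show ?case using insert.hyps by simp
  qed simp
  then show "degree (\<Prod>c\<in>C. [:b c, a c:]) \<le> card C"
    "coeff (\<Prod>c\<in>C. [:b c, a c:]) (card C) = (\<Prod>c\<in>C. a c)"
    "C \<noteq> {} \<Longrightarrow> coeff (\<Prod>c\<in>C. [:b c, a c:]) (card C - 1) = (\<Sum>c\<in>C. b c * (\<Prod>d\<in>C - {c}. a d))"
    by blast+
qed

text \<open>What the colouring argument uses about \<open>D S z\<close>, the principal minor on
  \<open>S\<close> of the diagonal matrix \<open>z\<close> minus A. \<open>affine\<close> is Laplace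
  expansion; \<open>pos\<close> and \<open>potential\<close> are where the bound on A
  enters.\<close>

locale minor_family =
  fixes n :: nat and D :: "nat set \<Rightarrow> (nat \<Rightarrow> complex) \<Rightarrow> complex"
  assumes affine: "i < n \<Longrightarrow> i \<in> S \<Longrightarrow> D S (z(i := t)) = D S (z(i := 0)) + t * D (S - {i}) z"
    and indep: "i \<notin> S \<Longrightarrow> D S (z(i := t)) = D S z"
    and stable: "(\<And>k. Im (z k) > 0) \<Longrightarrow> D S z \<noteq> 0"
    and refl: "D S (\<lambda>k. cnj (z k)) = cnj (D S z)"
    and line: "\<exists>p. \<forall>e. poly p e = D S (\<lambda>k. z k + e * w k)"
    and pos: "S \<subseteq> {..<n} \<Longrightarrow> (\<And>k. k \<in> S \<Longrightarrow> 1 < y k) \<Longrightarrow> 0 < D S (\<lambda>k. of_real (y k))"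
    and potential: "S \<subseteq> {..<n} \<Longrightarrow> j \<in> S \<Longrightarrow> (\<And>k. k \<in> S \<Longrightarrow> 2 \<le> y k) \<Longrightarrow>
      Re (D (S - {j}) (\<lambda>k. of_real (y k))) \<le> 2 / 3 * Re (D S (\<lambda>k. of_real (y k)))"
begin

definition base :: "nat \<Rightarrow> family" where
  "base r = (\<lambda>S z. \<Prod>c<r. D (S c) z)"

lemma line_poly_base: "line_poly (base r)"
  unfolding line_poly_def
proof (intro allI)
  fix S :: "nat \<Rightarrow> nat set" and z w
  have "\<forall>c. \<exists>p. \<forall>e. poly p e = D (S c) (\<lambda>k. z k + e * w k)" using line by blast
  then obtain p where "\<And>c e. poly (p c) e = D (S c) (\<lambda>k. z k + e * w k)" by metis
  then show "\<exists>p. \<forall>e. poly p e = base r S (\<lambda>k. z k + e * w k)"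
    by (intro exI[of _ "\<Prod>c<r. p c"]) (simp add: poly_prod base_def)
qed

lemma real_family_base: "real_family (base r)"
  by (simp add: real_family_def base_def refl)

lemma stable_family_base: "stable_family {} (base r)"
  by (simp add: stable_family_def base_def stable)

lemma coord_poly_base:
  assumes i: "i < n" and r: "r \<ge> 1"
  shows "coord_poly r i (base r)"
  unfolding coord_poly_def
proof (intro allI impI)
  fix S :: "nat \<Rightarrow> nat set" and z :: "nat \<Rightarrow> complex"
  assume S: "\<forall>c. i \<in> S c"
  define a where "a = (\<lambda>c. D (S c - {i}) z)"
  define b where "b = (\<lambda>c. D (S c) (z(i := 0)))"
  define F where "F = (\<Prod>c<r. [:b c, a c:])"
  have D1: "D (S c) (z(i := t)) = b c + t * a c" for c t
    using affine[OF i, of "S c" z t] S by (simp add: a_def b_def)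
  have D2: "D (S c - {i}) (z(i := t)) = a c" for c t
    by (simp add: a_def indep)
  have split: "prod g {..<r} = g c * prod g ({..<r} - {c})" if "c < r" for c and g :: "nat \<Rightarrow> complex"
    by (rule prod.remove) (use that in auto)
  show "\<exists>F. degree F \<le> r \<and> (\<forall>t. poly F t = base r S (z(i := t))) \<and> coeff F r = base r (strip i UNIV S) z \<and>
    (\<forall>t. top_linear r F t = mix r i (base r) S (z(i := t))) \<and>
    (\<forall>t. poly (pderiv F) t = partial r i (base r) S (z(i := t)))"
  proof (intro exI[of _ F] conjI allI)
    show "degree F \<le> r" using coeff_prod_linear(1)[of "{..<r}" b a] by (simp add: F_def)
    show "poly F t = base r S (z(i := t))" for t
      by (simp add: F_def poly_prod base_def D1)
    show "coeff F r = base r (strip i UNIV S) z"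
      using coeff_prod_linear(2)[of "{..<r}" b a] by (simp add: F_def base_def a_def strip_def)
    show "top_linear r F t = mix r i (base r) S (z(i := t))" for t
    proof -
      have "top_linear r F t = (\<Sum>c<r. b c * (\<Prod>d\<in>{..<r} - {c}. a d)) + of_nat r * t * (\<Prod>c<r. a c)"
        using coeff_prod_linear(2,3)[of "{..<r}" b a] r
        by (simp add: top_linear_def F_def lessThan_empty_iff)
      also have "of_nat r * t * (\<Prod>c<r. a c) = (\<Sum>c<r. t * (a c * (\<Prod>d\<in>{..<r} - {c}. a d)))"
        by (simp flip: split)
      also have "(\<Sum>c<r. b c * (\<Prod>d\<in>{..<r} - {c}. a d)) + \<dots> =
          (\<Sum>c<r. (b c + t * a c) * (\<Prod>d\<in>{..<r} - {c}. a d))"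
        by (simp add: sum.distrib algebra_simps)
      also have "\<dots> = mix r i (base r) S (z(i := t))"
        unfolding strip_sum_def base_def
        by (intro sum.cong HOL.refl) (simp add: split strip_def D1 D2)
      finally show ?thesis .
    qed
    show "poly (pderiv F) t = partial r i (base r) S (z(i := t))" for t
      unfolding strip_sum_def base_def F_def pderiv_prod poly_sum
      by (intro sum.cong HOL.refl) (simp add: split strip_def D1 D2 poly_prod pderiv_pCons)
  qed
qed

text \<open>Divided by the product of the minors without \<open>k\<close>, the sum becomes a
  nonnegative combination of the quotients \<open>D (S c) z / a c\<close>. Each lies in the open
  upper half-plane, and so does the combination.\<close>

lemma stable_family_weighted_mix_base:
  assumes k: "k < n" and w: "\<And>c. w c \<ge> 0" "c < r" "w c > 0"
  shows "stable_family {k} (weighted_mix r w k (base r))"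
  unfolding stable_family_def
proof (intro allI impI)
  fix S :: "nat \<Rightarrow> nat set" and z :: "nat \<Rightarrow> complex"
  assume S: "\<forall>c. {k} \<subseteq> S c" and z: "\<forall>k. Im (z k) > 0"
  define a where "a = (\<lambda>c. D (S c - {k}) z)"
  have a: "a c \<noteq> 0" for c unfolding a_def using stable z by blast
  have Im: "Im (D (S c) z / a c) > 0" for c
  proof -
    define b where "b = D (S c) (z(k := 0)) / a c"
    have eq: "D (S c) (z(k := t)) = (t + b) * a c" for t
      using affine[OF k, of "S c" z t] S a[of c] by (simp add: b_def a_def field_simps)
    \<comment> \<open>Otherwise \<open>- b\<close> would be a zero of the minor in the open upper
      half-plane.\<close>
    have "Im b \<ge> 0"
    proof (rule ccontr)
      assume "\<not> 0 \<le> Im b"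
      then have "D (S c) (z(k := - b)) \<noteq> 0" using z by (intro stable) simp
      then show False by (simp add: eq)
    qed
    moreover have "D (S c) z / a c = z k + b" using eq[of "z k"] a[of c] by simp
    ultimately show ?thesis using z by (simp add: add_pos_nonneg)
  qed
  have "weighted_mix r w k (base r) S z = (\<Sum>c<r. of_real (w c) * (D (S c) z / a c)) * (\<Prod>c<r. a c)"
    unfolding strip_sum_def base_def sum_distrib_right
  proof (intro sum.cong HOL.refl)
    fix c assume c: "c \<in> {..<r}"
    have split: "prod g {..<r} = g c * prod g ({..<r} - {c})" for g :: "nat \<Rightarrow> complex"
      by (rule prod.remove) (use c in auto)
    have "(\<Prod>d\<in>{..<r} - {c}. D (strip k (- {c}) S d) z) = (\<Prod>d\<in>{..<r} - {c}. a d)"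
      by (intro prod.cong) (auto simp: strip_def a_def)
    then show "of_real (w c) * (\<Prod>d<r. D (strip k (- {c}) S d) z) =
        of_real (w c) * (D (S c) z / a c) * (\<Prod>c<r. a c)"
      using a[of c] by (simp add: split) (simp add: strip_def)
  qed
  moreover have "Im (\<Sum>c<r. of_real (w c) * (D (S c) z / a c)) > 0"
  proof -
    have "(\<Sum>c<r. w c * Im (D (S c) z / a c)) > 0"
      by (rule sum_pos2[of _ c]) (use w Im less_imp_le in \<open>auto intro!: mult_nonneg_nonneg mult_pos_pos\<close>)
    then show ?thesis by (simp only: Im_sum times_complex.sel Re_complex_of_real Im_complex_of_real) simp
  qed
  then have "(\<Sum>c<r. of_real (w c) * (D (S c) z / a c)) \<noteq> 0" by (metis less_irrefl zero_complex.sel(2))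
  ultimately show "weighted_mix r w k (base r) S z \<noteq> 0" using a by simp
qed

text \<open>With ten colours the barrier argument lowers every coordinate from 2 to 4/5, keeping the
  logarithmic derivatives below 20/3.\<close>

definition above_roots :: "nat list \<Rightarrow> bool" where
  "above_roots is \<longleftrightarrow> (\<forall>S y. set is \<subseteq> S \<longrightarrow> S \<subseteq> {..<n} \<longrightarrow>
    (\<forall>k\<in>S. (if k \<in> set is then 4 / 5 else 2) \<le> y k) \<longrightarrow>
    0 < mixes 10 is (base 10) (\<lambda>_. S) (\<lambda>k. of_real (y k)) \<and>
    (\<forall>j\<in>S - set is. Re (partial 10 j (mixes 10 is (base 10)) (\<lambda>_. S) (\<lambda>k. of_real (y k)))
      \<le> 20 / 3 * Re (mixes 10 is (base 10) (\<lambda>_. S) (\<lambda>k. of_real (y k)))))"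

text \<open>With equal index sets the product is a tenth power, so its logarithmic derivative is ten
  times that of a single minor: the bound 2/3 becomes 20/3.\<close>

lemma above_roots_Nil: "above_roots []"
  unfolding above_roots_def
proof (intro allI impI conjI ballI)
  fix S :: "nat set" and y :: "nat \<Rightarrow> real"
  assume S: "S \<subseteq> {..<n}" and y: "\<forall>k\<in>S. (if k \<in> set [] then 4 / 5 else 2) \<le> y k"
  then have y2: "\<And>k. k \<in> S \<Longrightarrow> 2 \<le> y k" by simp
  define z where "z = (\<lambda>k. complex_of_real (y k))"
  have D: "0 < D S z" unfolding z_def using S y2 by (intro pos) force+
  then obtain d where d: "D S z = of_real d" "d > 0"
    by (metis complex_is_Real_iff of_real_Re real_complex_pos_iff)
  have base: "base 10 (\<lambda>_. S) z = of_real (d ^ 10)" by (simp add: base_def d)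
  show "0 < mixes 10 [] (base 10) (\<lambda>_. S) (\<lambda>k. of_real (y k))"
    using d(2) unfolding mixes_simps z_def[symmetric] base by (simp add: less_complex_def)
  fix j assume j: "j \<in> S - set []"
  have "0 < D (S - {j}) z" unfolding z_def using S y2 by (intro pos) force+
  then obtain e where e: "D (S - {j}) z = of_real e"
    by (metis complex_is_Real_iff of_real_Re real_complex_pos_iff)
  have ed: "e \<le> 2 / 3 * d" using potential[of S j y] S j y2 d e by (simp add: z_def)
  have "partial 10 j (base 10) (\<lambda>_. S) z = (\<Sum>m<10::nat. of_real (e * d ^ 9))"
    unfolding strip_sum_def base_def
  proof (intro sum.cong HOL.refl)
    fix m :: nat assume m: "m \<in> {..<10}"
    have "(\<Prod>c<10. D (strip j {m} (\<lambda>_. S) c) z) =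
        D (strip j {m} (\<lambda>_. S) m) z * (\<Prod>c\<in>{..<10} - {m}. D (strip j {m} (\<lambda>_. S) c) z)"
      by (rule prod.remove) (use m in auto)
    also have "(\<Prod>c\<in>{..<10} - {m}. D (strip j {m} (\<lambda>_. S) c) z) = (\<Prod>c\<in>{..<10} - {m}. of_real d)"
      by (intro prod.cong) (auto simp: strip_def d)
    also have "\<dots> = of_real (d ^ 9)" using m by (simp add: card_Diff_singleton)
    finally show "of_real 1 * (\<Prod>c<10. D (strip j {m} (\<lambda>_. S) c) z) = of_real (e * d ^ 9)"
      by (simp add: strip_def e)
  qed
  then have "Re (partial 10 j (base 10) (\<lambda>_. S) z) = 10 * (e * d ^ 9)" by simp
  also have "\<dots> \<le> 20 / 3 * d ^ 10"
    using mult_right_mono[OF ed, of "d ^ 9"] d(2) by (simp add: power_eq_if)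
  also have "\<dots> = 20 / 3 * Re (base 10 (\<lambda>_. S) z)" by (simp add: base del: of_real_power)
  finally show "Re (partial 10 j (mixes 10 [] (base 10)) (\<lambda>_. S) (\<lambda>k. of_real (y k)))
    \<le> 20 / 3 * Re (mixes 10 [] (base 10) (\<lambda>_. S) (\<lambda>k. of_real (y k)))"
    by (simp add: z_def)
qed

text \<open>\<open>barrier_shift\<close> in the variable \<open>z i\<close>, with the derivative in
  another variable \<open>z j\<close> as numerator. The hypothesis is used on \<open>S\<close>, but
  also on \<open>S - {i}\<close> and \<open>S - {i} - {j}\<close>, whose values are the leading
  coefficients that keep the relevant polynomials from degenerating.\<close>

lemma above_roots_Cons:
  assumes IH: "above_roots is" and "is": "distinct (i # is)" "set (i # is) \<subseteq> {..<n}"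
  shows "above_roots (i # is)"
  unfolding above_roots_def
proof (intro allI impI)
  fix S :: "nat set" and y :: "nat \<Rightarrow> real"
  assume S: "set (i # is) \<subseteq> S" "S \<subseteq> {..<n}"
    and y: "\<forall>k\<in>S. (if k \<in> set (i # is) then 4 / 5 else 2) \<le> y k"
  define B where "B = mixes 10 is (base 10)"
  have Bs: "stable_family (set is) B"
  proof -
    have "stable_family (set is \<union> {}) (mixes 10 is (base 10))"
      by (rule stable_family_mixes[OF stable_family_base]) (use "is" in \<open>auto intro: coord_poly_base\<close>)
    then show ?thesis by (simp add: B_def)
  qed
  have Bl: "line_poly B" unfolding B_def by (intro line_poly_mixes line_poly_base)
  have Br: "real_family B" unfolding B_def by (intro real_family_mixes real_family_base)
  have Bc: "coord_poly 10 j B" if "j \<in> S" "j \<notin> set is" for j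
    using that S unfolding B_def by (intro coord_poly_mixes coord_poly_base) auto
  have i: "i \<in> S" "i \<notin> set is" using S "is" by auto
  have IH': "0 < B (\<lambda>_. S') (\<lambda>k. of_real (x k)) \<and>
      (\<forall>j\<in>S' - set is. Re (partial 10 j B (\<lambda>_. S') (\<lambda>k. of_real (x k)))
        \<le> 20 / 3 * Re (B (\<lambda>_. S') (\<lambda>k. of_real (x k))))"
    if "set is \<subseteq> S'" "S' \<subseteq> S" "\<And>k. k \<in> S' \<Longrightarrow> (if k \<in> set is then 4 / 5 else 2) \<le> x k" for S' x
  proof -
    have "S' \<subseteq> {..<n}" "\<forall>k\<in>S'. (if k \<in> set is then 4 / 5 else 2) \<le> x k" using that S by auto
    with that(1) spec[OF spec[OF IH[unfolded above_roots_def], of S'], of x] show ?thesis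
      unfolding B_def by blast
  qed
  note IHpos = IH'[THEN conjunct1] and IHpot = IH'[THEN conjunct2, rule_format]
  define z where "z = (\<lambda>k. complex_of_real (y k))"
  obtain F where F: "degree F \<le> 10" "\<And>t. poly F t = B (\<lambda>_. S) (z(i := t))"
    "coeff F 10 = B (strip i UNIV (\<lambda>_. S)) z" "\<And>t. top_linear 10 F t = mix 10 i B (\<lambda>_. S) (z(i := t))"
    "\<And>t. poly (pderiv F) t = partial 10 i B (\<lambda>_. S) (z(i := t))"
    using Bc[OF i] i unfolding coord_poly_def by metis
  have strip_const: "strip k UNIV (\<lambda>_. S') = (\<lambda>_. S' - {k})" for k S' by (simp add: strip_def)
  have y': "(if k \<in> set is then 4 / 5 else 2) \<le> y k" if "k \<in> S - {i}" for k
    using y that by auto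
  have upd: "z(i := of_real u) = (\<lambda>k. of_real ((y(i := u)) k))" for u by (auto simp: z_def)
  have c0: "0 < coeff F 10"
    unfolding F(3) strip_const z_def using S i y' by (intro IHpos) auto
  then obtain c where c: "coeff F 10 = of_real c" "c > 0"
    by (metis complex_is_Real_iff of_real_Re real_complex_pos_iff)
  have dF: "degree F = 10" using F(1) c le_degree[of F 10] by simp
  have Fpos: "0 < poly F (of_real u)" if "u \<ge> 2" for u
    unfolding F(2) upd using that y S by (intro IHpos) auto
  have lower: "Im t ^ 10 * cmod (B (\<lambda>_. S - {i}) z') \<le> cmod (B (\<lambda>_. S) (z'(i := t)))"
    if "Im t \<ge> 0" "\<And>k. Im (z' k) \<ge> 0" for t z'
  proof -
    have "Im ((z'(i := t)) i) ^ 10 * cmod (B (strip i UNIV (\<lambda>_. S)) (z'(i := t))) \<le> cmod (B (\<lambda>_. S) (z'(i := t)))"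
      using Bs Bc[OF i] Bl i S that by (intro stable_family_norm_ge) auto
    then show ?thesis using coord_poly_indep[OF Bc[OF i], of "\<lambda>_. S" z' t] i by (simp add: strip_const)
  qed
  have zIm: "Im (z k) = 0" for k by (simp add: z_def)
  have Fst: "poly F t \<noteq> 0" if t: "Im t > 0" for t
  proof -
    have "0 < Im t ^ 10 * cmod (B (\<lambda>_. S - {i}) z)"
      using c t F(3) by (intro mult_pos_pos) (auto simp: strip_const)
    then show ?thesis using lower[of t z] t zIm F(2)[of t] by auto
  qed
  obtain M where M: "F = Polynomial.smult (lead_coeff F) (monic_with_roots M)" "size M = degree F" "\<forall>x\<in>#M. Im x \<le> 0"
    using stable_roots[OF Fst] by blast
  have FM: "F = Polynomial.smult (of_real c) (monic_with_roots M)" using M(1) dF c by simp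
  have root: "poly F x = 0" if "x \<in># M" for x
    using that poly_monic_with_roots_eq_0_iff[of M x] by (subst FM) simp
  have Fcnj: "poly F (cnj x) = cnj (poly F x)" for x
  proof -
    have "z(i := cnj x) = (\<lambda>k. cnj ((z(i := x)) k))" by (auto simp: z_def)
    then show ?thesis using Br unfolding F(2) real_family_def by metis
  qed
  have Mreal: "Im x = 0" if x: "x \<in># M" for x
  proof (rule ccontr)
    assume "Im x \<noteq> 0"
    then have "Im (cnj x) > 0" using M(3) x by force
    then show False using Fst Fcnj root[OF x] by (metis complex_cnj_zero)
  qed
  \<comment> \<open>The old family is examined at \<open>t \<ge> 2\<close>, where the hypothesis for
    an unmixed \<open>i\<close> applies; mixing then lowers the coordinate to \<open>y i\<close>.
    The step is admissible because 10 (6/5) (20/3) = 80 is at most 81 = 9^2.\<close>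
  define t where "t = y i + 6 / 5"
  have t: "t \<ge> 2" using y i S by (force simp: t_def)
  have Mabove: "Re x < t" if x: "x \<in># M" for x
  proof (rule ccontr)
    assume "\<not> Re x < t"
    then have "0 < poly F (of_real (Re x))" using t by (intro Fpos) simp
    moreover have "of_real (Re x) = x" using Mreal[OF x] by (simp add: complex_eq_iff)
    ultimately show False using root[OF x] by simp
  qed
  have ty: "t - 6 / 5 = y i" by (simp add: t_def)
  have zi: "z(i := of_real (y i)) = z" by (simp add: z_def fun_upd_idem)
  have Tt: "top_linear 10 F (of_real (t - 6 / 5)) = mix 10 i B (\<lambda>_. S) z"
    by (simp only: F(4) ty zi)
  have potF: "Re (poly (pderiv F) (of_real t) / poly F (of_real t)) \<le> 20 / 3"
  proof -
    have "Re (partial 10 i B (\<lambda>_. S) (\<lambda>k. of_real ((y(i := t)) k)))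
      \<le> 20 / 3 * Re (B (\<lambda>_. S) (\<lambda>k. of_real ((y(i := t)) k)))"
      using S y i t by (intro IHpot) auto
    then show ?thesis
      using Fpos[OF t] unfolding Re_divide_pos[OF Fpos[OF t]]
      by (simp add: F(2,5) upd real_complex_pos_iff divide_le_eq)
  qed
  note shift = barrier_shift[of M t 10 c F "20 / 3" "6 / 5", OF Mreal Mabove _ _ c(2) FM potF]
  have pos: "0 < mix 10 i B (\<lambda>_. S) z"
    using shift(1)[of 0] M(2) dF by (simp add: Tt[simplified])
  moreover have "Re (partial 10 j (mix 10 i B) (\<lambda>_. S) z) \<le> 20 / 3 * Re (mix 10 i B (\<lambda>_. S) z)"
    if j: "j \<in> S - set (i # is)" for j
  proof -
    have jj: "j \<in> S" "j \<notin> set is" "j \<noteq> i" using j by auto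
    obtain N where N: "degree N \<le> 10" "\<And>t. poly N t = partial 10 j B (\<lambda>_. S) (z(i := t))"
      "\<And>t. top_linear 10 N t = mix 10 i (partial 10 j B) (\<lambda>_. S) (z(i := t))"
      using coord_poly_strip_sum[OF Bc[OF i], of j "\<lambda>_. 1" "\<lambda>m. {m}"] i jj unfolding coord_poly_def by metis
    \<comment> \<open>For \<open>z i = u\<close> in the upper half-plane this quotient is the
      logarithmic derivative in \<open>z j\<close>, taken at the real point
      \<open>z j\<close>.\<close>
    have Im_N: "Im (poly N u / poly F u) \<le> 0" if u: "Im u > 0" for u
    proof -
      obtain G where G: "\<And>s. poly G s = B (\<lambda>_. S) (z(i := u, j := s))"
        "\<And>s. poly (pderiv G) s = partial 10 j B (\<lambda>_. S) (z(i := u, j := s))"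
        using Bc[OF jj(1,2)] jj unfolding coord_poly_def by metis
      have zj: "z(i := u, j := z j) = z(i := u)" using jj by auto
      \<comment> \<open>All variables except \<open>i\<close> and \<open>j\<close> are real, so the
        norm bound is used twice, in \<open>j\<close> after \<open>i\<close> has been deleted and
        then in \<open>i\<close>. It descends to a value that is positive by the induction
        hypothesis.\<close>
      have "poly G s \<noteq> 0" if s: "Im s > 0" for s
      proof -
        have eq: "B (strip j UNIV (\<lambda>_. S - {i})) (z(j := s)) = B (\<lambda>_. S - {i} - {j}) z"
          using coord_poly_indep[OF Bc[OF jj(1,2)], of "\<lambda>_. S - {i}" z s] jj by (simp add: strip_const)
        have "0 < B (\<lambda>_. S - {i} - {j}) z"
          unfolding z_def using S i jj y' by (intro IHpos) auto
        then have "0 < Im s ^ 10 * cmod (B (strip j UNIV (\<lambda>_. S - {i})) (z(j := s)))"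
          unfolding eq using s by (intro mult_pos_pos) auto
        also have "\<dots> = Im ((z(j := s)) j) ^ 10 * cmod (B (strip j UNIV (\<lambda>_. S - {i})) (z(j := s)))"
          by simp
        also have "\<dots> \<le> cmod (B (\<lambda>_. S - {i}) (z(j := s)))"
          using Bs Bc[OF jj(1,2)] Bl jj S i s zIm by (intro stable_family_norm_ge) auto
        finally have "0 < cmod (B (\<lambda>_. S - {i}) (z(j := s)))" .
        then have "0 < Im u ^ 10 * cmod (B (\<lambda>_. S - {i}) (z(j := s)))" using u by simp
        also have "\<dots> \<le> cmod (B (\<lambda>_. S) ((z(j := s))(i := u)))"
          using u s zIm by (intro lower) auto
        finally show ?thesis using jj by (simp add: G fun_upd_twist)
      qed
      moreover have "poly G (z j) \<noteq> 0" using Fst[OF u] by (simp add: G zj F(2))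
      moreover have "0 \<le> Im (z j)" using zIm[of j] by simp
      ultimately have "Im (poly (pderiv G) (z j) / poly G (z j)) \<le> 0"
        by (rule Im_log_derivative_of_stable)
      then show ?thesis by (simp add: G zj N(2) F(2))
    qed
    have potN: "Re (poly N (of_real t) / poly F (of_real t)) \<le> 20 / 3"
    proof -
      have "Re (partial 10 j B (\<lambda>_. S) (\<lambda>k. of_real ((y(i := t)) k)))
        \<le> 20 / 3 * Re (B (\<lambda>_. S) (\<lambda>k. of_real ((y(i := t)) k)))"
        using S y i t jj by (intro IHpot) auto
      then show ?thesis
        using Fpos[OF t] unfolding Re_divide_pos[OF Fpos[OF t]]
        by (simp add: F(2) N(2) upd real_complex_pos_iff divide_le_eq)
    qed
    have TN: "top_linear 10 N (of_real (t - 6 / 5)) = partial 10 j (mix 10 i B) (\<lambda>_. S) z"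
      by (simp only: N(3) ty zi) (subst strip_sum_commute, rule HOL.refl)
    have "Re (top_linear 10 N (of_real (t - 6 / 5)) / top_linear 10 F (of_real (t - 6 / 5)))
      \<le> Re (poly N (of_real t) / poly F (of_real t))"
      by (rule shift(2)) (use M(2) dF N(1) Im_N in auto)
    then have "Re (partial 10 j (mix 10 i B) (\<lambda>_. S) z / mix 10 i B (\<lambda>_. S) z) \<le> 20 / 3"
      using potN unfolding TN Tt by linarith
    then show ?thesis
      using pos unfolding Re_divide_pos[OF pos] by (simp add: real_complex_pos_iff divide_le_eq)
  qed
  ultimately show "0 < mixes 10 (i # is) (base 10) (\<lambda>_. S) (\<lambda>k. of_real (y k)) \<and>
    (\<forall>j\<in>S - set (i # is). Re (partial 10 j (mixes 10 (i # is) (base 10)) (\<lambda>_. S) (\<lambda>k. of_real (y k)))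
      \<le> 20 / 3 * Re (mixes 10 (i # is) (base 10) (\<lambda>_. S) (\<lambda>k. of_real (y k))))"
    by (simp add: B_def z_def)
qed

lemma above_roots: "distinct is \<Longrightarrow> set is \<subseteq> {..<n} \<Longrightarrow> above_roots is"
proof (induction "is")
  case (Cons i "is")
  show ?case by (rule above_roots_Cons) (use Cons in auto)
qed (rule above_roots_Nil)

text \<open>Along the segment from the sum to a summand that is positive at the left end of the half line,
  real-rootedness makes every positive member at least as large as its value at that end, so
  positivity propagates.\<close>

lemma positive_summand:
  fixes f :: "nat \<Rightarrow> complex \<Rightarrow> complex" and a b :: real
  assumes poly: "\<And>c. \<exists>p. \<forall>x. poly p x = f c x"
    and refl: "\<And>c x. f c (cnj x) = cnj (f c x)"
    and stable: "\<And>w x. (\<And>c. w c \<ge> 0) \<Longrightarrow> (\<exists>c<r. w c > 0) \<Longrightarrow> Im x > 0 \<Longrightarrow>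
      (\<Sum>c<r. of_real (w c) * f c x) \<noteq> 0"
    and pos: "\<And>c x. x > b \<Longrightarrow> 0 < f c (of_real x)"
    and sum: "\<And>x. x \<ge> a \<Longrightarrow> 0 < (\<Sum>c<r. f c (of_real x))"
  shows "\<exists>c<r. \<forall>x\<ge>a. 0 < f c (of_real x)"
proof -
  have real: "f c (of_real x) = of_real (Re (f c (of_real x)))" for c x
    using refl[of c "of_real x"] by (simp add: complex_eq_iff)
  define g where "g = (\<lambda>c x. Re (f c (of_real x)))"
  have fg: "f c (of_real x) = of_real (g c x)" for c x using real by (simp add: g_def)
  have fpos: "0 < f c (of_real x) \<longleftrightarrow> 0 < g c x" for c x by (simp add: fg less_complex_def)
  define G where "G = (\<lambda>x. \<Sum>c<r. g c x)"
  have Gpos: "0 < G x" if "x \<ge> a" for x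
  proof -
    have "(\<Sum>c<r. f c (of_real x)) = of_real (G x)" by (simp add: fg G_def)
    then show ?thesis using sum[OF that] by (simp add: less_complex_def)
  qed
  obtain p where p: "\<And>c x. poly (p c) x = f c x" using poly by metis
  obtain c where c: "c < r" "0 < g c a"
    using Gpos[of a] unfolding G_def by (metis lessThan_iff not_le order_refl sum_nonpos)
  \<comment> \<open>A segment from the sum (\<open>s = 0\<close>) to the chosen summand
    (\<open>s = 1\<close>). It equals the combination with weight 1 on \<open>c\<close> and
    \<open>1 - s\<close> on the others, so it is real-rooted throughout.\<close>
  define h where "h = (\<lambda>s x. s * g c x + (1 - s) * G x)"
  have hsum: "of_real (h s x) = (\<Sum>d<r. of_real ((if d = c then 1 else 1 - s)) * f d (of_real x))" for s x
  proof -
    have "h s x = (\<Sum>d<r. (if d = c then 1 else 1 - s) * g d x)"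
      using c(1) by (simp add: h_def G_def sum.remove[of "{..<r}" c] algebra_simps sum_distrib_left sum_subtractf)
    then show ?thesis by (simp add: fg)
  qed
  have mono: "h s a \<le> h s x" if s: "0 \<le> s" "s \<le> 1" and hp: "\<And>x. x \<ge> a \<Longrightarrow> 0 < h s x" and x: "x \<ge> a" for s x
  proof -
    define q where "q = (\<Sum>d<r. Polynomial.smult (of_real ((if d = c then 1 else 1 - s))) (p d))"
    have q: "poly q x = (\<Sum>d<r. of_real ((if d = c then 1 else 1 - s)) * f d x)" for x
      by (simp add: q_def poly_sum p)
    have "poly q (of_real a) \<le> poly q (of_real x)"
    proof (rule real_rooted_mono[where a = a])
      show "poly q t \<noteq> 0" if "Im t > 0" for t
        unfolding q by (rule stable) (use s c(1) that in auto)
      show "poly q (cnj t) = cnj (poly q t)" for t by (simp add: q refl)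
      show "0 < poly q (of_real x)" if "x \<ge> a" for x
        using hp[OF that] unfolding q hsum[symmetric] by (simp add: less_complex_def)
    qed (use x in auto)
    then show ?thesis unfolding q hsum[symmetric] by (simp add: less_eq_complex_def)
  qed
  define m where "m = min (g c a) (G a)"
  have m: "m > 0" using c Gpos[of a] by (simp add: m_def)
  have ha: "m \<le> h s a" if "0 \<le> s" "s \<le> 1" for s
  proof -
    have "m = s * m + (1 - s) * m" by (simp add: algebra_simps)
    also have "\<dots> \<le> h s a" unfolding h_def
      using that by (intro add_mono mult_left_mono) (auto simp: m_def)
    finally show ?thesis .
  qed
  have cont: "continuous_on UNIV (g d)" for d
    unfolding g_def p[symmetric] by (intro continuous_intros)
  have "continuous_on {a..max a b} (\<lambda>x. \<bar>g c x - G x\<bar>)"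
    unfolding G_def by (intro continuous_intros continuous_on_subset[OF cont]) auto
  then have "bounded ((\<lambda>x. \<bar>g c x - G x\<bar>) ` {a..max a b})"
    by (intro compact_imp_bounded compact_continuous_image) auto
  then obtain K where K: "K > 0" "\<And>x. x \<in> {a..max a b} \<Longrightarrow> \<bar>g c x - G x\<bar> \<le> K"
    unfolding bounded_pos by auto
  have hb: "0 < h s x" if s: "0 \<le> s" "s \<le> 1" and x: "x > b" for s x
  proof -
    have gp: "\<And>d. 0 < g d x" using pos[OF x] by (simp add: fpos)
    have "g c x \<le> G x" unfolding G_def using c(1) gp by (intro member_le_sum) (auto intro: less_imp_le)
    then have "s * g c x + (1 - s) * g c x \<le> h s x" unfolding h_def using s by (intro add_mono mult_left_mono) auto
    then show ?thesis using gp[of c] by (simp add: algebra_simps)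
  qed
  \<comment> \<open>Once positive on the half line, \<open>h s\<close> is at least \<open>m\<close>
    there by monotonicity. On the compact part it moves by at most \<open>K\<close> per unit of
    \<open>s\<close>, so a step of this length costs at most half of \<open>m\<close>; beyond
    \<open>b\<close> all members are positive anyway.\<close>
  define \<delta> where "\<delta> = m / (2 * K)"
  have \<delta>: "\<delta> > 0" using m K by (simp add: \<delta>_def)
  have step: "\<forall>x\<ge>a. 0 < h s' x"
    if s: "0 \<le> s" "s \<le> s'" "s' \<le> 1" "s' - s \<le> \<delta>" and hs: "\<forall>x\<ge>a. 0 < h s x" for s s'
  proof (intro allI impI)
    fix x assume x: "x \<ge> a"
    show "0 < h s' x"
    proof (cases "x > b")
      case False
      have "m \<le> h s x" using ha[of s] mono[of s x] s hs x by auto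
      moreover have "h s x - h s' x = (s' - s) * (G x - g c x)" by (simp add: h_def algebra_simps)
      moreover have "(s' - s) * (G x - g c x) \<le> (s' - s) * \<bar>g c x - G x\<bar>"
        using s by (intro mult_left_mono) auto
      moreover have "(s' - s) * \<bar>g c x - G x\<bar> \<le> \<delta> * K"
        using s K(2)[of x] x False K(1) \<delta> by (intro mult_mono) auto
      moreover have "\<delta> * K = m / 2" using K(1) by (simp add: \<delta>_def)
      ultimately show ?thesis using m by simp
    qed (use hb s in auto)
  qed
  have iter: "\<forall>x\<ge>a. 0 < h (min 1 (real k * \<delta>)) x" for k
  proof (induction k)
    case (Suc k)
    show ?case
      by (rule step[OF _ _ _ _ Suc.IH]) (use \<delta> in \<open>auto simp: min_def algebra_simps\<close>)
  qed (use Gpos \<delta> in \<open>simp add: h_def\<close>)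
  obtain k :: nat where "1 \<le> real k * \<delta>"
    using reals_Archimedean3[OF \<delta>] less_imp_le by blast
  with iter[of k] have "\<forall>x\<ge>a. 0 < h 1 x" by simp
  then show ?thesis using c by (intro exI[of _ c]) (simp add: h_def fpos)
qed

lemma base_pos:
  assumes "x > 1" "\<And>c. S c \<subseteq> {..<n}"
  shows "0 < base r S (\<lambda>_. of_real x)"
proof -
  have "0 < D (S c) (\<lambda>_. of_real x)" for c
    using assms pos[of "S c" "\<lambda>_. x"] by simp
  then show ?thesis unfolding base_def by (intro prod_complex_pos) simp
qed

lemma mixes_base_pos:
  assumes "x > 1" "r \<ge> 1" "\<And>c. S c \<subseteq> {..<n}"
  shows "0 < mixes r is (base r) S (\<lambda>_. of_real x)"
  using assms(3)
proof (induction "is" arbitrary: S)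
  case (Cons i "is")
  have "0 < mixes r is (base r) (strip i (- {c}) S) (\<lambda>_. of_real x)" for c
    by (rule Cons.IH) (use Cons.prems in \<open>auto simp: strip_def\<close>)
  moreover have "0 \<in> {..<r}" using assms(2) by simp
  ultimately show ?case by (auto simp: strip_sum_def intro!: sum_complex_pos)
qed (simp add: base_pos assms)

text \<open>Colours are fixed one index at a time while positivity on the half line from 4/5 is
  preserved. The initial case is \<open>above_roots\<close>, each step is
  \<open>positive_summand\<close>, and at the end the family is the product of the minors of the
  classes.\<close>

theorem exists_good_coloring:
  "\<exists>\<sigma>::nat \<Rightarrow> nat. (\<forall>i. \<sigma> i < 10) \<and>
    (\<forall>c<10. \<forall>x\<ge>4/5. D {i. i < n \<and> \<sigma> i = c} (\<lambda>_. of_real x) \<noteq> 0)"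
proof -
  \<comment> \<open>Undecided indices \<open>i \<ge> k\<close> belong to every colour; a decided
    index belongs only to its own.\<close>
  define cls where "cls = (\<lambda>k \<sigma> c. {i. i < n \<and> (i < k \<longrightarrow> \<sigma> i = (c::nat))})"
  have "\<exists>\<sigma>. (\<forall>i. \<sigma> i < 10) \<and> (\<forall>x\<ge>4/5. 0 < mixes 10 [k..<n] (base 10) (cls k \<sigma>) (\<lambda>_. of_real x))"
    if "k \<le> n" for k
    using that
  proof (induction k)
    case 0
    have "above_roots [0..<n]" by (rule above_roots) auto
    then have "0 < mixes 10 [0..<n] (base 10) (\<lambda>_. {..<n}) (\<lambda>_. of_real x)" if "x \<ge> 4/5" for x
      using that unfolding above_roots_def
      by (auto dest!: spec[of _ "{..<n}"] spec[of _ "\<lambda>_. x"])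
    moreover have "cls 0 \<sigma> = (\<lambda>_. {..<n})" for \<sigma> by (auto simp: cls_def)
    ultimately show ?case by (intro exI[of _ "\<lambda>_. 0"]) simp
  next
    case (Suc k)
    then obtain \<sigma> where \<sigma>: "\<And>i. \<sigma> i < 10"
      "\<And>x. x \<ge> 4/5 \<Longrightarrow> 0 < mixes 10 [k..<n] (base 10) (cls k \<sigma>) (\<lambda>_. of_real x)" by auto
    have k: "k < n" "[k..<n] = k # [Suc k..<n]" using Suc.prems by (auto simp: upt_conv_Cons)
    define Q where "Q = mixes 10 [Suc k..<n] (base 10)"
    define f where "f = (\<lambda>c x. Q (strip k (- {c}) (cls k \<sigma>)) (\<lambda>_. x))"
    have in_cls: "j \<in> cls k \<sigma> c" if "j \<in> set (k # [Suc k..<n])" for j c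
      using that k by (auto simp: cls_def)
    have "\<exists>c<10. \<forall>x\<ge>4/5. 0 < f c (of_real x)"
    proof (rule positive_summand[where b = 1])
      show "\<exists>p. \<forall>x. poly p x = f c x" for c
      proof -
        have "line_poly Q" unfolding Q_def by (intro line_poly_mixes line_poly_base)
        from this[unfolded line_poly_def, THEN spec, THEN spec, THEN spec,
            of "strip k (- {c}) (cls k \<sigma>)" "\<lambda>_. 0" "\<lambda>_. 1"]
        show ?thesis unfolding f_def by simp
      qed
      show "f c (cnj x) = cnj (f c x)" for c x
        using real_family_mixes[OF real_family_base, of 10 "[Suc k..<n]" 10] by (simp add: real_family_def f_def Q_def)
      show "0 < f c (of_real x)" if "x > 1" for c x
        unfolding f_def Q_def by (rule mixes_base_pos) (use that in \<open>auto simp: strip_def cls_def\<close>)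
      show "0 < (\<Sum>c<10. f c (of_real x))" if "x \<ge> 4/5" for x
        using \<sigma>(2)[OF that] by (simp add: k(2) strip_sum_def f_def Q_def)
      show "(\<Sum>c<10. of_real (w c) * f c x) \<noteq> 0"
        if w: "\<And>c. w c \<ge> 0" "\<exists>c<10. w c > 0" and x: "Im x > 0" for w x
      proof -
        obtain c where c: "c < 10" "w c > 0" using w by blast
        \<comment> \<open>Operations in different indices commute, so the weighted step at
          \<open>k\<close> may be carried out first, on the base family, where stability under
          weights is visible from the product.\<close>
        have "stable_family (set [Suc k..<n] \<union> {k}) (mixes 10 [Suc k..<n] (weighted_mix 10 w k (base 10)))"
          using stable_family_weighted_mix_base[of k w c 10] k(1) w(1) c
          by (intro stable_family_mixes coord_poly_strip_sum coord_poly_base) auto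
        then have "mixes 10 [Suc k..<n] (weighted_mix 10 w k (base 10)) (cls k \<sigma>) (\<lambda>_. x) \<noteq> 0"
          using in_cls x unfolding stable_family_def by (auto simp: subset_iff)
        then show ?thesis unfolding mixes_strip_sum by (simp add: strip_sum_def f_def Q_def)
      qed
    qed
    then obtain c where c: "c < 10" "\<And>x. x \<ge> 4/5 \<Longrightarrow> 0 < f c (of_real x)" by blast
    define \<tau> where "\<tau> = \<sigma>(k := c)"
    have "strip k (- {c}) (cls k \<sigma>) = cls (Suc k) \<tau>"
      using k(1) by (auto simp: \<tau>_def strip_def cls_def less_Suc_eq fun_eq_iff)
    moreover have "\<tau> i < 10" for i using c(1) \<sigma>(1) by (simp add: \<tau>_def)
    ultimately show ?case using c(2) by (intro exI[of _ \<tau>]) (simp add: f_def Q_def)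
  qed
  from this[of n] obtain \<sigma> where \<sigma>: "\<And>i. \<sigma> i < 10"
    "\<And>x. x \<ge> 4/5 \<Longrightarrow> 0 < base 10 (cls n \<sigma>) (\<lambda>_. of_real x)" by auto
  have "cls n \<sigma> c = {i. i < n \<and> \<sigma> i = c}" for c by (auto simp: cls_def)
  then have "D {i. i < n \<and> \<sigma> i = c} (\<lambda>_. of_real x) \<noteq> 0" if "c < 10" "x \<ge> 4/5" for c x
    using \<sigma>(2)[OF that(2)] that(1) unfolding base_def by (metis finite_lessThan lessThan_iff less_irrefl prod_zero_iff)
  with \<sigma>(1) show ?thesis by blast
qed

end

section \<open>Paving Hermitian matrices\<close>

lemma comm_ring_hom_cnj: "comm_ring_hom cnj"
  by unfold_locales auto

lemma comm_ring_hom_poly: "comm_ring_hom (\<lambda>p::complex poly. poly p e)"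
  by unfold_locales auto

definition form :: "nat \<Rightarrow> (nat \<Rightarrow> nat \<Rightarrow> complex) \<Rightarrow> (nat \<Rightarrow> complex) \<Rightarrow> complex" where
  "form n a v = (\<Sum>i<n. \<Sum>j<n. cnj (v i) * a i j * v j)"

definition sqnorm :: "nat \<Rightarrow> (nat \<Rightarrow> complex) \<Rightarrow> real" where
  "sqnorm n v = (\<Sum>i<n. (cmod (v i))\<^sup>2)"

locale hermitian_contraction =
  fixes n :: nat and a :: "nat \<Rightarrow> nat \<Rightarrow> complex"
  assumes hermitian: "a j i = cnj (a i j)" and diagonal_0: "a i i = 0"
    and contraction: "\<bar>Re (form n a v)\<bar> \<le> sqnorm n v"
begin

lemma cnj_entry: "cnj (a i j) = a j i"
  by (rule hermitian[symmetric])

text \<open>Rows and columns outside \<open>S\<close> are replaced by those of the identity. All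
  principal minors thus become determinants of matrices of the same size.\<close>

definition M :: "nat set \<Rightarrow> (nat \<Rightarrow> complex) \<Rightarrow> complex mat" where
  "M S z = mat n n (\<lambda>(k, l). if k \<in> S \<and> l \<in> S then (if k = l then z k else 0) - a k l
    else if k = l then 1 else 0)"

definition D :: "nat set \<Rightarrow> (nat \<Rightarrow> complex) \<Rightarrow> complex" where
  "D S z = Determinant.det (M S z)"

lemma M_carrier: "M S z \<in> carrier_mat n n" by (simp add: M_def)

lemma dim_M [simp]: "dim_row (M S z) = n" "dim_col (M S z) = n" by (simp_all add: M_def)

lemma M_index: "k < n \<Longrightarrow> l < n \<Longrightarrow> M S z $$ (k, l) = (if k \<in> S \<and> l \<in> S
    then (if k = l then z k else 0) - a k l else if k = l then 1 else 0)"
  by (simp add: M_def)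

lemma cofactor_M_upd: "i < n \<Longrightarrow> cofactor (M S (z(i := t))) i j = cofactor (M S z) i j"
  unfolding cofactor_def
  by (intro arg_cong[where f = "\<lambda>A. (-1) ^ (i + j) * Determinant.det A"] eq_matI)
     (auto simp: mat_delete_def M_def)

text \<open>In the matrix for \<open>S - {i}\<close> row \<open>i\<close> is a unit row, so its
  expansion is a single cofactor; that cofactor deletes the row and column in which the two matrices
  differ.\<close>

lemma cofactor_M_diag:
  assumes "i < n"
  shows "cofactor (M S z) i i = D (S - {i}) z"
proof -
  have "D (S - {i}) z = (\<Sum>j<n. M (S - {i}) z $$ (i, j) * cofactor (M (S - {i}) z) i j)"
    unfolding D_def by (rule laplace_expansion_row[OF M_carrier assms])
  also have "\<dots> = (\<Sum>j<n. if j = i then cofactor (M (S - {i}) z) i i else 0)"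
    by (intro sum.cong) (auto simp: M_index assms)
  also have "\<dots> = cofactor (M (S - {i}) z) i i" using assms by simp
  also have "\<dots> = cofactor (M S z) i i"
    unfolding cofactor_def
    by (intro arg_cong[where f = "\<lambda>A. (-1) ^ (i + i) * Determinant.det A"] eq_matI)
       (auto simp: mat_delete_def M_def)
  finally show ?thesis by simp
qed

lemma D_affine:
  assumes i: "i < n" "i \<in> S"
  shows "D S (z(i := t)) = D S (z(i := 0)) + t * D (S - {i}) z"
proof -
  have D: "D S (z(i := t)) = (\<Sum>j<n. M S (z(i := t)) $$ (i, j) * cofactor (M S z) i j)" for t
    unfolding D_def laplace_expansion_row[OF M_carrier i(1)] by (simp add: cofactor_M_upd i)
  have "D S (z(i := t)) = (\<Sum>j<n. M S (z(i := 0)) $$ (i, j) * cofactor (M S z) i j +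
      (if j = i then t * cofactor (M S z) i i else 0))"
    unfolding D by (intro sum.cong) (auto simp: M_index i algebra_simps)
  then show ?thesis by (simp add: sum.distrib D i cofactor_M_diag)
qed

lemma D_indep: "i \<notin> S \<Longrightarrow> D S (z(i := t)) = D S z"
  unfolding D_def by (intro arg_cong[where f = Determinant.det] eq_matI) (auto simp: M_def)

lemma D_cnj: "D S (\<lambda>k. cnj (z k)) = cnj (D S z)"
proof -
  interpret comm_ring_hom cnj by (rule comm_ring_hom_cnj)
  have "M S (\<lambda>k. cnj (z k)) = (map_mat cnj (M S z))\<^sup>T"
    by (rule eq_matI) (auto simp: M_def cnj_entry)
  then show ?thesis
    unfolding D_def by (simp add: Determinant.det_transpose[of _ n] M_carrier)
qed

lemma D_line: "\<exists>p. \<forall>e. poly p e = D S (\<lambda>k. z k + e * w k)"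
proof -
  define P where "P = mat n n (\<lambda>(k, l). if k \<in> S \<and> l \<in> S
    then (if k = l then [:z k, w k:] else 0) - [:a k l:] else if k = l then 1 else 0)"
  have "poly (Determinant.det P) e = D S (\<lambda>k. z k + e * w k)" for e
  proof -
    interpret comm_ring_hom "\<lambda>p::complex poly. poly p e" by (rule comm_ring_hom_poly)
    have "M S (\<lambda>k. z k + e * w k) = map_mat (\<lambda>p. poly p e) P"
      by (rule eq_matI) (auto simp: M_def P_def)
    then show ?thesis unfolding D_def by simp
  qed
  then show ?thesis by blast
qed

section \<open>Kernel and inverse in terms of vectors, and the energy identity\<close>

definition apply_M :: "nat set \<Rightarrow> (nat \<Rightarrow> complex) \<Rightarrow> (nat \<Rightarrow> complex) \<Rightarrow> nat \<Rightarrow> complex" where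
  "apply_M S z u k = (\<Sum>l<n. M S z $$ (k, l) * u l)"

lemma apply_M_outside: "k < n \<Longrightarrow> k \<notin> S \<Longrightarrow> apply_M S z u k = u k"
proof -
  assume k: "k < n" "k \<notin> S"
  then have "apply_M S z u k = (\<Sum>l<n. if l = k then u k else 0)"
    unfolding apply_M_def by (intro sum.cong) (auto simp: M_index)
  then show ?thesis using k by simp
qed

lemma apply_M_inside:
  assumes k: "k < n" "k \<in> S" and u: "\<And>l. l < n \<Longrightarrow> l \<notin> S \<Longrightarrow> u l = 0"
  shows "apply_M S z u k = z k * u k - (\<Sum>l<n. a k l * u l)"
proof -
  have "apply_M S z u k = (\<Sum>l<n. (if l = k then z k * u k else 0) - a k l * u l)"
    unfolding apply_M_def using k u by (intro sum.cong) (auto simp: M_index algebra_simps)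
  then show ?thesis using k by (simp add: sum_subtractf)
qed

lemma D_nonzero_iff: "D S z \<noteq> 0 \<longleftrightarrow> (\<forall>u. (\<forall>k<n. apply_M S z u k = 0) \<longrightarrow> (\<forall>k<n. u k = 0))"
proof -
  have mult: "(M S z *\<^sub>v v) $ k = apply_M S z (\<lambda>l. v $ l) k" if "k < n" "v \<in> carrier_vec n" for v k
    using that by (auto simp: apply_M_def scalar_prod_def atLeast0LessThan intro!: sum.cong)
  have "D S z = 0 \<longleftrightarrow> (\<exists>v. v \<in> carrier_vec n \<and> v \<noteq> 0\<^sub>v n \<and> M S z *\<^sub>v v = 0\<^sub>v n)"
    unfolding D_def by (rule det_0_iff_vec_prod_zero[OF M_carrier])
  also have "\<dots> \<longleftrightarrow> (\<exists>u. (\<forall>k<n. apply_M S z u k = 0) \<and> (\<exists>k<n. u k \<noteq> 0))" (is "?l \<longleftrightarrow> ?r")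
  proof
    assume ?l
    then obtain v where v: "v \<in> carrier_vec n" "v \<noteq> 0\<^sub>v n" "M S z *\<^sub>v v = 0\<^sub>v n" by blast
    have "\<forall>k<n. apply_M S z (\<lambda>l. v $ l) k = 0" using mult v by (metis index_zero_vec(1))
    moreover have "\<exists>k<n. v $ k \<noteq> 0"
    proof (rule ccontr)
      assume "\<not> (\<exists>k<n. v $ k \<noteq> 0)"
      then have "v = 0\<^sub>v n" using v(1) by (intro eq_vecI) auto
      with v(2) show False by simp
    qed
    ultimately show ?r by (intro exI[of _ "\<lambda>l. v $ l"]) simp
  next
    assume ?r
    then obtain u k where u: "\<forall>k<n. apply_M S z u k = 0" "k < n" "u k \<noteq> 0" by blast
    have "M S z *\<^sub>v vec n u = 0\<^sub>v n"
    proof (rule eq_vecI)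
      fix k assume "k < dim_vec (0\<^sub>v n :: complex Matrix.vec)"
      then have k: "k < n" by simp
      have "apply_M S z (\<lambda>l. vec n u $ l) k = apply_M S z u k"
        unfolding apply_M_def by (intro sum.cong) auto
      then show "(M S z *\<^sub>v vec n u) $ k = 0\<^sub>v n $ k" using u(1) k by (subst mult) auto
    qed simp
    moreover have "vec n u \<noteq> 0\<^sub>v n" using u(2,3) by (metis index_vec index_zero_vec(1))
    ultimately show ?l by (intro exI[of _ "vec n u"]) auto
  qed
  finally show ?thesis by blast
qed

text \<open>The \<open>j\<close>-th column of the inverse, taken from the adjugate. By Cramer its
  \<open>j\<close>-th entry is a quotient of minors, so estimates for vectors become estimates for
  minors.\<close>

lemma exists_column:
  assumes D: "D S z \<noteq> 0" and j: "j < n"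
  shows "\<exists>u. (\<forall>k<n. apply_M S z u k = (if k = j then 1 else 0)) \<and> u j * D S z = D (S - {j}) z"
proof -
  define u where "u = (\<lambda>l. adj_mat (M S z) $$ (l, j) / D S z)"
  have "apply_M S z u k = (if k = j then 1 else 0)" if k: "k < n" for k
  proof -
    have "(\<Sum>l<n. M S z $$ (k, l) * adj_mat (M S z) $$ (l, j)) = (M S z * adj_mat (M S z)) $$ (k, j)"
      using k j adj_mat(1)[OF M_carrier[of S z]]
      by (auto simp: times_mat_def scalar_prod_def atLeast0LessThan intro!: sum.cong)
    also have "\<dots> = (if k = j then D S z else 0)"
      using k j by (simp add: adj_mat(2)[OF M_carrier] D_def)
    finally show ?thesis using D by (simp add: apply_M_def u_def flip: sum_divide_distrib)
  qed
  moreover have "u j * D S z = D (S - {j}) z"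
    using D j by (simp add: u_def adj_mat_def cofactor_M_diag)
  ultimately show ?thesis by blast
qed

text \<open>Cauchy-Schwarz for the rows of the inverse; \<open>K\<close> is its squared Frobenius
  norm, plus 1 to be positive.\<close>

lemma sqnorm_le_apply_M:
  assumes D: "D S z \<noteq> 0"
  shows "\<exists>K>0. \<forall>u. sqnorm n u \<le> K * sqnorm n (apply_M S z u)"
proof -
  define C where "C = (\<lambda>l k. adj_mat (M S z) $$ (l, k) / D S z)"
  have u: "u l = (\<Sum>k<n. C l k * apply_M S z u k)" if l: "l < n" for u l
  proof -
    have *: "(\<Sum>k<n. adj_mat (M S z) $$ (l, k) * M S z $$ (k, m)) = (if l = m then D S z else 0)"
      if m: "m < n" for m
    proof -
      have "(\<Sum>k<n. adj_mat (M S z) $$ (l, k) * M S z $$ (k, m)) = (adj_mat (M S z) * M S z) $$ (l, m)"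
        using l m adj_mat(1)[OF M_carrier[of S z]]
        by (auto simp: times_mat_def scalar_prod_def atLeast0LessThan intro!: sum.cong)
      then show ?thesis using l m by (simp add: adj_mat(3)[OF M_carrier] D_def)
    qed
    have "(\<Sum>k<n. C l k * apply_M S z u k) =
        (\<Sum>m<n. (\<Sum>k<n. adj_mat (M S z) $$ (l, k) * M S z $$ (k, m)) * u m / D S z)"
      unfolding apply_M_def C_def sum_distrib_left sum_distrib_right sum_divide_distrib
      by (subst sum.swap) (simp add: mult.assoc)
    also have "\<dots> = (\<Sum>m<n. if m = l then u l else 0)"
      using D by (intro sum.cong) (auto simp: *)
    finally show ?thesis using l by simp
  qed
  define K where "K = (\<Sum>l<n. \<Sum>k<n. (cmod (C l k))\<^sup>2) + 1"
  have "sqnorm n u \<le> K * sqnorm n (apply_M S z u)" for u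
  proof -
    have "(cmod (u l))\<^sup>2 \<le> (\<Sum>k<n. (cmod (C l k))\<^sup>2) * sqnorm n (apply_M S z u)" if l: "l < n" for l
    proof -
      have "cmod (u l) \<le> (\<Sum>k<n. cmod (C l k) * cmod (apply_M S z u k))"
        by (subst u[OF l]) (rule order.trans[OF norm_sum], simp add: norm_mult)
      then have "(cmod (u l))\<^sup>2 \<le> (\<Sum>k<n. cmod (C l k) * cmod (apply_M S z u k))\<^sup>2"
        by (rule power_mono) simp
      also have "\<dots> \<le> (\<Sum>k<n. (cmod (C l k))\<^sup>2) * (\<Sum>k<n. (cmod (apply_M S z u k))\<^sup>2)"
        by (rule Cauchy_Schwarz_ineq_sum)
      finally show ?thesis by (simp add: sqnorm_def)
    qed
    then have "sqnorm n u \<le> (\<Sum>l<n. (\<Sum>k<n. (cmod (C l k))\<^sup>2) * sqnorm n (apply_M S z u))"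
      unfolding sqnorm_def[of n u] by (intro sum_mono) simp
    also have "\<dots> \<le> K * sqnorm n (apply_M S z u)"
      by (simp add: K_def distrib_right sum_distrib_right sqnorm_def sum_nonneg)
    finally show ?thesis .
  qed
  moreover have "K > 0" by (simp add: K_def add_nonneg_pos sum_nonneg)
  ultimately show ?thesis by blast
qed

lemma form_real: "Im (form n a v) = 0"
proof -
  have "cnj (form n a v) = form n a v"
    unfolding form_def by (subst sum.swap) (simp add: cnj_entry mult.commute mult.left_commute)
  then show ?thesis by (simp add: complex_eq_iff)
qed

lemma energy_identity:
  assumes u: "\<And>l. l < n \<Longrightarrow> l \<notin> S \<Longrightarrow> u l = 0"
  shows "(\<Sum>k<n. cnj (u k) * apply_M S z u k) = (\<Sum>k<n. z k * of_real ((cmod (u k))\<^sup>2)) - form n a u"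
proof -
  have "cnj (u k) * apply_M S z u k = z k * of_real ((cmod (u k))\<^sup>2) - (\<Sum>l<n. cnj (u k) * a k l * u l)"
    if k: "k < n" for k
  proof (cases "k \<in> S")
    case True
    then show ?thesis
      by (simp add: apply_M_inside[OF k True u] complex_norm_square algebra_simps sum_distrib_left
          del: of_real_power)
  qed (use u k in simp)
  then show ?thesis by (simp add: form_def sum_subtractf)
qed

text \<open>The form of a Hermitian matrix is real, so for a kernel vector the imaginary part of the
  energy is the sum of \<open>Im (z k) * (cmod (u k))\<^sup>2\<close> and must vanish.\<close>

lemma D_stable:
  assumes z: "\<And>k. Im (z k) > 0"
  shows "D S z \<noteq> 0"
  unfolding D_nonzero_iff
proof (intro allI impI)
  fix u :: "nat \<Rightarrow> complex" and k assume u: "\<forall>k<n. apply_M S z u k = 0" and k: "k < n"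
  have "u l = 0" if "l < n" "l \<notin> S" for l using apply_M_outside[OF that, of z u] u that by simp
  from energy_identity[of S u z, OF this] u
  have "(\<Sum>k<n. z k * of_real ((cmod (u k))\<^sup>2)) = form n a u" by simp
  then have "Im (\<Sum>k<n. z k * of_real ((cmod (u k))\<^sup>2)) = 0" by (simp add: form_real)
  then have "(\<Sum>k<n. Im (z k) * (cmod (u k))\<^sup>2) = 0" by simp
  then have "Im (z k) * (cmod (u k))\<^sup>2 = 0"
    using z k by (subst (asm) sum_nonneg_eq_0_iff) (auto intro!: mult_nonneg_nonneg intro: less_imp_le)
  then show "u k = 0" using z[of k] by simp
qed

text \<open>Here the real part decides: for a kernel vector the contraction bound leaves the sum of
  \<open>(y k - 1) * (cmod (u k))\<^sup>2\<close> at most 0, while the vector vanishes outside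
  \<open>S\<close>.\<close>

lemma D_nonzero_real:
  assumes S: "S \<subseteq> {..<n}" and y: "\<And>k. k \<in> S \<Longrightarrow> 1 < y k"
  shows "D S (\<lambda>k. of_real (y k)) \<noteq> 0"
  unfolding D_nonzero_iff
proof (intro allI impI)
  fix u :: "nat \<Rightarrow> complex" and k
  assume u: "\<forall>k<n. apply_M S (\<lambda>k. of_real (y k)) u k = 0" and k: "k < n"
  have u0: "u l = 0" if "l < n" "l \<notin> S" for l using apply_M_outside[OF that, of _ u] u that by metis
  from energy_identity[of S u "\<lambda>k. of_real (y k)", OF u0] u
  have "(\<Sum>k<n. of_real (y k) * of_real ((cmod (u k))\<^sup>2)) = form n a u" by simp
  then have "Re (\<Sum>k<n. of_real (y k) * of_real ((cmod (u k))\<^sup>2)) = Re (form n a u)" by (rule arg_cong)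
  then have "(\<Sum>k<n. y k * (cmod (u k))\<^sup>2) = Re (form n a u)" by (simp del: of_real_power)
  then have "(\<Sum>k<n. y k * (cmod (u k))\<^sup>2) \<le> (\<Sum>k<n. (cmod (u k))\<^sup>2)"
    using contraction[of u] by (simp add: sqnorm_def)
  then have le: "(\<Sum>k<n. (y k - 1) * (cmod (u k))\<^sup>2) \<le> 0" by (simp add: left_diff_distrib sum_subtractf)
  have nn: "(y k - 1) * (cmod (u k))\<^sup>2 \<ge> 0" if "k < n" for k
    using y[of k] u0[OF that] by (cases "k \<in> S") auto
  then have "(\<Sum>k<n. (y k - 1) * (cmod (u k))\<^sup>2) = 0" using le by (intro antisym sum_nonneg) auto
  then have "(y k - 1) * (cmod (u k))\<^sup>2 = 0"
    using nn k by (subst (asm) sum_nonneg_eq_0_iff) auto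
  then show "u k = 0" using y[of k] u0[OF k] by (cases "k \<in> S") auto
qed

lemma D_empty: "D {} z = 1"
proof -
  have "M {} z = 1\<^sub>m n" by (rule eq_matI) (auto simp: M_def)
  then show ?thesis by (simp add: D_def)
qed

lemma column_energy:
  assumes S: "S \<subseteq> {..<n}" and y: "\<And>k. k \<in> S \<Longrightarrow> 1 < y k" and j: "j \<in> S"
    and u: "\<And>k. k < n \<Longrightarrow> apply_M S (\<lambda>k. of_real (y k)) u k = (if k = j then 1 else 0)"
  shows "k < n \<Longrightarrow> k \<notin> S \<Longrightarrow> u k = 0"
    and "u j = of_real ((\<Sum>k<n. y k * (cmod (u k))\<^sup>2) - Re (form n a u))"
    and "0 < (\<Sum>k<n. y k * (cmod (u k))\<^sup>2) - Re (form n a u)"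
proof -
  have jn: "j < n" using S j by auto
  show u0: "u k = 0" if "k < n" "k \<notin> S" for k
  proof -
    have "k \<noteq> j" using that j by auto
    then show ?thesis using apply_M_outside[OF that, of "\<lambda>k. of_real (y k)" u] u[OF that(1)] by simp
  qed
  have "(\<Sum>k<n. cnj (u k) * apply_M S (\<lambda>k. of_real (y k)) u k) = (\<Sum>k<n. if k = j then cnj (u j) else 0)"
    by (intro sum.cong) (auto simp: u)
  then have "cnj (u j) = (\<Sum>k<n. of_real (y k) * of_real ((cmod (u k))\<^sup>2)) - form n a u"
    using energy_identity[of S u "\<lambda>k. of_real (y k)", OF u0] jn by simp
  also have "form n a u = of_real (Re (form n a u))" by (simp add: complex_eq_iff form_real)
  also have "(\<Sum>k<n. of_real (y k) * of_real ((cmod (u k))\<^sup>2)) - of_real (Re (form n a u)) =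
      complex_of_real ((\<Sum>k<n. y k * (cmod (u k))\<^sup>2) - Re (form n a u))" by simp
  finally show uj: "u j = of_real ((\<Sum>k<n. y k * (cmod (u k))\<^sup>2) - Re (form n a u))"
    by (metis complex_cnj_cnj complex_cnj_complex_of_real)
  have "\<exists>k<n. u k \<noteq> 0"
  proof (rule ccontr)
    assume "\<not> (\<exists>k<n. u k \<noteq> 0)"
    then have "apply_M S (\<lambda>k. of_real (y k)) u j = 0" by (simp add: apply_M_def)
    then show False using u[OF jn] by simp
  qed
  then obtain k where k: "k < n" "u k \<noteq> 0" by blast
  have "0 < (y k - 1) * (cmod (u k))\<^sup>2" using y[of k] u0[OF k(1)] k(2) by (cases "k \<in> S") auto
  then have "0 < (\<Sum>k<n. (y k - 1) * (cmod (u k))\<^sup>2)"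
  proof (rule sum_pos2[of _ k, rotated 2])
    show "0 \<le> (y i - 1) * (cmod (u i))\<^sup>2" if "i \<in> {..<n}" for i
      using y[of i] u0[of i] that by (cases "i \<in> S") auto
  qed (use k in auto)
  then have "sqnorm n u < (\<Sum>k<n. y k * (cmod (u k))\<^sup>2)"
    by (simp add: left_diff_distrib sum_subtractf sqnorm_def)
  then show "0 < (\<Sum>k<n. y k * (cmod (u k))\<^sup>2) - Re (form n a u)"
    using contraction[of u] by linarith
qed

text \<open>The quotient of the minors for \<open>S\<close> and \<open>insert j S\<close> is a
  diagonal entry of an inverse, equal to the energy of its column and therefore positive; induction
  starts from the empty minor 1.\<close>

lemma D_pos:
  assumes "S \<subseteq> {..<n}" "\<And>k. k \<in> S \<Longrightarrow> 1 < y k"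
  shows "0 < D S (\<lambda>k. of_real (y k))"
proof -
  have "finite S" using assms(1) finite_subset by blast
  then show ?thesis using assms
  proof (induction S)
    case (insert j S)
    define z where "z = (\<lambda>k. complex_of_real (y k))"
    have j: "j < n" using insert.prems by auto
    have nz: "D (insert j S) z \<noteq> 0" unfolding z_def using insert.prems by (intro D_nonzero_real) auto
    then obtain u where u: "\<forall>k<n. apply_M (insert j S) z u k = (if k = j then 1 else 0)"
      "u j * D (insert j S) z = D (insert j S - {j}) z" using exists_column[OF _ j] by metis
    obtain b where b: "u j = of_real b" "b > 0"
      using column_energy(2,3)[of "insert j S" y j u] insert.prems u(1) unfolding z_def by blast
    have "0 < D S z" unfolding z_def using insert by auto
    moreover have "insert j S - {j} = S" using insert.hyps by auto
    ultimately have "0 < of_real b * D (insert j S) z" using u(2) b(1) by simp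
    then show ?case using b(2) by (simp add: real_complex_pos_iff complex_is_Real_iff zero_less_mult_iff z_def)
  qed (simp add: D_empty less_complex_def)
qed

lemma form_add_unit:
  assumes "j < n"
  shows "Re (form n a (\<lambda>k. u k + (if k = j then of_real g else 0))) =
    Re (form n a u) + 2 * g * Re (\<Sum>l<n. a j l * u l)"
proof -
  define e where "e = (\<lambda>k. if k = j then complex_of_real g else 0)"
  have eq: "cnj (u i + e i) * a i l * (u l + e l) = cnj (u i) * a i l * u l + (if i = j then of_real g * a j l * u l else 0)
     + (if l = j then cnj (u i) * a i j * of_real g else 0)" for i l
    by (auto simp: e_def algebra_simps diagonal_0)
  have "form n a (\<lambda>k. u k + e k) = form n a u
    + (\<Sum>i<n. \<Sum>l<n. if i = j then of_real g * a j l * u l else 0)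
    + (\<Sum>i<n. \<Sum>l<n. if l = j then cnj (u i) * a i j * of_real g else 0)"
    unfolding form_def eq by (simp add: sum.distrib)
  also have "(\<Sum>i<n. \<Sum>l<n. if i = j then of_real g * a j l * u l else 0) = of_real g * (\<Sum>l<n. a j l * u l)"
    using assms by (subst sum.swap) (simp add: sum_distrib_left mult.assoc)
  also have "(\<Sum>i<n. \<Sum>l<n. if l = j then cnj (u i) * a i j * of_real g else 0) = cnj (of_real g * (\<Sum>l<n. a j l * u l))"
    using assms by (simp add: cnj_entry sum_distrib_left mult.assoc mult.commute mult.left_commute)
  finally show ?thesis by (simp add: e_def)
qed

lemma sqnorm_add_unit:
  assumes "j < n"
  shows "sqnorm n (\<lambda>k. u k + (if k = j then of_real g else 0)) = sqnorm n u + 2 * g * Re (u j) + g\<^sup>2"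
proof -
  have "(cmod (u k + (if k = j then of_real g else 0)))\<^sup>2 = (cmod (u k))\<^sup>2 + (if k = j then 2 * g * Re (u j) + g\<^sup>2 else 0)" for k
    unfolding cmod_power2 by (auto simp: power2_eq_square algebra_simps)
  then show ?thesis using assms by (simp add: sqnorm_def sum.distrib)
qed

text \<open>The diagonal of \<open>(Z - A)\<^sup>-\<^sup>1\<close> is at most \<open>2/3\<close>: test \<open>-1 \<le> A \<le> 1\<close> on combinations of the
  \<open>j\<close>-th column of the inverse and the \<open>j\<close>-th unit vector.\<close>

lemma D_potential:
  assumes S: "S \<subseteq> {..<n}" and j: "j \<in> S" and y: "\<And>k. k \<in> S \<Longrightarrow> 2 \<le> y k"
  shows "Re (D (S - {j}) (\<lambda>k. of_real (y k))) \<le> 2 / 3 * Re (D S (\<lambda>k. of_real (y k)))"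
proof -
  define z where "z = (\<lambda>k. complex_of_real (y k))"
  have jn: "j < n" using S j by auto
  have y1: "1 < y k" if "k \<in> S" for k using y[OF that] by simp
  have Dp: "0 < D S z" unfolding z_def by (rule D_pos[OF S y1])
  then have "D S z \<noteq> 0" by auto
  then obtain u where u: "\<forall>k<n. apply_M S z u k = (if k = j then 1 else 0)"
    "u j * D S z = D (S - {j}) z" using exists_column[OF _ jn] by metis
  define N where "N = sqnorm n u"
  define R where "R = (\<Sum>k<n. y k * (cmod (u k))\<^sup>2)"
  define b where "b = R - Re (form n a u)"
  note energy = column_energy[of S y j u, OF S y1 j, folded z_def, OF _ u(1)[rule_format]]
  have u0: "\<And>k. k < n \<Longrightarrow> k \<notin> S \<Longrightarrow> u k = 0" and uj: "u j = of_real b" and b0: "b > 0"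
    using energy by (auto simp: b_def R_def)
  have RN: "R \<ge> 2 * N"
    unfolding R_def N_def sqnorm_def sum_distrib_left
  proof (rule sum_mono)
    fix k assume "k \<in> {..<n}"
    then show "2 * (cmod (u k))\<^sup>2 \<le> y k * (cmod (u k))\<^sup>2"
      using y[of k] u0[of k] by (cases "k \<in> S") (auto intro: mult_right_mono)
  qed
  have "apply_M S z u j = z j * u j - (\<Sum>l<n. a j l * u l)" by (rule apply_M_inside[OF jn j u0])
  then have "(\<Sum>l<n. a j l * u l) = z j * u j - 1" using u(1) jn by (simp add: algebra_simps)
  then have Au: "Re (\<Sum>l<n. a j l * u l) = y j * b - 1" by (simp add: z_def uj)
  have test: "\<bar>R - b + 2 * g * (y j * b - 1)\<bar> \<le> N + 2 * g * b + g\<^sup>2" for g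
    using contraction[of "\<lambda>k. u k + (if k = j then of_real g else 0)"]
    unfolding form_add_unit[OF jn] sqnorm_add_unit[OF jn] Au by (simp add: uj b_def N_def)
  define Y where "Y = y j"
  have Y: "Y \<ge> 2" using y[OF j] by (simp add: Y_def)
  have 1: "(1 - (Y - 1) * b)\<^sup>2 \<le> N + b - R"
  proof -
    \<comment> \<open>The minimiser of the quadratic polynomial in \<open>g\<close> by which the
      right-hand side exceeds the left; the other inequality is treated in the same way.\<close>
    define g where "g = - (1 - (Y - 1) * b)"
    have "R - b + 2 * g * (Y * b - 1) \<le> N + 2 * g * b + g\<^sup>2" using test[of g] by (simp add: Y_def)
    then have "0 \<le> N + b - R + 2 * g * (1 - (Y - 1) * b) + g\<^sup>2" by (simp add: algebra_simps)
    moreover have "2 * g * (1 - (Y - 1) * b) + g\<^sup>2 = - (1 - (Y - 1) * b)\<^sup>2"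
      by (simp add: g_def power2_eq_square algebra_simps)
    ultimately show ?thesis by linarith
  qed
  have 2: "((Y + 1) * b - 1)\<^sup>2 \<le> N + R - b"
  proof -
    define g where "g = - ((Y + 1) * b - 1)"
    have "- (R - b + 2 * g * (Y * b - 1)) \<le> N + 2 * g * b + g\<^sup>2" using test[of g] by (simp add: Y_def)
    then have "0 \<le> N + R - b + 2 * g * ((Y + 1) * b - 1) + g\<^sup>2" by (simp add: algebra_simps)
    moreover have "2 * g * ((Y + 1) * b - 1) + g\<^sup>2 = - ((Y + 1) * b - 1)\<^sup>2"
      by (simp add: g_def power2_eq_square algebra_simps)
    ultimately show ?thesis by linarith
  qed
  \<comment> \<open>Weights 3 and 1 leave \<open>4 * N - 2 * R\<close>, which is at most 0, so both
    unknown quantities disappear.\<close>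
  have 3: "3 * (1 - (Y - 1) * b)\<^sup>2 + ((Y + 1) * b - 1)\<^sup>2 \<le> 2 * b"
    using 1 2 RN by linarith
  have "b \<le> 2 / 3"
  proof (rule ccontr)
    assume "\<not> b \<le> 2 / 3"
    then have b: "b > 2 / 3" by simp
    define q where "q = (Y - 2) * b"
    have q: "q \<ge> 0" using Y b by (simp add: q_def)
    \<comment> \<open>For \<open>Y = 2\<close> the condition reads (3b - 2)(2b - 1) \<le> 0, whose
      larger root is 2/3. A larger \<open>Y\<close> only adds terms that are nonnegative when
      \<open>b > 2 / 3\<close>.\<close>
    have eq: "3 * (1 - (Y - 1) * b)\<^sup>2 + ((Y + 1) * b - 1)\<^sup>2 - 2 * b =
      2 * ((3 * b - 2) * (2 * b - 1) + 2 * q * (3 * b - 2) + 2 * q\<^sup>2)"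
      by (simp add: q_def power2_eq_square algebra_simps)
    have "0 < 2 * ((3 * b - 2) * (2 * b - 1) + 2 * q * (3 * b - 2) + 2 * q\<^sup>2)"
      using q b by (intro mult_pos_pos add_pos_nonneg mult_nonneg_nonneg) auto
    then show False using 3 unfolding eq[symmetric] by simp
  qed
  moreover have "Re (D (S - {j}) z) = b * Re (D S z)" by (simp flip: u(2) add: uj)
  ultimately show ?thesis using Dp by (simp add: z_def real_complex_pos_iff mult_right_mono)
qed

sublocale minor_family n D
proof
  show "D S (z(i := t)) = D S (z(i := 0)) + t * D (S - {i}) z" if "i < n" "i \<in> S" for i S z t
    using that by (rule D_affine)
  show "D S (z(i := t)) = D S z" if "i \<notin> S" for i S z t using that by (rule D_indep)
  show "D S z \<noteq> 0" if "\<And>k. 0 < Im (z k)" for S z using that by (rule D_stable)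
  show "D S (\<lambda>k. cnj (z k)) = cnj (D S z)" for S z by (rule D_cnj)
  show "\<exists>p. \<forall>e. poly p e = D S (\<lambda>k. z k + e * w k)" for S z w by (rule D_line)
  show "0 < D S (\<lambda>k. of_real (y k))" if "S \<subseteq> {..<n}" "\<And>k. k \<in> S \<Longrightarrow> 1 < y k" for S y
    using that by (rule D_pos)
  show "Re (D (S - {j}) (\<lambda>k. of_real (y k))) \<le> 2 / 3 * Re (D S (\<lambda>k. of_real (y k)))"
    if "S \<subseteq> {..<n}" "j \<in> S" "\<And>k. k \<in> S \<Longrightarrow> 2 \<le> y k" for S j y
    using that by (rule D_potential)
qed

text \<open>A replacement for eigenvalues. If the best upper bound \<open>x\<close> exceeded
  \<open>b\<close>, then \<open>x - A\<close> on \<open>S\<close> would be nonnegative and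
  invertible, hence bounded below, and \<open>x\<close> could be lowered.\<close>

lemma form_le_of_D_nonzero:
  assumes S: "S \<subseteq> {..<n}" and D: "\<And>x. x \<ge> b \<Longrightarrow> D S (\<lambda>_. of_real x) \<noteq> 0"
    and b: "0 \<le> b" "b \<le> 1" and v: "\<And>k. k \<notin> S \<Longrightarrow> v k = 0"
  shows "Re (form n a v) \<le> b * sqnorm n v"
proof -
  define X where "X = {x. b \<le> x \<and> (\<forall>v. (\<forall>k. k \<notin> S \<longrightarrow> v k = 0) \<longrightarrow> Re (form n a v) \<le> x * sqnorm n v)}"
  have sq0: "0 \<le> sqnorm n v" for v by (simp add: sqnorm_def sum_nonneg)
  have X1: "1 \<in> X" using contraction b by (auto simp: X_def abs_le_iff)
  have bdd: "bdd_below X" by (auto simp: X_def bdd_below_def)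
  define x where "x = Inf X"
  have x1: "x \<le> 1" unfolding x_def by (rule cInf_lower[OF X1 bdd])
  have xb: "b \<le> x" unfolding x_def by (rule cInf_greatest) (use X1 in blast, simp add: X_def)
  have xX: "Re (form n a v) \<le> x * sqnorm n v" if v: "\<And>k. k \<notin> S \<Longrightarrow> v k = 0" for v
  proof (cases "sqnorm n v = 0")
    case True
    then show ?thesis using contraction[of v] by simp
  next
    case False
    then have pos: "0 < sqnorm n v" using sq0[of v] by simp
    have "Re (form n a v) / sqnorm n v \<le> x"
      unfolding x_def by (rule cInf_greatest) (use X1 in blast, use v pos in \<open>simp add: X_def divide_le_eq\<close>)
    then show ?thesis using pos by (simp add: divide_le_eq)
  qed
  have "x = b"
  proof (rule ccontr)
    assume "x \<noteq> b"
    then have xb': "b < x" using xb by simp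
    obtain K where K: "K > 0" "\<And>u. sqnorm n u \<le> K * sqnorm n (apply_M S (\<lambda>_. of_real x) u)"
      using sqnorm_le_apply_M[OF D[OF xb]] by blast
    have gap: "Re (form n a v) \<le> (x - 1 / (2 * K)) * sqnorm n v" if v: "\<And>k. k \<notin> S \<Longrightarrow> v k = 0" for v
    proof -
      define w where "w = (\<lambda>k. if k < n then apply_M S (\<lambda>_. of_real x) v k else 0)"
      have w0: "w k = 0" if "k \<notin> S" for k using that v apply_M_outside by (auto simp: w_def)
      have sw: "sqnorm n w = sqnorm n (apply_M S (\<lambda>_. of_real x) v)" by (simp add: sqnorm_def w_def)
      have Av: "(\<Sum>l<n. a k l * v l) = of_real x * v k - w k" if "k \<in> S" for k
        using apply_M_inside[of k S v "\<lambda>_. of_real x"] that v S by (auto simp: w_def)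
      define h where "h = (\<Sum>k<n. Re (cnj (w k) * v k))"
      have fv: "Re (\<Sum>i<n. \<Sum>l<n. cnj (w i) * a i l * v l) = x * h - sqnorm n w"
      proof -
        have "(\<Sum>l<n. cnj (w i) * a i l * v l) = of_real x * (cnj (w i) * v i) - of_real ((cmod (w i))\<^sup>2)" for i
        proof (cases "i \<in> S")
          case True
          have "(\<Sum>l<n. cnj (w i) * a i l * v l) = cnj (w i) * (\<Sum>l<n. a i l * v l)"
            by (simp add: sum_distrib_left mult.assoc)
          then show ?thesis unfolding Av[OF True]
            by (simp add: complex_norm_square algebra_simps del: of_real_power)
        qed (simp add: w0)
        then show ?thesis by (simp add: h_def sqnorm_def sum_subtractf sum_distrib_left del: of_real_power)
      qed
      have cross: "Re (\<Sum>i<n. \<Sum>l<n. cnj (v i) * a i l * w l) = Re (\<Sum>i<n. \<Sum>l<n. cnj (w i) * a i l * v l)"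
      proof -
        have "(\<Sum>i<n. \<Sum>l<n. cnj (v i) * a i l * w l) = cnj (\<Sum>i<n. \<Sum>l<n. cnj (w i) * a i l * v l)"
          by (subst sum.swap) (simp add: cnj_entry mult.commute mult.left_commute)
        then show ?thesis by (simp only: cnj.simps)
      qed
      \<comment> \<open>\<open>w\<close> is \<open>(x - A) v\<close> on \<open>S\<close>. Since
        \<open>x - A\<close> lies between 0 and 2, testing it on \<open>v - c * w\<close> bounds the
        energy of \<open>v\<close> below by 2c - 2c^2 times the squared norm of \<open>w\<close>;
        the best choice is 1/2.\<close>
      define c :: complex where "c = 1 / 2"
      define d where "d = (\<lambda>k. v k - c * w k)"
      have eq: "cnj (d i) * a i l * d l = cnj (v i) * a i l * v l - c * (cnj (w i) * a i l * v l)
          - c * (cnj (v i) * a i l * w l) + c * c * (cnj (w i) * a i l * w l)" for i l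
      proof -
        have "cnj c = c" by (simp add: c_def)
        then show ?thesis by (simp add: d_def algebra_simps)
      qed
      have "form n a d = form n a v - c * (\<Sum>i<n. \<Sum>l<n. cnj (w i) * a i l * v l)
          - c * (\<Sum>i<n. \<Sum>l<n. cnj (v i) * a i l * w l) + c * c * form n a w"
        unfolding form_def eq by (simp add: sum.distrib sum_subtractf sum_distrib_left)
      then have fd: "Re (form n a d) = Re (form n a v) - (x * h - sqnorm n w) + 1 / 4 * Re (form n a w)"
        using cross fv by (simp add: c_def)
      have sd: "sqnorm n d = sqnorm n v - h + 1 / 4 * sqnorm n w"
      proof -
        have "(cmod (d k))\<^sup>2 = (cmod (v k))\<^sup>2 - Re (cnj (w k) * v k) + 1 / 4 * (cmod (w k))\<^sup>2" for k
          unfolding d_def c_def cmod_power2 by (simp add: power2_eq_square algebra_simps)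
        then show ?thesis by (simp add: sqnorm_def h_def sum.distrib sum_subtractf sum_distrib_left)
      qed
      have "Re (form n a d) \<le> x * sqnorm n d" by (rule xX) (simp add: d_def v w0)
      then have "Re (form n a v) + sqnorm n w + 1 / 4 * Re (form n a w) \<le> x * sqnorm n v + 1 / 4 * (x * sqnorm n w)"
        unfolding fd sd by (simp add: algebra_simps)
      moreover have "x * sqnorm n w \<le> 1 * sqnorm n w" by (rule mult_right_mono[OF x1 sq0])
      moreover have "- Re (form n a w) \<le> sqnorm n w" using contraction[of w] by simp
      ultimately have "Re (form n a v) \<le> x * sqnorm n v - sqnorm n w / 2" by linarith
      moreover have "sqnorm n v / (2 * K) \<le> sqnorm n w / 2"
        using K(2)[of v] K(1) by (simp add: sw divide_le_eq mult.commute)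
      ultimately show ?thesis by (simp add: left_diff_distrib)
    qed
    define x' where "x' = max b (x - 1 / (2 * K))"
    have "x' \<in> X"
      unfolding X_def
    proof (intro CollectI conjI allI impI)
      fix v :: "nat \<Rightarrow> complex" assume "\<forall>k. k \<notin> S \<longrightarrow> v k = 0"
      then have "Re (form n a v) \<le> (x - 1 / (2 * K)) * sqnorm n v" by (intro gap) auto
      also have "\<dots> \<le> x' * sqnorm n v" by (rule mult_right_mono) (auto simp: x'_def sq0)
      finally show "Re (form n a v) \<le> x' * sqnorm n v" .
    qed (simp add: x'_def)
    then have "x \<le> x'" unfolding x_def by (rule cInf_lower[OF _ bdd])
    then show False using xb' K(1) by (simp add: x'_def max_def split: if_splits)
  qed
  then show ?thesis using xX v by simp
qed

theorem finite_paving: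
  "\<exists>\<sigma>::nat \<Rightarrow> nat. (\<forall>i. \<sigma> i < 10) \<and>
    (\<forall>c<10. \<forall>v. (\<forall>k. \<not> (k < n \<and> \<sigma> k = c) \<longrightarrow> v k = 0) \<longrightarrow> Re (form n a v) \<le> 4 / 5 * sqnorm n v)"
proof -
  obtain \<sigma> :: "nat \<Rightarrow> nat" where \<sigma>: "\<forall>i. \<sigma> i < 10"
    "\<forall>c<10. \<forall>x\<ge>4/5. D {i. i < n \<and> \<sigma> i = c} (\<lambda>_. of_real x) \<noteq> 0"
    using exists_good_coloring by blast
  have "Re (form n a v) \<le> 4 / 5 * sqnorm n v"
    if "c < 10" "\<forall>k. \<not> (k < n \<and> \<sigma> k = c) \<longrightarrow> v k = 0" for c v
    by (rule form_le_of_D_nonzero[of "{i. i < n \<and> \<sigma> i = c}"]) (use \<sigma>(2) that in auto)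
  with \<sigma>(1) show ?thesis by blast
qed

end

section \<open>Operators on the sequence space\<close>

lemma coord_zero [simp]: "coord 0 n = 0"
  and coord_add [simp]: "coord (x + y) n = coord x n + coord y n"
  and coord_diff [simp]: "coord (x - y) n = coord x n - coord y n"
  and coord_scaleC [simp]: "coord (c *\<^sub>C x) n = c * coord x n"
  and coord_ket: "coord (ket j) n = (if n = j then 1 else 0)"
  by (simp_all add: zero_ell2.rep_eq plus_ell2.rep_eq minus_ell2.rep_eq scaleC_ell2.rep_eq ket.rep_eq)

lemma coord_sum [simp]: "coord (\<Sum>i\<in>I. f i) n = (\<Sum>i\<in>I. coord (f i) n)"
  by (induction I rule: infinite_finite_induct) simp_all

lemma ell2_eqI: "(\<And>n. coord x n = coord y n) \<Longrightarrow> x = y"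
  by (metis coord_inject ext)

lemma summable_coord: "summable (\<lambda>n. (cmod (coord x n))\<^sup>2)"
  using coord[of x] by simp

lemma coord_Abs_ell2: "summable (\<lambda>n. (cmod (f n))\<^sup>2) \<Longrightarrow> coord (Abs_ell2 f) n = f n"
  by (simp add: Abs_ell2_inverse)

lemma norm_ell2_sq: "(norm x)\<^sup>2 = (\<Sum>n. (cmod (coord x n))\<^sup>2)"
  by (simp add: norm_ell2_eq suminf_nonneg[OF summable_coord])

lemma summable_cinner: "summable (\<lambda>n. cnj (coord x n) * coord y n)"
proof (rule summable_norm_cancel)
  show "summable (\<lambda>n. cmod (cnj (coord x n) * coord y n))"
    using square_summable_mult[OF summable_coord[of x] summable_coord[of y]] by (simp add: norm_mult)
qed

lemma cinner_add_right: "cinner x (y + z) = cinner x y + cinner x z"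
  by (simp add: cinner.rep_eq distrib_left suminf_add summable_cinner)

lemma cinner_scaleC_right: "cinner x (c *\<^sub>C y) = c * cinner x y"
  unfolding cinner.rep_eq suminf_mult[OF summable_cinner, symmetric] by (simp add: mult.left_commute)

lemma cinner_commute: "cinner y x = cnj (cinner x y)"
  unfolding cinner.rep_eq
  by (subst bounded_linear.suminf[OF bounded_linear_cnj summable_cinner]) (simp add: mult.commute)

lemma cinner_add_left: "cinner (x + y) z = cinner x z + cinner y z"
  using cinner_add_right[of z x y] by (metis cinner_commute complex_cnj_add)

lemma cinner_scaleC_left: "cinner (c *\<^sub>C x) y = cnj c * cinner x y"
  using cinner_scaleC_right[of y c x] by (metis cinner_commute complex_cnj_mult)

lemma cinner_diff_right: "cinner x (y - z) = cinner x y - cinner x z"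
proof -
  have "y - z = y + (-1) *\<^sub>C z" by (rule ell2_eqI) simp
  then show ?thesis by (simp only: cinner_add_right cinner_scaleC_right) simp
qed

lemma cinner_diff_left: "cinner (x - y) z = cinner x z - cinner y z"
  using cinner_diff_right[of z x y] by (metis cinner_commute complex_cnj_diff)

lemma cinner_zero_left [simp]: "cinner 0 y = 0"
  by (simp add: cinner.rep_eq)

lemma cinner_sum_right: "cinner x (\<Sum>i\<in>I. f i) = (\<Sum>i\<in>I. cinner x (f i))"
  by (induction I rule: infinite_finite_induct) (simp_all add: cinner_add_right cinner.rep_eq[of _ 0])

lemma cinner_sum_left: "cinner (\<Sum>i\<in>I. f i) x = (\<Sum>i\<in>I. cinner (f i) x)"
  by (induction I rule: infinite_finite_induct) (simp_all add: cinner_add_left)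

lemma cinner_ket_left: "cinner (ket j) x = coord x j"
proof -
  have "(\<lambda>n. cnj (coord (ket j) n) * coord x n) = (\<lambda>n. if n = j then coord x n else 0)"
    by (auto simp: coord_ket)
  then show ?thesis unfolding cinner.rep_eq using sums_single[of j "coord x"] by (simp add: sums_iff)
qed

lemma Re_cinner: "Re (cinner x y) = inner x y"
  unfolding cinner.rep_eq inner_ell2.rep_eq
  by (subst Re_suminf[OF summable_cinner]) (simp add: inner_complex_def)

lemma norm_cinner_le: "cmod (cinner x y) \<le> norm x * norm y"
proof (cases "cinner x y = 0")
  case False
  define c where "c = cnj (cinner x y) / cmod (cinner x y)"
  have c: "cmod c = 1" using False by (simp add: c_def norm_divide)
  have "c * cinner x y = of_real (cmod (cinner x y))"
    using False by (simp add: c_def complex_norm_square[symmetric] power2_eq_square field_simps)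
  then have "cmod (cinner x y) = Re (cinner x (c *\<^sub>C y))" by (simp add: cinner_scaleC_right)
  also have "\<dots> \<le> norm x * norm (c *\<^sub>C y)" unfolding Re_cinner by (rule norm_cauchy_schwarz)
  finally show ?thesis by (simp add: norm_scaleC c)
qed simp

lemma tendsto_cinner:
  assumes f: "(f \<longlongrightarrow> x) F" and g: "(g \<longlongrightarrow> y) F"
  shows "((\<lambda>n. cinner (f n) (g n)) \<longlongrightarrow> cinner x y) F"
proof -
  have "bounded_bilinear cinner"
  proof
    show "\<exists>K. \<forall>a b. cmod (cinner a b) \<le> norm a * norm b * K"
      by (intro exI[of _ 1]) (simp add: norm_cinner_le)
  qed (simp_all add: cinner_add_left cinner_add_right scaleR_eq_scaleC cinner_scaleC_left cinner_scaleC_right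
      scaleR_conv_of_real)
  then show ?thesis using f g by (rule bounded_bilinear.tendsto)
qed

lemma tendsto_coord: "(f \<longlongrightarrow> x) F \<Longrightarrow> ((\<lambda>n. coord (f n) k) \<longlongrightarrow> coord x k) F"
  using tendsto_cinner[OF tendsto_const[of "ket k"]] by (simp add: cinner_ket_left)

lemma bop_add: "A \<cdot> (x + y) = A \<cdot> x + A \<cdot> y"
  by (simp add: bop_apply_def blinfun.add_right)

lemma bop_zero [simp]: "A \<cdot> 0 = 0" by (simp add: bop_apply_def)

lemma bop_scaleC: "A \<cdot> (c *\<^sub>C x) = c *\<^sub>C (A \<cdot> x)"
  using blinfun_of_bop[of A] by (simp add: bop_apply_def)

lemma bop_sum: "A \<cdot> (\<Sum>i\<in>I. f i) = (\<Sum>i\<in>I. A \<cdot> f i)"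
  by (induction I rule: infinite_finite_induct) (simp_all add: bop_add)

lemma norm_bop_apply: "norm (A \<cdot> x) \<le> norm A * norm x"
  by (simp add: bop_apply_def norm_bop.rep_eq norm_blinfun)

lemma plus_bop_apply: "(A + B) \<cdot> x = A \<cdot> x + B \<cdot> x"
  and minus_bop_apply: "(A - B) \<cdot> x = A \<cdot> x - B \<cdot> x"
  and uminus_bop_apply: "(- A) \<cdot> x = - (A \<cdot> x)"
  and times_bop_apply: "(A * B) \<cdot> x = A \<cdot> (B \<cdot> x)"
  and one_bop_apply: "1 \<cdot> x = x"
  and scaleC_bop_apply: "scaleC_bop c A \<cdot> x = c *\<^sub>C (A \<cdot> x)"
  by (simp_all add: bop_apply_def plus_bop.rep_eq minus_bop.rep_eq uminus_bop.rep_eq times_bop.rep_eq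
      one_bop.rep_eq scaleC_bop.rep_eq blinfun.add_left blinfun.diff_left blinfun.minus_left
      bounded_linear_Blinfun_apply[OF bounded_linear_scaleC])

lemmas bop_apply_simps = plus_bop_apply minus_bop_apply uminus_bop_apply times_bop_apply one_bop_apply
  scaleC_bop_apply

lemma bop_eqI: "(\<And>x. A \<cdot> x = B \<cdot> x) \<Longrightarrow> A = B"
  by (metis blinfun_of_bop_inject blinfun_eqI bop_apply_def)

lemma norm_bop_le: "0 \<le> K \<Longrightarrow> (\<And>x. norm (A \<cdot> x) \<le> K * norm x) \<Longrightarrow> norm A \<le> K"
  unfolding norm_bop.rep_eq bop_apply_def by (rule norm_blinfun_bound)

lemma exists_bop:
  assumes add: "\<And>x y. f (x + y) = f x + f y" and scale: "\<And>c x. f (c *\<^sub>C x) = c *\<^sub>C f x"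
    and bound: "\<And>x. norm (f x) \<le> K * norm x"
  shows "\<exists>A. \<forall>x. A \<cdot> x = f x"
proof -
  have "bounded_linear f"
    by (rule bounded_linear_intro[of _ K]) (simp_all add: add scaleR_eq_scaleC scale bound mult.commute)
  then have "blinfun_apply (Blinfun f) = f" by (rule bounded_linear_Blinfun_apply)
  then have "Abs_bop (Blinfun f) \<cdot> x = f x" for x
    by (simp add: bop_apply_def Abs_bop_inverse scale)
  then show ?thesis by blast
qed

lemma tendsto_bop: "(f \<longlongrightarrow> x) F \<Longrightarrow> ((\<lambda>n. A \<cdot> f n) \<longlongrightarrow> A \<cdot> x) F"
  unfolding bop_apply_def by (intro tendsto_intros)

text \<open>Choice makes this total without a boundedness premise; for an unbounded sequence no
  operator qualifies and the value is arbitrary.\<close>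

definition diag_op :: "(nat \<Rightarrow> complex) \<Rightarrow> bop" where
  "diag_op d = (SOME A. \<forall>x n. coord (A \<cdot> x) n = d n * coord x n)"

lemma diag_op_eqI: "(\<And>x n. coord (A \<cdot> x) n = d n * coord x n) \<Longrightarrow> diag_op d = A"
  unfolding diag_op_def by (rule some_equality) (auto intro!: bop_eqI ell2_eqI)

lemma square_summable_diag:
  assumes d: "\<And>n. cmod (d n) \<le> K"
  shows "summable (\<lambda>n. (cmod (d n * coord x n))\<^sup>2)"
    and "(\<Sum>n. (cmod (d n * coord x n))\<^sup>2) \<le> K\<^sup>2 * (norm x)\<^sup>2"
proof -
  have le: "(cmod (d n * coord x n))\<^sup>2 \<le> K\<^sup>2 * (cmod (coord x n))\<^sup>2" for n
    unfolding norm_mult power_mult_distrib by (intro mult_right_mono power_mono d) simp_all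
  have sm: "summable (\<lambda>n. K\<^sup>2 * (cmod (coord x n))\<^sup>2)" by (intro summable_mult summable_coord)
  show 1: "summable (\<lambda>n. (cmod (d n * coord x n))\<^sup>2)"
    by (rule summable_comparison_test'[OF sm, of 0]) (use le in simp)
  show "(\<Sum>n. (cmod (d n * coord x n))\<^sup>2) \<le> K\<^sup>2 * (norm x)\<^sup>2"
    unfolding norm_ell2_sq suminf_mult[OF summable_coord, symmetric] by (rule suminf_le[OF le 1 sm])
qed

lemma coord_diag_op:
  assumes d: "\<And>n. cmod (d n) \<le> K"
  shows "coord (diag_op d \<cdot> x) n = d n * coord x n"
proof -
  define f where "f = (\<lambda>x. Abs_ell2 (\<lambda>n. d n * coord x n))"
  have f: "coord (f x) n = d n * coord x n" for x n
    unfolding f_def by (rule coord_Abs_ell2[OF square_summable_diag(1)[OF d]])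
  have K: "K \<ge> 0" using d[of 0] norm_ge_zero order_trans by blast
  have "norm (f x) \<le> K * norm x" for x
  proof (rule power2_le_imp_le)
    show "(norm (f x))\<^sup>2 \<le> (K * norm x)\<^sup>2"
      unfolding norm_ell2_sq[of "f x"] f power_mult_distrib by (rule square_summable_diag(2)[OF d])
  qed (use K in simp)
  moreover have "f (x + y) = f x + f y" for x y by (rule ell2_eqI) (simp add: f distrib_left)
  moreover have "f (c *\<^sub>C x) = c *\<^sub>C f x" for c x by (rule ell2_eqI) (simp add: f)
  ultimately obtain A where "\<forall>x. A \<cdot> x = f x" using exists_bop[of f K] by blast
  then have "\<forall>x n. coord (A \<cdot> x) n = d n * coord x n" using f by simp
  then have "\<forall>x n. coord (diag_op d \<cdot> x) n = d n * coord x n"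
    unfolding diag_op_def by (rule someI)
  then show ?thesis by blast
qed

lemma norm_diag_op_le:
  assumes d: "\<And>n. cmod (d n) \<le> K"
  shows "norm (diag_op d) \<le> K"
proof -
  have K: "K \<ge> 0" using d[of 0] norm_ge_zero order_trans by blast
  show ?thesis
  proof (rule norm_bop_le[OF K], rule power2_le_imp_le)
    show "(norm (diag_op d \<cdot> x))\<^sup>2 \<le> (K * norm x)\<^sup>2" for x
      unfolding norm_ell2_sq[of "diag_op d \<cdot> x"] coord_diag_op[OF d] power_mult_distrib
      by (rule square_summable_diag(2)[OF d])
  qed (use K in simp)
qed

lemma diag_op_in_diagonal_ops:
  assumes "\<And>n. cmod (d n) \<le> K"
  shows "diag_op d \<in> diagonal_ops"
  by (auto simp: diagonal_ops_def cinner_ket_left coord_diag_op[OF assms] coord_ket)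

definition proj :: "nat set \<Rightarrow> bop" where
  "proj S = diag_op (\<lambda>n. if n \<in> S then 1 else 0)"

lemma coord_proj: "coord (proj S \<cdot> x) n = (if n \<in> S then coord x n else 0)"
  unfolding proj_def by (subst coord_diag_op[of _ 1]) auto

lemma proj_in_diagonal_ops: "proj S \<in> diagonal_ops"
  unfolding proj_def by (rule diag_op_in_diagonal_ops[of _ 1]) auto

lemma proj_eqI: "(\<And>x n. coord (A \<cdot> x) n = (if n \<in> S then coord x n else 0)) \<Longrightarrow> A = proj S"
  by (intro bop_eqI ell2_eqI) (simp add: coord_proj)

lemma proj_mult: "proj S * proj T = proj (S \<inter> T)"
  by (rule proj_eqI) (auto simp: times_bop_apply coord_proj)

lemma proj_UNIV: "proj UNIV = 1"
  by (rule proj_eqI[symmetric]) (simp add: one_bop_apply)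

lemma proj_Un: "S \<inter> T = {} \<Longrightarrow> proj (S \<union> T) = proj S + proj T"
  by (rule proj_eqI[symmetric]) (auto simp: plus_bop_apply coord_proj)

lemma cinner_proj_left: "cinner (proj S \<cdot> x) y = cinner x (proj S \<cdot> y)"
proof -
  have "(\<lambda>n. cnj (coord (proj S \<cdot> x) n) * coord y n) = (\<lambda>n. cnj (coord x n) * coord (proj S \<cdot> y) n)"
    by (auto simp: coord_proj)
  then show ?thesis by (simp add: cinner.rep_eq)
qed

lemma truncation_eq: "proj {..<N} \<cdot> x = (\<Sum>k<N. coord x k *\<^sub>C ket k)"
proof (rule ell2_eqI)
  fix n
  have "(\<Sum>k<N. coord x k * coord (ket k) n) = (\<Sum>k<N. if k = n then coord x n else 0)"
    by (intro sum.cong) (auto simp: coord_ket)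
  then show "coord (proj {..<N} \<cdot> x) n = coord (\<Sum>k<N. coord x k *\<^sub>C ket k) n"
    by (simp add: coord_proj)
qed

lemma truncation_tendsto: "(\<lambda>N. proj {..<N} \<cdot> x) \<longlonglongrightarrow> x"
proof -
  have "(norm (x - proj {..<N} \<cdot> x))\<^sup>2 = (norm x)\<^sup>2 - (\<Sum>n<N. (cmod (coord x n))\<^sup>2)" for N
  proof -
    have "(norm (x - proj {..<N} \<cdot> x))\<^sup>2 = (\<Sum>n. (cmod (coord x n))\<^sup>2 - (if n \<in> {..<N} then (cmod (coord x n))\<^sup>2 else 0))"
      unfolding norm_ell2_sq by (intro suminf_cong) (simp add: coord_proj)
    also have "\<dots> = (norm x)\<^sup>2 - (\<Sum>n. if n \<in> {..<N} then (cmod (coord x n))\<^sup>2 else 0)"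
      unfolding norm_ell2_sq by (intro suminf_diff[symmetric] summable_coord summable_If_finite_set) simp
    also have "(\<Sum>n. if n \<in> {..<N} then (cmod (coord x n))\<^sup>2 else 0) = (\<Sum>n<N. (cmod (coord x n))\<^sup>2)"
      using sums_If_finite_set[of "{..<N}" "\<lambda>n. (cmod (coord x n))\<^sup>2"] by (simp add: sums_iff)
    finally show ?thesis .
  qed
  moreover have "(\<lambda>N. (norm x)\<^sup>2 - (\<Sum>n<N. (cmod (coord x n))\<^sup>2)) \<longlonglongrightarrow> (norm x)\<^sup>2 - (norm x)\<^sup>2"
    using summable_LIMSEQ[OF summable_coord[of x]] by (intro tendsto_intros) (simp add: norm_ell2_sq)
  ultimately have "(\<lambda>N. (norm (x - proj {..<N} \<cdot> x))\<^sup>2) \<longlonglongrightarrow> 0" by simp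
  then have "(\<lambda>N. sqrt ((norm (x - proj {..<N} \<cdot> x))\<^sup>2)) \<longlonglongrightarrow> sqrt 0" by (rule tendsto_real_sqrt)
  then have "(\<lambda>N. norm (proj {..<N} \<cdot> x - x)) \<longlonglongrightarrow> 0" by (simp add: norm_minus_commute)
  then show ?thesis by (simp add: tendsto_norm_zero_iff LIM_zero_iff)
qed

definition diag_entry :: "bop \<Rightarrow> nat \<Rightarrow> complex" where
  "diag_entry A n = cinner (ket n) (A \<cdot> ket n)"

lemma norm_diag_entry_le: "cmod (diag_entry A n) \<le> norm A"
  using norm_cinner_le[of "ket n" "A \<cdot> ket n"] norm_bop_apply[of A "ket n"]
  by (simp add: diag_entry_def norm_ket)

text \<open>The conditional expectation onto the diagonal algebra; composing \<open>s\<close> with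
  it gives the extension.\<close>

definition diag_part :: "bop \<Rightarrow> bop" where "diag_part A = diag_op (diag_entry A)"

lemma coord_diag_part: "coord (diag_part A \<cdot> x) n = diag_entry A n * coord x n"
  unfolding diag_part_def by (rule coord_diag_op[OF norm_diag_entry_le])

lemma diag_part_in_diagonal_ops: "diag_part A \<in> diagonal_ops"
  unfolding diag_part_def by (rule diag_op_in_diagonal_ops[OF norm_diag_entry_le])

lemma norm_diag_part_le: "norm (diag_part A) \<le> norm A"
  unfolding diag_part_def by (rule norm_diag_op_le[OF norm_diag_entry_le])

lemma diag_part_eqI:
  assumes "\<And>x n. coord (B \<cdot> x) n = diag_entry A n * coord x n"
  shows "diag_part A = B"
  unfolding diag_part_def by (rule diag_op_eqI[OF assms])

lemma diag_part_add: "diag_part (A + B) = diag_part A + diag_part B"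
  by (rule diag_part_eqI)
     (simp add: plus_bop_apply coord_diag_part diag_entry_def cinner_add_right distrib_right)

lemma diag_part_scaleC: "diag_part (scaleC_bop c A) = scaleC_bop c (diag_part A)"
  by (rule diag_part_eqI) (simp add: scaleC_bop_apply coord_diag_part diag_entry_def cinner_scaleC_right)

text \<open>Membership in \<open>diagonal_ops\<close> speaks about matrix entries only, so the
  action on an arbitrary vector is recovered from its finite truncations by continuity.\<close>

lemma diag_part_diagonal:
  assumes A: "A \<in> diagonal_ops"
  shows "diag_part A = A"
proof (rule diag_part_eqI)
  fix x n
  have "coord (A \<cdot> (proj {..<N} \<cdot> x)) n = (if n < N then diag_entry A n * coord x n else 0)" for N
  proof -
    have "coord (A \<cdot> (proj {..<N} \<cdot> x)) n = (\<Sum>k<N. coord x k * cinner (ket n) (A \<cdot> ket k))"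
      unfolding truncation_eq by (simp add: bop_sum bop_scaleC cinner_ket_left)
    also have "\<dots> = (\<Sum>k<N. if k = n then diag_entry A n * coord x n else 0)"
      using A by (intro sum.cong) (auto simp: diagonal_ops_def diag_entry_def)
    finally show ?thesis by simp
  qed
  then have "(\<lambda>N. coord (A \<cdot> (proj {..<N} \<cdot> x)) n) \<longlonglongrightarrow> diag_entry A n * coord x n"
    by (auto intro!: tendsto_eventually eventually_sequentiallyI[of "Suc n"])
  moreover have "(\<lambda>N. coord (A \<cdot> (proj {..<N} \<cdot> x)) n) \<longlonglongrightarrow> coord (A \<cdot> x) n"
    by (intro tendsto_coord tendsto_bop truncation_tendsto)
  ultimately show "coord (A \<cdot> x) n = diag_entry A n * coord x n"
    using LIMSEQ_unique by blast
qed

lemma one_in_diagonal_ops: "1 \<in> diagonal_ops"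
  using proj_in_diagonal_ops[of UNIV] by (simp add: proj_UNIV)

lemma positive_diag_op:
  assumes "\<And>n. 0 \<le> d n" "\<And>n. cmod (d n) \<le> K"
  shows "positive_op (diag_op d)"
  unfolding positive_op_def
proof
  fix x
  have s: "summable (\<lambda>n. cnj (coord x n) * (d n * coord x n))"
    using summable_cinner[of x "diag_op d \<cdot> x"] by (simp add: coord_diag_op[OF assms(2)])
  have t: "cnj (coord x n) * (d n * coord x n) = of_real (Re (d n) * (cmod (coord x n))\<^sup>2)" for n
  proof -
    have "d n = of_real (Re (d n))" using assms(1)[of n] by (simp add: less_eq_complex_def complex_eq_iff)
    then have "cnj (coord x n) * (d n * coord x n) = of_real (Re (d n)) * (coord x n * cnj (coord x n))"
      by (metis mult.assoc mult.commute)
    then show ?thesis by (simp flip: complex_norm_square)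
  qed
  have sr: "summable (\<lambda>n. Re (d n) * (cmod (coord x n))\<^sup>2)"
    using s unfolding t by (simp only: summable_complex_of_real)
  have "cinner x (diag_op d \<cdot> x) = (\<Sum>n. of_real (Re (d n) * (cmod (coord x n))\<^sup>2))"
    by (simp only: cinner.rep_eq coord_diag_op[OF assms(2)] t)
  also have "\<dots> = of_real (\<Sum>n. Re (d n) * (cmod (coord x n))\<^sup>2)"
    using suminf_of_real[OF sr, where 'a = complex] by metis
  finally show "0 \<le> cinner x (diag_op d \<cdot> x)"
    using assms(1) suminf_nonneg[OF sr] by (simp add: less_eq_complex_def)
qed

lemma diag_entry_nonneg: "positive_op A \<Longrightarrow> 0 \<le> diag_entry A n"
  by (simp add: positive_op_def diag_entry_def)

lemma positive_diag_part: "positive_op A \<Longrightarrow> positive_op (diag_part A)"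
  unfolding diag_part_def by (rule positive_diag_op[OF diag_entry_nonneg norm_diag_entry_le])

text \<open>The adjoint is built from its coordinates \<open>cinner (A \<cdot> ket n) y\<close>.
  Pairing \<open>y\<close> with the image under A of their own partial sum shows that they are
  square-summable with the right bound.\<close>

lemma exists_adjoint: "\<exists>B. \<forall>x y. cinner (A \<cdot> x) y = cinner x (B \<cdot> y)"
proof -
  define f where "f = (\<lambda>y n. cinner (A \<cdot> ket n) y)"
  have partial_sum: "(\<Sum>n<N. (cmod (f y n))\<^sup>2) \<le> (norm A * norm y)\<^sup>2" for y N
  proof -
    define z where "z = (\<Sum>n<N. f y n *\<^sub>C ket n)"
    define s where "s = (\<Sum>n<N. (cmod (f y n))\<^sup>2)"
    have s0: "s \<ge> 0" by (simp add: s_def sum_nonneg)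
    have cz: "coord z n = (if n < N then f y n else 0)" for n
    proof -
      have "coord z n = (\<Sum>k<N. if k = n then f y n else 0)"
        unfolding z_def coord_sum by (intro sum.cong) (auto simp: coord_ket)
      then show ?thesis by simp
    qed
    have nz: "(norm z)\<^sup>2 = s"
    proof -
      have "(\<lambda>n. (cmod (coord z n))\<^sup>2) = (\<lambda>n. if n \<in> {..<N} then (cmod (f y n))\<^sup>2 else 0)"
        by (auto simp: cz)
      then show ?thesis
        unfolding norm_ell2_sq s_def using sums_If_finite_set[of "{..<N}" "\<lambda>n. (cmod (f y n))\<^sup>2"]
        by (simp add: sums_iff)
    qed
    have "cinner (A \<cdot> z) y = (\<Sum>n<N. cnj (f y n) * f y n)"
      by (simp add: z_def bop_sum bop_scaleC cinner_sum_left cinner_scaleC_left f_def)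
    also have "\<dots> = of_real s"
      by (simp add: s_def complex_norm_square mult.commute del: of_real_power)
    finally have "s = cmod (cinner (A \<cdot> z) y)" using s0 by simp
    also have "\<dots> \<le> norm (A \<cdot> z) * norm y" by (rule norm_cinner_le)
    also have "\<dots> \<le> (norm A * norm z) * norm y" by (intro mult_right_mono norm_bop_apply) simp
    finally have le: "norm z * norm z \<le> norm z * (norm A * norm y)"
      using nz by (simp add: power2_eq_square mult.assoc mult.left_commute)
    have "norm z \<le> norm A * norm y"
    proof (cases "z = 0")
      case False
      then show ?thesis by (intro mult_left_le_imp_le[OF le]) simp
    qed simp
    then show ?thesis unfolding s_def[symmetric] nz[symmetric] by (rule power_mono) simp
  qed
  have sm: "summable (\<lambda>n. (cmod (f y n))\<^sup>2)" for y
    by (rule bounded_imp_summable[of _ "(norm A * norm y)\<^sup>2"])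
       (use partial_sum[where N = "Suc _"] in \<open>auto simp: lessThan_Suc_atMost\<close>)
  define g where "g = (\<lambda>y. Abs_ell2 (f y))"
  have g: "coord (g y) n = f y n" for y n unfolding g_def by (rule coord_Abs_ell2[OF sm])
  have "norm (g y) \<le> norm A * norm y" for y
  proof (rule power2_le_imp_le)
    show "(norm (g y))\<^sup>2 \<le> (norm A * norm y)\<^sup>2"
      unfolding norm_ell2_sq g by (intro suminf_le_const sm partial_sum)
  qed simp
  moreover have "g (x + y) = g x + g y" for x y by (rule ell2_eqI) (simp add: g f_def cinner_add_right)
  moreover have "g (c *\<^sub>C x) = c *\<^sub>C g x" for c x by (rule ell2_eqI) (simp add: g f_def cinner_scaleC_right)
  ultimately obtain B where B: "\<forall>y. B \<cdot> y = g y" using exists_bop[of g "norm A"] by blast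
  have "cinner (A \<cdot> x) y = cinner x (B \<cdot> y)" for x y
  proof -
    have "cinner (A \<cdot> (proj {..<N} \<cdot> x)) y = cinner (proj {..<N} \<cdot> x) (B \<cdot> y)" for N
      unfolding truncation_eq
      by (simp add: bop_sum bop_scaleC cinner_sum_left cinner_scaleC_left cinner_ket_left B g f_def)
    moreover have "(\<lambda>N. cinner (A \<cdot> (proj {..<N} \<cdot> x)) y) \<longlonglongrightarrow> cinner (A \<cdot> x) y"
      by (intro tendsto_cinner tendsto_bop truncation_tendsto tendsto_const)
    moreover have "(\<lambda>N. cinner (proj {..<N} \<cdot> x) (B \<cdot> y)) \<longlonglongrightarrow> cinner x (B \<cdot> y)"
      by (intro tendsto_cinner truncation_tendsto tendsto_const)
    ultimately show ?thesis using LIMSEQ_unique by simp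
  qed
  then show ?thesis by blast
qed

section \<open>Selfadjoint operators and their finite matrices\<close>

definition selfadjoint :: "bop \<Rightarrow> bool" where
  "selfadjoint A \<longleftrightarrow> (\<forall>x y. cinner (A \<cdot> x) y = cinner x (A \<cdot> y))"

lemma Im_cinner_selfadjoint: "selfadjoint A \<Longrightarrow> Im (cinner x (A \<cdot> x)) = 0"
  using cinner_commute[of "A \<cdot> x" x] unfolding selfadjoint_def
  by (metis Im_complex_of_real Reals_cnj_iff complex_is_Real_iff)

lemma scaleC_bop_of_real: "scaleC_bop (of_real r) A = r *\<^sub>R A"
  by (rule bop_eqI)
     (simp add: bop_apply_def scaleC_bop.rep_eq scaleR_bop.rep_eq blinfun.scaleR_left scaleR_eq_scaleC
       bounded_linear_Blinfun_apply[OF bounded_linear_scaleC])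

lemma scaleR_bop_apply: "(r *\<^sub>R A) \<cdot> x = of_real r *\<^sub>C (A \<cdot> x)"
  by (simp flip: scaleC_bop_of_real add: scaleC_bop_apply)

lemma selfadjoint_add: "selfadjoint A \<Longrightarrow> selfadjoint B \<Longrightarrow> selfadjoint (A + B)"
  and selfadjoint_scaleR: "selfadjoint A \<Longrightarrow> selfadjoint (r *\<^sub>R A)"
  and selfadjoint_uminus: "selfadjoint A \<Longrightarrow> selfadjoint (- A)"
  and selfadjoint_compress: "selfadjoint A \<Longrightarrow> selfadjoint B \<Longrightarrow> selfadjoint (B * A * B)"
  and selfadjoint_proj: "selfadjoint (proj S)"
proof -
  show "selfadjoint (r *\<^sub>R A)" if "selfadjoint A" for r A
    using that by (simp add: selfadjoint_def scaleR_bop_apply cinner_scaleC_left cinner_scaleC_right)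
  from this[of A "-1"] show "selfadjoint A \<Longrightarrow> selfadjoint (- A)" by simp
qed (simp_all add: selfadjoint_def bop_apply_simps cinner_add_left cinner_add_right cinner_proj_left)

text \<open>The Cartesian decomposition. The diagonal of the adjoint is the conjugate of that of A,
  so a zero diagonal is inherited by both parts.\<close>

lemma selfadjoint_decomposition:
  "\<exists>H K. selfadjoint H \<and> selfadjoint K \<and> A = H + scaleC_bop \<i> K \<and>
    (diag_part A = 0 \<longrightarrow> diag_part H = 0 \<and> diag_part K = 0)"
proof -
  obtain B where B: "\<And>x y. cinner (A \<cdot> x) y = cinner x (B \<cdot> y)" using exists_adjoint by blast
  have B': "cinner (B \<cdot> x) y = cinner x (A \<cdot> y)" for x y
    using B[of y x] cinner_commute[of "B \<cdot> x" y] cinner_commute[of x "A \<cdot> y"] by simp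
  define H where "H = scaleC_bop (1/2) (A + B)"
  define K where "K = scaleC_bop (- \<i>/2) (A - B)"
  have sa: "selfadjoint H" "selfadjoint K"
    unfolding selfadjoint_def H_def K_def
    by (auto simp: bop_apply_simps cinner_scaleC_left cinner_scaleC_right cinner_add_left cinner_add_right
        cinner_diff_left cinner_diff_right B B' algebra_simps)
  have "A = H + scaleC_bop \<i> K"
    by (intro bop_eqI ell2_eqI) (simp add: H_def K_def bop_apply_simps algebra_simps)
  moreover have "diag_part H = 0 \<and> diag_part K = 0" if A: "diag_part A = 0"
  proof -
    have "diag_entry A n = 0" for n
      using coord_diag_part[of A "ket n" n] A by (simp add: bop_apply_def zero_bop.rep_eq coord_ket)
    then have "diag_entry A n = 0 \<and> diag_entry B n = 0" for n
      using cinner_commute[of "ket n" "A \<cdot> ket n"] by (simp add: diag_entry_def B)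
    then have "diag_entry H n = 0 \<and> diag_entry K n = 0" for n
      by (simp add: diag_entry_def H_def K_def bop_apply_simps cinner_scaleC_right cinner_add_right cinner_diff_right)
    then show ?thesis
      by (auto intro!: diag_part_eqI simp: bop_apply_def zero_bop.rep_eq)
  qed
  ultimately show ?thesis using sa by blast
qed

text \<open>Stated for the quadratic form because paving bounds the form and positivity of a state
  tests only the form.\<close>

definition contraction_form :: "bop \<Rightarrow> bool" where
  "contraction_form A \<longleftrightarrow> (\<forall>x. \<bar>Re (cinner x (A \<cdot> x))\<bar> \<le> (norm x)\<^sup>2)"

lemma diag_part_0_iff: "diag_part A = 0 \<longleftrightarrow> (\<forall>n. diag_entry A n = 0)"
proof
  assume A: "diag_part A = 0"
  show "\<forall>n. diag_entry A n = 0"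
  proof
    fix n
    show "diag_entry A n = 0"
      using coord_diag_part[of A "ket n" n] A by (simp add: bop_apply_def zero_bop.rep_eq coord_ket)
  qed
qed (auto intro!: diag_part_eqI simp: bop_apply_def zero_bop.rep_eq)

definition matrix_of :: "bop \<Rightarrow> nat \<Rightarrow> nat \<Rightarrow> complex" where
  "matrix_of A i j = cinner (ket i) (A \<cdot> ket j)"

lemma form_matrix_of:
  "form n (matrix_of A) v = cinner (\<Sum>k<n. v k *\<^sub>C ket k) (A \<cdot> (\<Sum>k<n. v k *\<^sub>C ket k))"
  by (simp add: form_def matrix_of_def cinner_sum_left bop_sum bop_scaleC cinner_sum_right
      cinner_scaleC_left cinner_scaleC_right sum_distrib_left mult_ac) (rule sum.swap)

lemma sqnorm_ket_sum: "sqnorm n v = (norm (\<Sum>k<n. v k *\<^sub>C ket k))\<^sup>2"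
proof -
  have "(\<lambda>m. (cmod (coord (\<Sum>k<n. v k *\<^sub>C ket k) m))\<^sup>2) = (\<lambda>m. if m \<in> {..<n} then (cmod (v m))\<^sup>2 else 0)"
  proof
    fix m
    have "(\<Sum>k<n. v k * coord (ket k) m) = (\<Sum>k<n. if k = m then v m else 0)"
      by (intro sum.cong) (auto simp: coord_ket)
    then show "(cmod (coord (\<Sum>k<n. v k *\<^sub>C ket k) m))\<^sup>2 = (if m \<in> {..<n} then (cmod (v m))\<^sup>2 else 0)"
      by simp
  qed
  then show ?thesis
    unfolding norm_ell2_sq sqnorm_def using sums_If_finite_set[of "{..<n}" "\<lambda>m. (cmod (v m))\<^sup>2"]
    by (simp add: sums_iff)
qed

lemma hermitian_contraction_matrix_of:
  assumes "selfadjoint A" "diag_part A = 0" "contraction_form A"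
  shows "hermitian_contraction n (matrix_of A)"
proof
  show "matrix_of A j i = cnj (matrix_of A i j)" for i j
    using assms(1) cinner_commute[of "A \<cdot> ket j" "ket i"] by (simp add: matrix_of_def selfadjoint_def)
  show "matrix_of A i i = 0" for i
    using assms(2) by (simp add: diag_part_0_iff diag_entry_def matrix_of_def)
  show "\<bar>Re (form n (matrix_of A) v)\<bar> \<le> sqnorm n v" for v
    using assms(3) unfolding form_matrix_of sqnorm_ket_sum contraction_form_def by blast
qed

text \<open>Koenig's lemma: a prefix that extends to good colourings of all lengths has an extension by one
  more colour with the same property.\<close>

lemma coloring_compactness:
  fixes good :: "nat \<Rightarrow> (nat \<Rightarrow> nat) \<Rightarrow> bool" and r :: nat
  assumes ex: "\<And>n. \<exists>\<sigma>. (\<forall>i. \<sigma> i < r) \<and> good n \<sigma>"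
    and mono: "\<And>n \<sigma>. good (Suc n) \<sigma> \<Longrightarrow> good n \<sigma>"
    and loc: "\<And>n \<sigma> \<tau>. (\<And>i. i < n \<Longrightarrow> \<sigma> i = \<tau> i) \<Longrightarrow> good n \<sigma> \<Longrightarrow> good n \<tau>"
  shows "\<exists>\<sigma>. (\<forall>i. \<sigma> i < r) \<and> (\<forall>n. good n \<sigma>)"
proof -
  have mono': "m \<le> n \<Longrightarrow> good n \<sigma> \<Longrightarrow> good m \<sigma>" for m n \<sigma>
    by (induction n) (auto simp: le_Suc_eq dest: mono)
  define P where "P = (\<lambda>k \<tau>. \<forall>n. \<exists>\<sigma>. (\<forall>i. \<sigma> i < r) \<and> good n \<sigma> \<and> (\<forall>i<k. \<sigma> i = (\<tau> i::nat)))"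
  have "\<exists>f. \<forall>k. P k (f k) \<and> (\<forall>i<k. f (Suc k) i = f k i)"
  proof (rule dependent_nat_choice)
    show "\<exists>\<tau>. P 0 \<tau>" using ex by (auto simp: P_def)
    fix \<tau> k assume P: "P k \<tau>"
    have "\<exists>c<r. P (Suc k) (\<tau>(k := c))"
    proof (rule ccontr)
      assume "\<not> ?thesis"
      then have "\<forall>c\<in>{..<r}. \<not> P (Suc k) (\<tau>(k := c))" by auto
      then have "\<forall>c\<in>{..<r}. \<exists>n. \<not> (\<exists>\<sigma>. (\<forall>i. \<sigma> i < r) \<and> good n \<sigma> \<and> (\<forall>i<Suc k. \<sigma> i = (\<tau>(k := c)) i))"
        unfolding P_def by simp
      from bchoice[OF this] obtain N where
        N: "\<forall>c\<in>{..<r}. \<not> (\<exists>\<sigma>. (\<forall>i. \<sigma> i < r) \<and> good (N c) \<sigma> \<and> (\<forall>i<Suc k. \<sigma> i = (\<tau>(k := c)) i))"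
        by blast
      \<comment> \<open>If each colour at position \<open>k\<close> failed at some length, a
        colouring good for the largest of these lengths would contradict the failure of its own
        colour.\<close>
      obtain \<sigma> where \<sigma>: "\<forall>i. \<sigma> i < r" "good (Max (N ` {..<r})) \<sigma>" "\<forall>i<k. \<sigma> i = \<tau> i"
        using P unfolding P_def by blast
      have "N (\<sigma> k) \<le> Max (N ` {..<r})" using \<sigma>(1) by (intro Max_ge) auto
      then have "good (N (\<sigma> k)) \<sigma>" using \<sigma>(2) mono' by blast
      moreover have "\<forall>i<Suc k. \<sigma> i = (\<tau>(k := \<sigma> k)) i" using \<sigma>(3) by (auto simp: less_Suc_eq)
      ultimately show False using bspec[OF N, of "\<sigma> k"] \<sigma>(1) by blast
    qed
    then obtain c where c: "P (Suc k) (\<tau>(k := c))" by blast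
    then show "\<exists>\<tau>'. P (Suc k) \<tau>' \<and> (\<forall>i<k. \<tau>' i = \<tau> i)"
      by (intro exI[of _ "\<tau>(k := c)"]) auto
  qed
  then obtain f where f: "\<And>k. P k (f k)" "\<And>k i. i < k \<Longrightarrow> f (Suc k) i = f k i" by blast
  define \<sigma> where "\<sigma> = (\<lambda>i. f (Suc i) i)"
  have agree: "f k i = \<sigma> i" if "i < k" for i k
    using that
  proof (induction k)
    case (Suc k)
    then show ?case using f(2)[of i k] by (cases "i = k") (auto simp: \<sigma>_def)
  qed simp
  have "good n \<sigma>" for n
  proof -
    obtain \<tau> where \<tau>: "good n \<tau>" "\<forall>i<n. \<tau> i = f n i" using f(1)[of n] unfolding P_def by blast
    show ?thesis by (rule loc[OF _ \<tau>(1)]) (use \<tau>(2) agree in auto)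
  qed
  moreover have "\<sigma> i < r" for i
  proof -
    obtain \<tau> where "\<forall>i. \<tau> i < r" "\<forall>j<Suc i. \<tau> j = f (Suc i) j" using f(1)[of "Suc i"] unfolding P_def by blast
    then show ?thesis by (metis \<sigma>_def lessI)
  qed
  ultimately show ?thesis by blast
qed

text \<open>A colouring good for all finite sections bounds the form on truncations of a vector
  supported in one class, and both sides are continuous.\<close>

lemma infinite_paving:
  assumes A: "selfadjoint A" "diag_part A = 0" "contraction_form A"
  shows "\<exists>\<sigma>::nat \<Rightarrow> nat. (\<forall>i. \<sigma> i < 10) \<and>
    (\<forall>c x. Re (cinner (proj {i. \<sigma> i = c} \<cdot> x) (A \<cdot> (proj {i. \<sigma> i = c} \<cdot> x)))
      \<le> 4 / 5 * (norm (proj {i. \<sigma> i = c} \<cdot> x))\<^sup>2)"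
proof -
  define a where "a = matrix_of A"
  define good where "good = (\<lambda>n (\<sigma> :: nat \<Rightarrow> nat). \<forall>c<10. \<forall>v. (\<forall>k. \<not> (k < n \<and> \<sigma> k = c) \<longrightarrow> v k = 0) \<longrightarrow>
    Re (form n a v) \<le> 4 / 5 * sqnorm n v)"
  have "\<exists>\<sigma>::nat \<Rightarrow> nat. (\<forall>i. \<sigma> i < 10) \<and> (\<forall>n. good n \<sigma>)"
  proof (rule coloring_compactness)
    show "\<exists>\<sigma>::nat \<Rightarrow> nat. (\<forall>i. \<sigma> i < 10) \<and> good n \<sigma>" for n
    proof -
      interpret hermitian_contraction n a
        unfolding a_def by (rule hermitian_contraction_matrix_of[OF A])
      show ?thesis using finite_paving unfolding good_def .
    qed
    show "good n \<sigma>" if g: "good (Suc n) \<sigma>" for n and \<sigma> :: "nat \<Rightarrow> nat"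
      unfolding good_def
    proof (intro allI impI)
      fix c :: nat and v :: "nat \<Rightarrow> complex"
      assume c: "c < 10" and v: "\<forall>k. \<not> (k < n \<and> \<sigma> k = c) \<longrightarrow> v k = 0"
      have "\<forall>k. \<not> (k < Suc n \<and> \<sigma> k = c) \<longrightarrow> v k = 0" using v by auto
      then have "Re (form (Suc n) a v) \<le> 4 / 5 * sqnorm (Suc n) v"
        using g c unfolding good_def by blast
      moreover have "v n = 0" using v by simp
      ultimately show "Re (form n a v) \<le> 4 / 5 * sqnorm n v" by (simp add: form_def sqnorm_def)
    qed
    show "good n \<tau>" if "\<And>i. i < n \<Longrightarrow> \<sigma> i = \<tau> i" "good n \<sigma>" for n and \<sigma> \<tau> :: "nat \<Rightarrow> nat"
      using that unfolding good_def by metis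
  qed
  then obtain \<sigma> :: "nat \<Rightarrow> nat" where \<sigma>: "\<And>i. \<sigma> i < 10" "\<And>n. good n \<sigma>" by blast
  have "Re (cinner (proj {i. \<sigma> i = c} \<cdot> x) (A \<cdot> (proj {i. \<sigma> i = c} \<cdot> x)))
      \<le> 4 / 5 * (norm (proj {i. \<sigma> i = c} \<cdot> x))\<^sup>2" for c x
  proof (cases "c < 10")
    case True
    define y where "y = proj {i. \<sigma> i = c} \<cdot> x"
    have y: "coord y k = 0" if "\<sigma> k \<noteq> c" for k using that by (simp add: y_def coord_proj)
    have "Re (cinner (proj {..<n} \<cdot> y) (A \<cdot> (proj {..<n} \<cdot> y))) \<le> 4 / 5 * (norm (proj {..<n} \<cdot> y))\<^sup>2" for n
    proof -
      define v where "v = (\<lambda>k. if k < n then coord y k else 0)"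
      have "proj {..<n} \<cdot> y = (\<Sum>k<n. v k *\<^sub>C ket k)"
        unfolding truncation_eq by (intro sum.cong) (auto simp: v_def)
      moreover have "Re (form n a v) \<le> 4 / 5 * sqnorm n v"
        using \<sigma>(2)[of n] True y unfolding good_def v_def by auto
      ultimately show ?thesis by (simp add: a_def form_matrix_of sqnorm_ket_sum)
    qed
    moreover have "(\<lambda>n. Re (cinner (proj {..<n} \<cdot> y) (A \<cdot> (proj {..<n} \<cdot> y)))) \<longlonglongrightarrow> Re (cinner y (A \<cdot> y))"
      by (intro tendsto_intros tendsto_cinner tendsto_bop truncation_tendsto)
    moreover have "(\<lambda>n. 4 / 5 * (norm (proj {..<n} \<cdot> y))\<^sup>2) \<longlonglongrightarrow> 4 / 5 * (norm y)\<^sup>2"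
      by (intro tendsto_intros truncation_tendsto)
    ultimately show ?thesis unfolding y_def[symmetric] by (intro LIMSEQ_le) auto
  next
    case False
    then have "proj {i. \<sigma> i = c} = proj {}" using \<sigma>(1) by (metis (mono_tags, lifting) Collect_empty_eq)
    moreover have "proj {} \<cdot> x = 0" by (rule ell2_eqI) (simp add: coord_proj)
    ultimately show ?thesis by simp
  qed
  with \<sigma>(1) show ?thesis by blast
qed

section \<open>States\<close>

lemma stateD:
  assumes "state \<A> s"
  shows state_add: "A \<in> \<A> \<Longrightarrow> B \<in> \<A> \<Longrightarrow> s (A + B) = s A + s B"
    and state_scaleC: "A \<in> \<A> \<Longrightarrow> s (scaleC_bop c A) = c * s A"
    and state_bounded: "\<exists>K. \<forall>A\<in>\<A>. cmod (s A) \<le> K * norm A"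
    and state_pos: "A \<in> \<A> \<Longrightarrow> positive_op A \<Longrightarrow> 0 \<le> s A"
    and state_one: "s 1 = 1"
  using assms unfolding state_def by blast+

lemma positive_proj: "positive_op (proj S)"
  unfolding proj_def by (rule positive_diag_op[of _ 1]) (auto simp: less_eq_complex_def)

lemma diag_part_one: "diag_part 1 = 1"
  by (rule diag_part_diagonal[OF one_in_diagonal_ops])

text \<open>The existence half: passing to the diagonal part is linear, contractive, positive and
  fixes the identity.\<close>

lemma state_diag_part:
  assumes s: "state diagonal_ops s"
  shows "state UNIV (\<lambda>A. s (diag_part A))"
  unfolding state_def
proof (intro conjI ballI allI impI)
  obtain K where K: "\<And>A. A \<in> diagonal_ops \<Longrightarrow> cmod (s A) \<le> K * norm A"
    using state_bounded[OF s] by blast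
  have "cmod (s (diag_part A)) \<le> \<bar>K\<bar> * norm A" for A
  proof -
    have "cmod (s (diag_part A)) \<le> K * norm (diag_part A)" by (rule K[OF diag_part_in_diagonal_ops])
    also have "\<dots> \<le> \<bar>K\<bar> * norm A" by (intro mult_mono norm_diag_part_le) auto
    finally show ?thesis .
  qed
  then show "\<exists>K. \<forall>A\<in>UNIV. cmod (s (diag_part A)) \<le> K * norm A" by blast
qed (simp_all add: diag_part_add diag_part_scaleC diag_part_one state_add[OF s] state_scaleC[OF s]
    state_one[OF s] diag_part_in_diagonal_ops state_pos[OF s] positive_diag_part)

lemma diagonal_ops_compress:
  assumes "A \<in> diagonal_ops"
  shows "proj S * A = diag_op (\<lambda>n. if n \<in> S then diag_entry A n else 0)"
    and "proj S * A \<in> diagonal_ops"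
proof -
  have A: "coord (A \<cdot> x) n = diag_entry A n * coord x n" for x n
    using coord_diag_part[of A x n] diag_part_diagonal[OF assms] by simp
  show eq: "proj S * A = diag_op (\<lambda>n. if n \<in> S then diag_entry A n else 0)"
    by (rule diag_op_eqI[symmetric]) (simp add: times_bop_apply coord_proj A)
  show "proj S * A \<in> diagonal_ops"
    unfolding eq by (rule diag_op_in_diagonal_ops[of _ "norm A"]) (simp add: norm_diag_entry_le)
qed

lemma positive_compress:
  assumes "A \<in> diagonal_ops" "positive_op A"
  shows "positive_op (proj S * A)"
  unfolding diagonal_ops_compress(1)[OF assms(1)]
  by (rule positive_diag_op[of _ "norm A"]) (auto simp: diag_entry_nonneg[OF assms(2)] norm_diag_entry_le)

lemma scaleC_times: "A * scaleC_bop c B = scaleC_bop c (A * B)"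
  by (rule bop_eqI) (simp add: bop_apply_simps bop_scaleC)

text \<open>Conditioning of \<open>s\<close> on the set \<open>S\<close>, as for a finitely additive
  probability.\<close>

lemma state_compress:
  assumes s: "state diagonal_ops s" and t: "s (proj S) = of_real t" "t > 0"
  shows "state diagonal_ops (\<lambda>A. s (proj S * A) / of_real t)"
  unfolding state_def
proof (intro conjI ballI allI impI)
  obtain K where K: "\<And>A. A \<in> diagonal_ops \<Longrightarrow> cmod (s A) \<le> K * norm A"
    using state_bounded[OF s] by blast
  have "cmod (s (proj S * A) / of_real t) \<le> \<bar>K\<bar> * norm (proj S) / t * norm A" if A: "A \<in> diagonal_ops" for A
  proof -
    have "cmod (s (proj S * A)) \<le> K * norm (proj S * A)" by (rule K[OF diagonal_ops_compress(2)[OF A]])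
    also have "\<dots> \<le> \<bar>K\<bar> * (norm (proj S) * norm A)" by (intro mult_mono norm_mult_ineq) auto
    finally show ?thesis using t(2) by (simp add: norm_divide divide_right_mono mult.assoc)
  qed
  then show "\<exists>K. \<forall>A\<in>diagonal_ops. cmod (s (proj S * A) / of_real t) \<le> K * norm A" by blast
  show "s (proj S * (A + B)) / of_real t = s (proj S * A) / of_real t + s (proj S * B) / of_real t"
    if "A \<in> diagonal_ops" "B \<in> diagonal_ops" for A B
    using that by (simp add: distrib_left state_add[OF s] diagonal_ops_compress(2) add_divide_distrib)
  show "s (proj S * scaleC_bop c A) / of_real t = c * (s (proj S * A) / of_real t)" if "A \<in> diagonal_ops" for c A
    using that by (simp add: scaleC_times state_scaleC[OF s] diagonal_ops_compress(2))
  show "0 \<le> s (proj S * A) / of_real t" if "A \<in> diagonal_ops" "positive_op A" for A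
    using state_pos[OF s diagonal_ops_compress(2)[OF that(1)] positive_compress[OF that]] t(2)
    by (simp add: less_eq_complex_def Re_divide_of_real Im_divide_of_real)
  show "s (proj S * 1) / of_real t = 1" using t by simp
qed

lemma state_proj_range:
  assumes "state \<A> s" "\<And>S. proj S \<in> \<A>"
  shows "s (proj S) + s (proj (- S)) = 1" "0 \<le> s (proj S)"
proof -
  have "proj S + proj (- S) = 1" using proj_Un[of S "- S"] by (simp add: proj_UNIV)
  then show "s (proj S) + s (proj (- S)) = 1"
    using state_add[OF assms(1), of "proj S" "proj (- S)"] assms by (simp add: state_one)
  show "0 \<le> s (proj S)" using assms by (intro state_pos positive_proj)
qed

text \<open>With \<open>t = s (proj S)\<close> strictly between 0 and 1, \<open>s\<close> is the
  mixture of its conditionings on \<open>S\<close> and on the complement. Both differ from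
  \<open>s\<close>, because they give probability 1 to the set on which they are
  conditioned.\<close>

lemma pure_state_proj:
  assumes pure: "pure_state diagonal_ops s"
  shows "s (proj S) = 0 \<or> s (proj S) = 1"
proof (rule ccontr)
  assume ne: "\<not> (s (proj S) = 0 \<or> s (proj S) = 1)"
  have s: "state diagonal_ops s" using pure by (simp add: pure_state_def)
  define t where "t = Re (s (proj S))"
  have nn: "0 \<le> s (proj S)" "0 \<le> s (proj (- S))"
    by (rule state_proj_range[OF s proj_in_diagonal_ops])+
  have sum: "s (proj S) + s (proj (- S)) = 1" by (rule state_proj_range[OF s proj_in_diagonal_ops])
  have st: "s (proj S) = of_real t" using nn by (simp add: t_def less_eq_complex_def complex_eq_iff)
  have st': "s (proj (- S)) = of_real (1 - t)" using sum st by (simp add: algebra_simps)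
  have t: "0 < t" "t < 1" using ne nn st st' by (auto simp: less_eq_complex_def less_le)
  define s1 where "s1 = (\<lambda>A. s (proj S * A) / of_real t)"
  define s2 where "s2 = (\<lambda>A. s (proj (- S) * A) / of_real (1 - t))"
  have "state diagonal_ops s1" "state diagonal_ops s2"
    unfolding s1_def s2_def
    by (rule state_compress[OF s st t(1)]) (rule state_compress[OF s st'], use t in simp)
  moreover have "\<not> eq_on diagonal_ops s1 s"
  proof
    assume "eq_on diagonal_ops s1 s"
    then have "s1 (proj S) = s (proj S)" using proj_in_diagonal_ops by (simp add: eq_on_def)
    then show False using t by (simp add: s1_def proj_mult st)
  qed
  moreover have "\<not> eq_on diagonal_ops s2 s"
  proof
    assume "eq_on diagonal_ops s2 s"
    then have "s2 (proj (- S)) = s (proj (- S))" using proj_in_diagonal_ops by (simp add: eq_on_def)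
    then show False using t by (simp add: s2_def proj_mult st')
  qed
  moreover have "eq_on diagonal_ops s (\<lambda>A. of_real t * s1 A + of_real (1 - t) * s2 A)"
    unfolding eq_on_def
  proof
    fix A assume A: "A \<in> diagonal_ops"
    have "A = (proj S + proj (- S)) * A" using proj_Un[of S "- S"] by (simp add: proj_UNIV)
    then have "A = proj S * A + proj (- S) * A" by (simp add: distrib_right)
    then have "s A = s (proj S * A) + s (proj (- S) * A)"
      using state_add[OF s diagonal_ops_compress(2)[OF A] diagonal_ops_compress(2)[OF A]] by metis
    moreover have "(1::complex) - of_real t \<noteq> 0" using t by (metis less_irrefl of_real_1 of_real_eq_iff right_minus_eq)
    ultimately show "s A = of_real t * s1 A + of_real (1 - t) * s2 A" using t by (simp add: s1_def s2_def)
  qed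
  ultimately show False using pure t unfolding pure_state_def by blast
qed

section \<open>States on all operators: absorbing projections of value 1\<close>

lemma state_scaleR: "state UNIV s \<Longrightarrow> s (r *\<^sub>R A) = of_real r * s A"
  by (simp flip: scaleC_bop_of_real add: state_scaleC)

lemma state_uminus: "state UNIV s \<Longrightarrow> s (- A) = - s A"
  using state_scaleR[of s "-1" A] by simp

lemma state_diff: "state UNIV s \<Longrightarrow> s (A - B) = s A - s B"
  using state_add[of UNIV s A "- B"] by (simp add: state_uminus)

lemma cinner_selfadjoint: "selfadjoint A \<Longrightarrow> cinner (A \<cdot> x) y = cinner x (A \<cdot> y)"
  by (simp add: selfadjoint_def)

lemma positive_square: "selfadjoint A \<Longrightarrow> positive_op (A * A)"
  by (simp add: positive_op_def times_bop_apply cinner_self less_eq_complex_def flip: cinner_selfadjoint)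

lemma positive_op_compress_diff:
  assumes H: "selfadjoint H" "contraction_form H"
  shows "positive_op (proj S - proj S * H * proj S)"
  unfolding positive_op_def
proof
  fix x
  define y where "y = proj S \<cdot> x"
  have "proj S \<cdot> y = y" unfolding y_def by (rule ell2_eqI) (simp add: coord_proj)
  then have "cinner x (y - proj S \<cdot> (H \<cdot> y)) = cinner y y - cinner y (H \<cdot> y)"
    using cinner_proj_left[of S x y] cinner_proj_left[of S x "H \<cdot> y"] by (simp add: cinner_diff_right flip: y_def)
  moreover have "Im (cinner y (H \<cdot> y)) = 0" by (rule Im_cinner_selfadjoint[OF H(1)])
  moreover have "\<bar>Re (cinner y (H \<cdot> y))\<bar> \<le> (norm y)\<^sup>2" using H(2) by (simp add: contraction_form_def)
  ultimately show "0 \<le> cinner x ((proj S - proj S * H * proj S) \<cdot> x)"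
    by (simp add: bop_apply_simps cinner_self less_eq_complex_def flip: y_def)
qed

lemma contraction_form_uminus: "contraction_form H \<Longrightarrow> contraction_form (- H)"
proof -
  have "cinner x ((- H) \<cdot> x) = - cinner x (H \<cdot> x)" for x
    using cinner_diff_right[of x 0 "H \<cdot> x"] by (simp add: uminus_bop_apply cinner.rep_eq[of _ 0])
  then show "contraction_form H \<Longrightarrow> contraction_form (- H)" by (simp add: contraction_form_def)
qed

lemma state_compress_bound:
  assumes s: "state UNIV s" and H: "selfadjoint H" "contraction_form H"
  shows "s (proj S * H * proj S) \<le> s (proj S)" "- s (proj S) \<le> s (proj S * H * proj S)"
proof -
  have le: "s (proj S * K * proj S) \<le> s (proj S)" if "selfadjoint K" "contraction_form K" for K
    using state_pos[OF s UNIV_I positive_op_compress_diff[OF that]] by (simp add: state_diff[OF s])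
  show "s (proj S * H * proj S) \<le> s (proj S)" by (rule le[OF H])
  have "s (proj S * (- H) * proj S) \<le> s (proj S)"
    by (intro le selfadjoint_uminus contraction_form_uminus H)
  then show "- s (proj S) \<le> s (proj S * H * proj S)"
    by (simp add: state_uminus[OF s] less_eq_complex_def)
qed

text \<open>Positivity of \<open>(H + x R)\<^sup>2\<close> for all real \<open>x\<close> makes the linear term vanish.\<close>

lemma state_absorb:
  assumes s: "state UNIV s" and P: "s (proj S) = 1" and H: "selfadjoint H" "contraction_form H"
  shows "s H = s (proj S * H * proj S)"
proof -
  define R where "R = proj (- S)"
  have PR: "proj S = 1 - R" using proj_Un[of S "- S"] by (simp add: proj_UNIV R_def eq_diff_eq)
  have sR: "s R = 0" using state_proj_range(1)[OF s, of S] P by (simp add: R_def)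
  have RR: "R * R = R" by (simp add: R_def proj_mult)
  have "s (R * H * R) \<le> 0" "0 \<le> s (R * H * R)"
    using state_compress_bound[OF s H, of "- S"] sR by (simp_all add: R_def)
  then have RHR: "s (R * H * R) = 0" by (rule antisym)
  define L where "L = s (H * R + R * H)"
  have sq: "0 \<le> s (H * H) + of_real x * L" for x :: real
  proof -
    define K where "K = H + x *\<^sub>R R"
    have "selfadjoint K" unfolding K_def R_def by (intro selfadjoint_add selfadjoint_scaleR selfadjoint_proj H)
    then have "0 \<le> s (K * K)" by (intro state_pos[OF s] positive_square) auto
    moreover have "K * K = H * H + (x *\<^sub>R (H * R + R * H) + (x * x) *\<^sub>R R)"
      by (simp add: K_def distrib_left distrib_right RR scaleR_add_right add_ac)
    ultimately show ?thesis by (simp add: state_add[OF s] state_scaleR[OF s] sR L_def)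
  qed
  have "L = 0"
  proof (rule ccontr)
    assume L: "L \<noteq> 0"
    have "Im (s (H * H)) + x * Im L = 0" "0 \<le> Re (s (H * H)) + x * Re L" for x
      using sq[of x] by (auto simp: less_eq_complex_def)
    from this(1)[of 0] this(1)[of 1] this(2)[of "- (Re (s (H * H)) + 1) / Re L"] show False
      using L by (cases "Re L = 0") (simp_all add: complex_eq_iff)
  qed
  \<comment> \<open>The mixed terms are written with the full \<open>H\<close>, so
    \<open>R * H * R\<close> is counted twice and has to be subtracted.\<close>
  have "H = (proj S * H * proj S + (H * R + R * H)) - R * H * R"
    by (simp add: PR algebra_simps)
  then have "s H = s (proj S * H * proj S) + L - s (R * H * R)"
    by (metis L_def UNIV_I s state_add state_diff)
  then show ?thesis using \<open>L = 0\<close> RHR by simp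
qed

lemma exists_color_of_state:
  assumes s: "state UNIV s" and P: "\<And>S. s (proj S) = 0 \<or> s (proj S) = 1" and \<sigma>: "\<And>i. \<sigma> i < (r::nat)"
  shows "\<exists>c. s (proj {i. \<sigma> i = c}) = 1"
proof (rule ccontr)
  assume "\<not> ?thesis"
  then have color: "s (proj {i. \<sigma> i = c}) = 0" for c using P by blast
  have "s (proj {i. \<sigma> i < k}) = 0" for k
  proof (induction k)
    case 0
    have "\<sigma> i \<noteq> r" for i using \<sigma>[of i] by simp
    then have "{i. \<sigma> i < 0} = {i. \<sigma> i = r}" by simp
    then show ?case using color[of r] by (simp only:)
  next
    case (Suc k)
    have "{i. \<sigma> i < Suc k} = {i. \<sigma> i < k} \<union> {i. \<sigma> i = k}" by auto
    then have "proj {i. \<sigma> i < Suc k} = proj {i. \<sigma> i < k} + proj {i. \<sigma> i = k}"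
      using proj_Un[of "{i. \<sigma> i < k}" "{i. \<sigma> i = k}"] by auto
    then show ?case using Suc color by (simp add: state_add[OF s])
  qed
  from this[of r] have "s 1 = 0" using \<sigma> by (simp add: proj_UNIV flip: UNIV_def)
  then show False using state_one[OF s] by simp
qed

lemma norm_proj_apply: "norm (proj S \<cdot> x) \<le> norm x"
proof -
  have "norm (proj S) \<le> 1" unfolding proj_def by (rule norm_diag_op_le) simp
  then have "norm (proj S) * norm x \<le> 1 * norm x" by (rule mult_right_mono) simp
  then show ?thesis using norm_bop_apply[of "proj S" x] by simp
qed

text \<open>Absorption applied to the projection onto \<open>T\<close>, which commutes with the one
  onto \<open>S\<close>.\<close>

lemma state_proj_Int:
  assumes s: "state UNIV s" and S: "s (proj S) = 1" and T: "s (proj T) = 1"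
  shows "s (proj (S \<inter> T)) = 1"
proof -
  have "selfadjoint (proj T)" by (rule selfadjoint_proj)
  moreover have "contraction_form (proj T)"
    unfolding contraction_form_def
  proof
    fix x
    have "norm x * norm (proj T \<cdot> x) \<le> (norm x)\<^sup>2" using norm_proj_apply[of T x] by (simp add: power2_eq_square mult_left_mono)
    then show "\<bar>Re (cinner x (proj T \<cdot> x))\<bar> \<le> (norm x)\<^sup>2"
      using norm_cinner_le[of x "proj T \<cdot> x"] abs_Re_le_cmod[of "cinner x (proj T \<cdot> x)"] by linarith
  qed
  ultimately have "s (proj T) = s (proj S * proj T * proj S)" using state_absorb[OF s S] by blast
  also have "proj S * proj T * proj S = proj (S \<inter> T)" by (simp add: proj_mult Int_ac)
  finally show ?thesis using T by simp
qed

text \<open>Compressing to the intersection of two chosen classes, one for \<open>H\<close> and one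
  for \<open>- H\<close>, leaves the value of the state unchanged but shrinks the form in both
  directions.\<close>

lemma state_zero_diagonal_le:
  assumes s: "state UNIV s" and P: "\<And>S. s (proj S) = 0 \<or> s (proj S) = 1"
    and H: "selfadjoint H" "diag_part H = 0" "contraction_form H"
  shows "cmod (s H) \<le> (4 / 5) ^ m"
  using H
proof (induction m arbitrary: H)
  case 0
  have "proj UNIV * H * proj UNIV = H" by (simp add: proj_UNIV)
  then have "s H \<le> 1" "- 1 \<le> s H"
    using state_compress_bound[OF s 0(1,3), of UNIV] state_one[OF s] by (simp_all add: proj_UNIV)
  then show ?case by (simp add: less_eq_complex_def cmod_eq_Re abs_le_iff)
next
  case (Suc m)
  have paved: "\<exists>S. s (proj S) = 1 \<and> (\<forall>x. Re (cinner (proj S \<cdot> x) (K \<cdot> (proj S \<cdot> x))) \<le> 4 / 5 * (norm (proj S \<cdot> x))\<^sup>2)"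
    if K: "selfadjoint K" "diag_part K = 0" "contraction_form K" for K
  proof -
    obtain \<sigma> :: "nat \<Rightarrow> nat" where \<sigma>: "\<And>i. \<sigma> i < 10"
      "\<And>c x. Re (cinner (proj {i. \<sigma> i = c} \<cdot> x) (K \<cdot> (proj {i. \<sigma> i = c} \<cdot> x)))
        \<le> 4 / 5 * (norm (proj {i. \<sigma> i = c} \<cdot> x))\<^sup>2"
      using infinite_paving[OF K] by blast
    have "\<exists>c. s (proj {i. \<sigma> i = c}) = 1" by (rule exists_color_of_state[OF s P]) (rule \<sigma>(1))
    then show ?thesis using \<sigma>(2) by blast
  qed
  obtain S where S: "s (proj S) = 1"
    "\<And>x. Re (cinner (proj S \<cdot> x) (H \<cdot> (proj S \<cdot> x))) \<le> 4 / 5 * (norm (proj S \<cdot> x))\<^sup>2"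
    using paved[OF Suc.prems] by blast
  have minus: "diag_part (- H) = 0"
    using Suc.prems(2) diag_part_scaleC[of "-1" H] scaleC_bop_of_real[of "-1" H] scaleC_bop_of_real[of "-1" 0] by simp
  obtain T where T: "s (proj T) = 1"
    "\<And>x. Re (cinner (proj T \<cdot> x) ((- H) \<cdot> (proj T \<cdot> x))) \<le> 4 / 5 * (norm (proj T \<cdot> x))\<^sup>2"
    using paved[OF selfadjoint_uminus[OF Suc.prems(1)] minus contraction_form_uminus[OF Suc.prems(3)]] by blast
  define P where "P = proj (S \<inter> T)"
  \<comment> \<open>Rescaling by 5/4 restores the contraction bound, so the induction hypothesis
    applies to \<open>K\<close> and yields one more factor 4/5 for \<open>H\<close>.\<close>
  define K where "K = (5 / 4) *\<^sub>R (P * H * P)"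
  have "selfadjoint K"
    unfolding K_def P_def by (intro selfadjoint_scaleR selfadjoint_compress selfadjoint_proj Suc.prems)
  moreover have "contraction_form K"
    unfolding contraction_form_def
  proof
    fix x
    define y where "y = P \<cdot> x"
    have y: "proj S \<cdot> y = y" "proj T \<cdot> y = y"
      by (auto simp: y_def P_def coord_proj intro!: ell2_eqI)
    have "cinner x (K \<cdot> x) = of_real (5 / 4) * cinner y (H \<cdot> y)"
      by (simp only: K_def y_def P_def scaleR_bop_apply cinner_scaleC_right times_bop_apply cinner_proj_left)
    then have "Re (cinner x (K \<cdot> x)) = 5 / 4 * Re (cinner y (H \<cdot> y))"
      by (simp only: times_complex.sel Re_complex_of_real Im_complex_of_real)
    moreover have "Re (cinner y (H \<cdot> y)) \<le> 4 / 5 * (norm y)\<^sup>2" using S(2)[of y] y by simp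
    moreover have "- Re (cinner y (H \<cdot> y)) \<le> 4 / 5 * (norm y)\<^sup>2"
      using T(2)[of y] y cinner_diff_right[of y 0 "H \<cdot> y"]
      by (simp add: uminus_bop_apply cinner.rep_eq[of _ 0])
    moreover have "(norm y)\<^sup>2 \<le> (norm x)\<^sup>2"
      unfolding y_def P_def by (intro power_mono norm_proj_apply) simp
    ultimately show "\<bar>Re (cinner x (K \<cdot> x))\<bar> \<le> (norm x)\<^sup>2" by linarith
  qed
  moreover have "diag_part K = 0"
    unfolding diag_part_0_iff
  proof
    fix n
    have "P \<cdot> ket n = ket n \<or> P \<cdot> ket n = 0"
    proof (cases "n \<in> S \<inter> T")
      case True
      then have "P \<cdot> ket n = ket n" by (intro ell2_eqI) (auto simp: P_def coord_proj coord_ket)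
      then show ?thesis ..
    next
      case False
      then have "P \<cdot> ket n = 0" by (intro ell2_eqI) (auto simp: P_def coord_proj coord_ket)
      then show ?thesis ..
    qed
    then have "cinner (P \<cdot> ket n) (H \<cdot> (P \<cdot> ket n)) = 0"
      using Suc.prems(2) by (auto simp: diag_part_0_iff diag_entry_def)
    moreover have "diag_entry K n = of_real (5 / 4) * cinner (P \<cdot> ket n) (H \<cdot> (P \<cdot> ket n))"
      by (simp only: diag_entry_def K_def P_def scaleR_bop_apply cinner_scaleC_right times_bop_apply cinner_proj_left)
    ultimately show "diag_entry K n = 0" by simp
  qed
  ultimately have "cmod (s K) \<le> (4 / 5) ^ m" using Suc.IH by blast
  moreover have "s H = s (P * H * P)"
    unfolding P_def by (rule state_absorb[OF s state_proj_Int[OF s S(1) T(1)] Suc.prems(1,3)])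
  then have "s K = of_real (5 / 4) * s H" unfolding K_def by (simp only: state_scaleR[OF s])
  then have "cmod (s K) = 5 / 4 * cmod (s H)" by (simp only: norm_mult norm_of_real)
  ultimately show ?case by simp
qed

lemma state_zero_diagonal:
  assumes s: "state UNIV s" and P: "\<And>S. s (proj S) = 0 \<or> s (proj S) = 1"
    and H: "selfadjoint H" "diag_part H = 0"
  shows "s H = 0"
proof -
  \<comment> \<open>Scales \<open>H\<close> to a contraction; the summand 1 covers
    \<open>H = 0\<close>.\<close>
  define r where "r = 1 / (norm H + 1)"
  have r: "r > 0" by (simp add: r_def add_nonneg_pos)
  define K where "K = r *\<^sub>R H"
  have "selfadjoint K" unfolding K_def by (intro selfadjoint_scaleR H)
  moreover have "diag_part K = 0"
    using H(2) diag_part_scaleC[of "of_real r" H] scaleC_bop_of_real[of r H] scaleC_bop_of_real[of r 0]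
    by (simp add: K_def)
  moreover have "contraction_form K"
    unfolding contraction_form_def
  proof
    fix x
    have "norm (K \<cdot> x) \<le> norm K * norm x" by (rule norm_bop_apply)
    also have "\<dots> \<le> 1 * norm x"
      by (intro mult_right_mono) (simp_all add: K_def r_def divide_le_eq add_nonneg_pos)
    finally have "norm x * norm (K \<cdot> x) \<le> (norm x)\<^sup>2" by (simp add: power2_eq_square mult_left_mono)
    then show "\<bar>Re (cinner x (K \<cdot> x))\<bar> \<le> (norm x)\<^sup>2"
      using norm_cinner_le[of x "K \<cdot> x"] abs_Re_le_cmod[of "cinner x (K \<cdot> x)"] by linarith
  qed
  ultimately have le: "cmod (s K) \<le> (4 / 5) ^ m" for m using state_zero_diagonal_le[OF s P] by blast
  have "(\<lambda>m. (4 / 5 :: real) ^ m) \<longlonglongrightarrow> 0" by (rule LIMSEQ_realpow_zero) auto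
  then have "cmod (s K) \<le> 0" by (rule LIMSEQ_le_const) (use le in blast)
  then have "s K = 0" by simp
  then show ?thesis using r by (simp add: K_def state_scaleR[OF s])
qed

text \<open>The remainder after subtracting the diagonal part has zero diagonal, and so have its two
  selfadjoint parts, on which the state vanishes.\<close>

lemma state_eq_diag_part:
  assumes s: "state UNIV s" and P: "\<And>S. s (proj S) = 0 \<or> s (proj S) = 1"
  shows "s A = s (diag_part A)"
proof -
  define Z where "Z = A - diag_part A"
  have "diag_part Z = 0"
  proof -
    have "A = Z + diag_part A" by (simp add: Z_def)
    then have "diag_part A = diag_part Z + diag_part (diag_part A)" by (metis diag_part_add)
    then show ?thesis by (simp add: diag_part_diagonal[OF diag_part_in_diagonal_ops])
  qed
  then obtain H K where HK: "selfadjoint H" "selfadjoint K" "Z = H + scaleC_bop \<i> K"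
    "diag_part H = 0" "diag_part K = 0"
    using selfadjoint_decomposition[of Z] by blast
  have "s Z = s H + \<i> * s K" unfolding HK(3) by (simp add: state_add[OF s] state_scaleC[OF s])
  then have "s Z = 0" using state_zero_diagonal[OF s P] HK by simp
  then show ?thesis by (simp add: Z_def state_diff[OF s])
qed

theorem mainTheorem1:
  fixes s :: "bop \<Rightarrow> complex"
  assumes "pure_state diagonal_ops s"
  shows "\<exists>!s'. state UNIV s' \<and> eq_on diagonal_ops s' s"
proof (rule ex1I[of _ "\<lambda>A. s (diag_part A)"])
  have s: "state diagonal_ops s" using assms by (simp add: pure_state_def)
  show "state UNIV (\<lambda>A. s (diag_part A)) \<and> eq_on diagonal_ops (\<lambda>A. s (diag_part A)) s"
    using state_diag_part[OF s] by (simp add: eq_on_def diag_part_diagonal)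
  fix s' assume s': "state UNIV s' \<and> eq_on diagonal_ops s' s"
  then have eq: "s' A = s A" if "A \<in> diagonal_ops" for A using that by (simp add: eq_on_def)
  \<comment> \<open>Projections onto coordinate sets are diagonal, so every extension inherits the
    values 0 and 1 from \<open>s\<close>; its values on diagonal parts are those of \<open>s\<close>
    as well.\<close>
  have "s' A = s (diag_part A)" for A
    using state_eq_diag_part[of s' A] s' pure_state_proj[OF assms]
    by (simp add: eq proj_in_diagonal_ops diag_part_in_diagonal_ops)
  then show "s' = (\<lambda>A. s (diag_part A))" by blast
qed

end
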